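(* Let $x_o\in\mathfrak b_{e,\Omega(n)}$ and $z_o\in\pi_n^{-1}(x_o)$, let $V_{x_o}$ be a connected (Euclidean) open neighborhood of $x_o$ in $\mathfrak b_{e,\Omega(n)}$ evenly covered by the covering $\pi_n:\pi_n^{-1}(\mathfrak b_{e,\Omega(n)})\to\mathfrak b_{e,\Omega(n)}$, let $V_{z_o}$ be the connected component of $\pi_n^{-1}(V_{x_o})$ containing $z_o$, let $W_z=A_{\mathfrak r}\cdot V_{z_o}$ and let $W_x=\pi_n(W_z)$ (an open subset of $M_\Omega(n)$). Then $V_{x_o}$ is a Lagrangian submanifold of $W_x$.
   Context: Fix a positive integer $n$. For $k\ge 0$ put $d(k)=k(k+1)/2$ and $I_k=\{1,\dots,k\}$. $M(n)$ is the space of complex $n\times n$ matrices; for $x\in M(n)$ and $m\in I_n$, $x_m$ is the upper left $m\times m$ block of $x$. $M_\Omega(n)$ is the Zariski open set of all $x\in M(n)$ such that $x_m$ has $m$ distinct eigenvalues for every $m\in I_n$, and $x_m,x_{m+1}$ have no common eigenvalue for every $m\in I_{n-1}$. $\mathfrak b_e$ is the set of $x\in M(n)$ with $x_{i+1,i}=1$ for all $i\in I_{n-1}$ and $x_{i,j}=0$ for $i>j+1$ (Hessenberg matrices), and $\mathfrak b_{e,\Omega(n)}=\mathfrak b_e\cap M_\Omega(n)$. $\mathfrak e_{\Omega(n)}$ is the set of all $\nu=(\nu(1),\dots,\nu(n))$, $\nu(m)=\mathrm{diag}(\nu_{1\,m},\dots,\nu_{m\,m})$, such that for each $m\in I_n$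 the numbers $\nu_{1\,m},\dots,\nu_{m\,m}$ are distinct and $\nu_{i\,m}\ne\nu_{j\,m+1}$ for all $m\in I_{n-1}$, $i\in I_m$, $j\in I_{m+1}$. Let $$M_\Omega(n,\mathfrak e)=\{(\nu,x)\in\mathfrak e_{\Omega(n)}\times M_\Omega(n)\mid \nu(m)\text{ is } Gl(m)\text{-conjugate to }x_m\ \forall m\in I_n\},$$ a nonsingular affine variety of dimension $n^2$; $\pi_n(\nu,x)=x$ is an analytic covering of $M_\Omega(n)$. For $m\in I_n$, $k\in I_m$ let $r_{d(m-1)+k}(\nu,x)=\nu_{k\,m}$. Poisson structure: on $M(n)$, $[f,g](x)=\mathrm{tr}(x[\nabla f(x),\nabla g(x)])$, where $\mathrm{tr}(\nabla f(x)v)=df_x(v)$; it lifts to $M_\Omega(n,\mathfrak e)$ via $\pi_n$. For a function $\varphi$, $\xi_\varphi$ is the vector field with $\xi_\varphi\psi=[\varphi,\psi]$. The vector fields $\xi_{r_j}$, $j\in I_{d(n-1)}$, on $M_\Omega(n,\mathfrak e)$ commute and have globally defined complex flows $\exp q\,\xi_{r_j}$, trivial for $q\in 2\pi i\,\mathbb Z$; the torus $A_{\mathfrak r}\cong(\mathbb C^\times)^{d(n-1)}$ acts on $M_\Omega(n,\mathfrak e)$, the element with coordinates $e^{q_j}$ acting as $\prod_j\exp q_j\,\xi_{r_j}$. Every $Gl(n)$-adjoint orbit $O\subset M(n)$ carries its standard (Kirillov–Kostant–Souriau) symplectic form: at $y\in O$, for the tangent vectors $[-u,y],[-v,y]$ with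 $u,v\in M(n)$, $\omega_y([-u,y],[-v,y])=\mathrm{tr}(y[u,v])$. A submanifold $X$ of $W_x$ is called Lagrangian in $W_x$ if $\dim X=d(n)$ and, for every $Gl(n)$-adjoint orbit $O$ of regular semisimple elements with $O\cap X\neq\emptyset$, $O\cap X$ is a Lagrangian submanifold of the symplectic manifold $O$. *)

theory Defs
  imports "Jordan_Normal_Form.Char_Poly" "HOL-Analysis.Analysis"
begin

no_notation Matrix.vec_index (infixl "$" 100)

section \<open>Matrices and their upper left blocks\<close>

text \<open>
  The space \<open>M(n)\<close> is \<open>complex^'n^'n\<close> with \<open>n = CARD('n)\<close>, where the linear order on the index
  type identifies it with \<open>I_n = {1..n}\<close>.  The blocks \<open>x_m\<close>, whose size varies, are matrices
  of \<open>Jordan_Normal_Form\<close> (which are indexed from 0).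
\<close>

type_synonym 'n cmat = "complex^'n^'n"

definition d_fun :: "nat \<Rightarrow> nat" where
  "d_fun k = k * (k + 1) div 2"

definition ix :: "nat \<Rightarrow> 'n::{finite,linorder}" where
  "ix i = sorted_list_of_set (UNIV :: 'n set) ! (i - 1)"

definition ent :: "'n::{finite,linorder} cmat \<Rightarrow> nat \<Rightarrow> nat \<Rightarrow> complex" where
  "ent x i j = x $ ix i $ ix j"

definition block :: "nat \<Rightarrow> 'n::{finite,linorder} cmat \<Rightarrow> complex Matrix.mat" where
  "block m x = Matrix.mat m m (\<lambda>(i, j). ent x (i + 1) (j + 1))"

definition M_Omega :: "('n::{finite,linorder} cmat) set" where
  "M_Omega = {x.
     (\<forall>m\<in>{1..CARD('n)}. card {c. eigenvalue (block m x) c} = m) \<and>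
     (\<forall>m\<in>{1..CARD('n) - 1}.
        \<not> (\<exists>c. eigenvalue (block m x) c \<and> eigenvalue (block (m + 1) x) c))}"

definition b_e :: "('n::{finite,linorder} cmat) set" where
  "b_e = {x.
     (\<forall>i\<in>{1..CARD('n) - 1}. ent x (i + 1) i = 1) \<and>
     (\<forall>i\<in>{1..CARD('n)}. \<forall>j\<in>{1..CARD('n)}. i > j + 1 \<longrightarrow> ent x i j = 0)}"

definition b_e_Omega :: "('n::{finite,linorder} cmat) set" where
  "b_e_Omega = b_e \<inter> M_Omega"


section \<open>The covering of the set \<open>M_Omega\<close>\<close>

text \<open>
  A tuple \<open>\<nu> = (\<nu>(1), \<dots>, \<nu>(n))\<close> of diagonal matrices is encoded by \<open>\<nu> k m = \<nu>\<^sub>k\<^sub>m\<close>, extended by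
  zero outside \<open>1 \<le> k \<le> m \<le> n\<close>, so that the product topology of the function type induces
  the usual topology on these tuples.
\<close>

type_synonym tuple = "nat \<Rightarrow> nat \<Rightarrow> complex"

definition nu_mat :: "tuple \<Rightarrow> nat \<Rightarrow> complex Matrix.mat" where
  "nu_mat \<nu> m = Matrix.mat m m (\<lambda>(i, j). if i = j then \<nu> (i + 1) m else 0)"

definition e_Omega :: "nat \<Rightarrow> tuple set" where
  "e_Omega n = {\<nu>.
     (\<forall>k m. \<not> (1 \<le> k \<and> k \<le> m \<and> m \<le> n) \<longrightarrow> \<nu> k m = 0) \<and>
     (\<forall>m\<in>{1..n}. inj_on (\<lambda>k. \<nu> k m) {1..m}) \<and>
     (\<forall>m\<in>{1..n - 1}. \<forall>i\<in>{1..m}. \<forall>j\<in>{1..m + 1}. \<nu> i m \<noteq> \<nu> j (m + 1))}"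

definition M_Omega_e :: "(tuple \<times> 'n::{finite,linorder} cmat) set" where
  "M_Omega_e = {(\<nu>, x). \<nu> \<in> e_Omega CARD('n) \<and> x \<in> M_Omega \<and>
     (\<forall>m\<in>{1..CARD('n)}. similar_mat (nu_mat \<nu> m) (block m x))}"

abbreviation pi_n :: "tuple \<times> 'n::{finite,linorder} cmat \<Rightarrow> 'n cmat" where
  "pi_n \<equiv> snd"

definition r_fun :: "nat \<Rightarrow> tuple \<times> 'n::{finite,linorder} cmat \<Rightarrow> complex" where
  "r_fun j z = (let m = (LEAST m. j \<le> d_fun m) in fst z (j - d_fun (m - 1)) m)"

lemma r_index:
  assumes "1 \<le> k" "k \<le> m"
  shows "r_fun (d_fun (m - 1) + k) (\<nu>, x) = \<nu> k m"
proof -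
  have d_Suc: "d_fun (Suc i) = d_fun i + Suc i" for i
    by (simp add: d_fun_def)
  have mono: "d_fun i \<le> d_fun j" if "i \<le> j" for i j
    using lift_Suc_mono_le[of d_fun i j] that by (simp add: d_Suc)
  obtain l where l: "m = Suc l"
    using assms by (cases m) auto
  have "(LEAST m'. d_fun (m - 1) + k \<le> d_fun m') = m"
  proof (rule Least_equality)
    show "d_fun (m - 1) + k \<le> d_fun m"
      using assms l d_Suc[of l] by simp
  next
    fix y assume y: "d_fun (m - 1) + k \<le> d_fun y"
    show "m \<le> y"
    proof (rule ccontr)
      assume "\<not> m \<le> y"
      then have "d_fun y \<le> d_fun (m - 1)"
        using l by (intro mono) simp
      with y assms show False by simp
    qed
  qed
  then show ?thesis
    by (simp add: r_fun_def)
qed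

text \<open>As in the definition of \<open>covering_space\<close> in the library.\<close>

definition evenly_covered ::
  "'a::topological_space set \<Rightarrow> ('a \<Rightarrow> 'b::topological_space) \<Rightarrow> 'b set \<Rightarrow> bool" where
  "evenly_covered C p T \<longleftrightarrow>
     (\<exists>\<U>. \<Union>\<U> = C \<inter> p -` T \<and>
          (\<forall>U\<in>\<U>. openin (top_of_set C) U) \<and>
          pairwise disjnt \<U> \<and>
          (\<forall>U\<in>\<U>. \<exists>q. homeomorphism U T p q))"


section \<open>Holomorphic functions and the Poisson structure\<close>

definition cscale :: "complex \<Rightarrow> complex^'n^'m \<Rightarrow> complex^'n^'m" where
  "cscale c v = (\<chi> i j. c * v $ i $ j)"

definition holo_on :: "('n::finite cmat) set \<Rightarrow> ('n cmat \<Rightarrow> complex) \<Rightarrow> bool" where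
  "holo_on U f \<longleftrightarrow>
     (\<forall>x\<in>U. \<exists>D. (f has_derivative D) (at x) \<and> (\<forall>c v. D (cscale c v) = c * D v))"

definition holo_map_on ::
  "('n::finite cmat) set \<Rightarrow> ('n cmat \<Rightarrow> 'n cmat) \<Rightarrow> bool" where
  "holo_map_on U F \<longleftrightarrow> (\<forall>i j. holo_on U (\<lambda>x. F x $ i $ j))"

definition commutator :: "'n cmat \<Rightarrow> 'n cmat \<Rightarrow> 'n::finite cmat" where
  "commutator u v = u ** v - v ** u"

definition grad :: "('n::finite cmat \<Rightarrow> complex) \<Rightarrow> 'n cmat \<Rightarrow> 'n cmat" where
  "grad f x = (THE w. (f has_derivative (\<lambda>v. trace (w ** v))) (at x))"

definition poisson ::
  "('n::finite cmat \<Rightarrow> complex) \<Rightarrow> ('n cmat \<Rightarrow> complex) \<Rightarrow> 'n cmat \<Rightarrow> complex" where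
  "poisson f g x = trace (x ** commutator (grad f x) (grad g x))"

text \<open>
  The complex structure and the Poisson bracket of \<open>M_Omega_e\<close> are those for which \<open>pi_n\<close> is
  a local isomorphism: near \<open>z\<close>, a function \<open>\<psi>\<close> is identified with \<open>\<psi> \<circ> section_at z\<close>, where
  \<open>section_at z\<close> is a local section of \<open>pi_n\<close> through \<open>z\<close>.  Its germ at \<open>pi_n z\<close> does not
  depend on the choice, since \<open>pi_n\<close> is a covering.
\<close>

definition section_at ::
  "tuple \<times> 'n cmat \<Rightarrow> 'n cmat \<Rightarrow> tuple \<times> 'n::{finite,linorder} cmat" where
  "section_at z = (SOME s. \<exists>U. open U \<and> pi_n z \<in> U \<and> continuous_on U s \<and>
      (\<forall>x\<in>U. s x \<in> M_Omega_e \<and> pi_n (s x) = x) \<and> s (pi_n z) = z)"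

definition holo_near ::
  "tuple \<times> 'n::{finite,linorder} cmat \<Rightarrow> (tuple \<times> 'n cmat \<Rightarrow> complex) \<Rightarrow> bool" where
  "holo_near z \<psi> \<longleftrightarrow> (\<exists>U. open U \<and> pi_n z \<in> U \<and> holo_on U (\<psi> \<circ> section_at z))"

definition lifted_poisson ::
  "(tuple \<times> 'n cmat \<Rightarrow> complex) \<Rightarrow> (tuple \<times> 'n cmat \<Rightarrow> complex) \<Rightarrow>
     tuple \<times> 'n::{finite,linorder} cmat \<Rightarrow> complex" where
  "lifted_poisson \<phi> \<psi> z = poisson (\<phi> \<circ> section_at z) (\<psi> \<circ> section_at z) (pi_n z)"

text \<open>
  The vector field \<open>\<xi>\<^sub>\<phi>\<close> is given as a derivation, \<open>\<xi>\<^sub>\<phi> \<psi> = [\<phi>, \<psi>]\<close>; accordingly, integral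
  curves with complex time are tested on all functions holomorphic near the point in question.
\<close>

definition integral_curve ::
  "(tuple \<times> 'n cmat \<Rightarrow> complex) \<Rightarrow> (complex \<Rightarrow> tuple \<times> 'n::{finite,linorder} cmat) \<Rightarrow> bool"
  where
  "integral_curve \<phi> \<gamma> \<longleftrightarrow> range \<gamma> \<subseteq> M_Omega_e \<and>
     (\<forall>q \<psi>. holo_near (\<gamma> q) \<psi> \<longrightarrow>
        ((\<psi> \<circ> \<gamma>) has_field_derivative lifted_poisson \<phi> \<psi> (\<gamma> q)) (at q))"

definition exp_xi ::
  "(tuple \<times> 'n cmat \<Rightarrow> complex) \<Rightarrow> complex \<Rightarrow>
     tuple \<times> 'n cmat \<Rightarrow> tuple \<times> 'n::{finite,linorder} cmat" where
  "exp_xi \<phi> q z = (THE \<gamma>. integral_curve \<phi> \<gamma> \<and> \<gamma> 0 = z) q"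

text \<open>
  The action of the element of the torus \<open>A_r\<close> with coordinates \<open>exp (q j)\<close>,
  \<open>1 \<le> j \<le> d_fun (n - 1)\<close>.  As \<open>exp\<close> maps onto the nonzero complex numbers, every element of the
  torus has this form.
\<close>

definition A_act ::
  "(nat \<Rightarrow> complex) \<Rightarrow> tuple \<times> 'n cmat \<Rightarrow> tuple \<times> 'n::{finite,linorder} cmat" where
  "A_act q = fold (\<lambda>j. exp_xi (r_fun j) (q j)) [1..<Suc (d_fun (CARD('n) - 1))]"


section \<open>Lagrangian submanifolds\<close>

text \<open>
  \<open>X\<close> is an embedded complex submanifold of dimension \<open>k\<close> of the open set \<open>W\<close>: it is flattened
  to a \<open>k\<close>-dimensional coordinate subspace by holomorphic charts of \<open>W\<close>.
\<close>

definition submanifold_of ::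
  "('n::finite cmat) set \<Rightarrow> nat \<Rightarrow> ('n cmat) set \<Rightarrow> bool" where
  "submanifold_of W k X \<longleftrightarrow> X \<subseteq> W \<and>
     (\<forall>p\<in>X. \<exists>U \<Phi> \<Psi> S.
        open U \<and> p \<in> U \<and> U \<subseteq> W \<and> open (\<Phi> ` U) \<and>
        holo_map_on U \<Phi> \<and> holo_map_on (\<Phi> ` U) \<Psi> \<and> (\<forall>x\<in>U. \<Psi> (\<Phi> x) = x) \<and>
        card S = k \<and>
        \<Phi> ` (U \<inter> X) = {y \<in> \<Phi> ` U. \<forall>i j. (i, j) \<notin> S \<longrightarrow> y $ i $ j = 0})"

definition tangent_space ::
  "('n::finite cmat) set \<Rightarrow> 'n cmat \<Rightarrow> ('n cmat) set" where
  "tangent_space X y = {v. \<exists>\<gamma> :: real \<Rightarrow> 'n cmat.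
     \<gamma> 0 = y \<and> (\<forall>\<^sub>F t in nhds 0. \<gamma> t \<in> X) \<and> (\<gamma> has_vector_derivative v) (at 0)}"

definition adjoint_orbit :: "'n::finite cmat \<Rightarrow> ('n cmat) set" where
  "adjoint_orbit a = {g ** a ** matrix_inv g | g. invertible g}"

definition regular_semisimple :: "'n::finite cmat \<Rightarrow> bool" where
  "regular_semisimple a \<longleftrightarrow>
     (\<exists>c :: 'n \<Rightarrow> complex. inj c \<and> a \<in> adjoint_orbit (\<chi> i j. if i = j then c i else 0))"

definition orbit_tangent :: "'n::finite cmat \<Rightarrow> ('n cmat) set" where
  "orbit_tangent y = range (\<lambda>u. commutator (- u) y)"

definition kks :: "'n::finite cmat \<Rightarrow> 'n cmat \<Rightarrow> 'n cmat \<Rightarrow> complex" where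
  "kks y \<xi> \<eta> = (THE c. \<exists>u v. \<xi> = commutator (- u) y \<and> \<eta> = commutator (- v) y \<and>
                           c = trace (y ** commutator u v))"

lemma kks_commutator:
  fixes u v y :: "'n::finite cmat"
  shows "kks y (commutator (- u) y) (commutator (- v) y) = trace (y ** commutator u v)"
proof -
  have neg: "commutator (- u) y = commutator y u" for u y :: "'n cmat"
    by (simp add: commutator_def matrix_matrix_mult_def vec_eq_iff sum_negf)
  have diff: "y ** (a - b) = y ** a - y ** b" "(a - b) ** y = a ** y - b ** y"
    for a b y :: "'n cmat"
    by (simp_all add: matrix_matrix_mult_def vec_eq_iff algebra_simps sum_subtractf)
  have tr: "trace (y ** commutator u v) = trace (commutator y u ** v)"
    for y u v :: "'n cmat"
  proof -
    have "trace (y ** (v ** u)) = trace ((u ** y) ** v)"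
      using trace_mul_sym[of "y ** v" u] by (simp add: matrix_mul_assoc)
    then show ?thesis
      by (simp add: commutator_def diff trace_sub matrix_mul_assoc)
  qed
  have anti: "trace (y ** commutator u v) = - trace (commutator y v ** u)"
    for y u v :: "'n cmat"
    using tr[of y v u] by (simp add: commutator_def diff trace_sub) (metis minus_diff_eq)
  show ?thesis
    unfolding kks_def neg
  proof (rule the_equality, goal_cases)
    case 1
    show ?case by blast
  next
    case (2 c)
    then obtain u' v' where u': "commutator y u = commutator y u'"
      and v': "commutator y v = commutator y v'" and c: "c = trace (y ** commutator u' v')"
      by blast
    have "c = trace (commutator y u ** v')"
      using c u' tr[of y u' v'] by simp
    also have "\<dots> = trace (y ** commutator u v')"
      using tr[of y u v'] by simp
    also have "\<dots> = - trace (commutator y v ** u)"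
      using v' anti[of y u v'] by simp
    also have "\<dots> = trace (y ** commutator u v)"
      using anti[of y u v] by simp
    finally show ?case .
  qed
qed

text \<open>
  For a regular semisimple orbit \<open>Q\<close>, a closed embedded submanifold of \<open>M(n)\<close>, the
  submanifolds of \<open>Q\<close> are those of \<open>M(n)\<close> contained in \<open>Q\<close>.  A submanifold \<open>L\<close> is Lagrangian if
  each tangent space is its own symplectic complement, that is, isotropic of half the dimension.
\<close>

definition lagrangian_in_orbit ::
  "('n::finite cmat) set \<Rightarrow> ('n cmat) set \<Rightarrow> bool" where
  "lagrangian_in_orbit Q L \<longleftrightarrow> L \<subseteq> Q \<and> (\<exists>k. submanifold_of UNIV k L) \<and>
     (\<forall>y\<in>L. tangent_space L y =
        {\<xi> \<in> orbit_tangent y. \<forall>\<eta>\<in>tangent_space L y. kks y \<xi> \<eta> = 0})"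

definition lagrangian_in ::
  "('n::{finite,linorder} cmat) set \<Rightarrow> ('n cmat) set \<Rightarrow> bool" where
  "lagrangian_in W X \<longleftrightarrow> submanifold_of W (d_fun CARD('n)) X \<and>
     (\<forall>a. regular_semisimple a \<and> adjoint_orbit a \<inter> X \<noteq> {} \<longrightarrow>
        lagrangian_in_orbit (adjoint_orbit a) (adjoint_orbit a \<inter> X))"

end

theory Submission
  imports Defs
begin

text \<open>
  In a Hessenberg matrix, row \<open>m + 1\<close> of the block \<open>x\<^sub>m\<^sub>+\<^sub>1\<close>, restricted to its first \<open>m\<close> entries, is
  the last unit vector.  The eigenvalue \<open>\<nu>\<^sub>k\<^sub>m\<close> has gradient the spectral projection \<open>P\<^sub>k\<^sub>m\<close>
  of \<open>x\<^sub>m\<close>; since \<open>x\<^sub>m\<close> does not change along its flow, the flow is conjugation by \<open>exp (-q P\<^sub>k\<^sub>m)\<close>.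
  For \<open>x\<close> close to a Hessenberg matrix one can therefore normalise the rows \<open>n, \<dots>, 2\<close> successively
  by flows of the levels \<open>n - 1, \<dots>, 1\<close> with parameters close to \<open>0\<close>: this writes \<open>x\<close> as a
  torus translate of a nearby Hessenberg matrix with the same \<open>\<nu>\<close>, so that \<open>W\<^sub>x\<close> is a
  neighbourhood of \<open>V\<^sub>x\<close>.  For the second half, the first unit vector is cyclic for a Hessenberg
  matrix \<open>y\<close>, which shows that an element of the orbit's tangent space at \<open>y\<close> is upper triangular
  iff it is \<open>[y, u]\<close> with \<open>u\<close> strictly upper triangular.  These elements form the tangent space
  of the intersection, and under the trace form the upper triangular matrices are the
  complement of the strictly upper triangular ones.
\<close>

section \<open>Indices, blocks and eigenvalues\<close>

text \<open>The flows are given only as a \<open>THE\<close> over curves tested on germs of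
  holomorphic functions on the covering, so conjugation must be shown to be an integral curve and
  the only one. For uniqueness it suffices to test on the coordinates \<nu> and on the matrix
  entries: the former are constant because the eigenvalue functions Poisson commute, and, the block
  of size m standing still, the latter satisfy a linear equation with constant coefficients.
  Normalising row m + 1 requires division by entries in row m of the projections of level m. That
  these rows do not vanish is where the condition that consecutive blocks share no eigenvalue
  enters. The intersection with an orbit needs a chart of its own. By cyclicity the matrix equation
  f(x) = 0, with f the characteristic polynomial of the orbit, reduces on Hessenberg matrices to its
  first column, and there the last column of x enters affinely with coefficient 1, so one can solve
  for it. No half-dimension count is made: that each tangent space is its own symplectic complement
  is checked directly.\<close>

definition rk :: "'n::{finite,linorder} \<Rightarrow> nat" where
  "rk = inv_into {1..CARD('n)} ix"

lemma bij_ix: "bij_betw (ix :: nat \<Rightarrow> 'n::{finite,linorder}) {1..CARD('n)} UNIV"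
proof -
  have 1: "bij_betw (\<lambda>i::nat. i - 1) {1..CARD('n)} {..<CARD('n)}"
    by (rule bij_betwI[where g = Suc]) auto
  have "bij_betw ((!) (sorted_list_of_set (UNIV :: 'n set))) {..<CARD('n)} UNIV"
    by (rule bij_betw_nth) auto
  from bij_betw_trans[OF 1 this] show ?thesis
    by (simp add: o_def ix_def[abs_def])
qed

lemma rk_le [simp]: "rk (i :: 'n::{finite,linorder}) \<le> CARD('n)"
  and rk_ge1: "1 \<le> rk i"
  using bij_betw_apply[OF bij_betw_inv_into[OF bij_ix[where 'n='n]], of i]
  by (auto simp: rk_def)

lemma ix_rk [simp]: "ix (rk i) = (i :: 'n::{finite,linorder})"
  unfolding rk_def by (rule bij_betw_inv_into_right[OF bij_ix]) simp

lemma rk_ix [simp]: "1 \<le> k \<Longrightarrow> k \<le> CARD('n) \<Longrightarrow> rk (ix k :: 'n::{finite,linorder}) = k"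
  unfolding rk_def by (rule bij_betw_inv_into_left[OF bij_ix]) simp

lemma rk_eq_iff [simp]: "rk i = rk j \<longleftrightarrow> i = (j :: 'n::{finite,linorder})"
  by (metis ix_rk)

lemma rk_Suc_diff: "Suc (rk i - 1) = rk (i :: 'n::{finite,linorder})"
  using rk_ge1[of i] by simp

lemma rk_Suc_diff' [simp]: "Suc (rk i - Suc 0) = rk (i :: 'n::{finite,linorder})"
  using rk_ge1[of i] by simp

lemma rk_less: "rk (i :: 'n::{finite,linorder}) \<le> m \<Longrightarrow> rk i - Suc 0 < m"
  using rk_ge1[of i] by simp

text \<open>Translates sums over positions \<open>0..<m\<close>, as they occur in products of
  blocks, into sums over the index type; later computations take place in the fixed type
  \<open>'n cmat\<close>.\<close>

lemma sum_block:
  fixes f :: "'n::{finite,linorder} \<Rightarrow> 'a::comm_monoid_add"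
  assumes "m \<le> CARD('n)"
  shows "(\<Sum>k=0..<m. f (ix (Suc k))) = (\<Sum>i\<in>UNIV. if rk i \<le> m then f i else 0)"
proof -
  have "(\<Sum>i\<in>UNIV. if rk i \<le> m then f i else 0) = (\<Sum>i | rk i \<le> m. f i)"
    by (simp add: sum.If_cases)
  also have "\<dots> = (\<Sum>k=0..<m. f (ix (Suc k)))"
    using assms
    by (intro sum.reindex_bij_witness[where i = "\<lambda>k. ix (Suc k)" and j = "\<lambda>i. rk i - 1"])
       (auto simp: rk_Suc_diff intro: rk_less)
  finally show ?thesis ..
qed

text \<open>Blocks of all sizes are kept as n by n matrices padded by zeros, so that projections of
  different levels can be multiplied with each other and with \<open>x\<close>. The matrices with
  \<open>supp m\<close> form an algebra whose unit is \<open>cut m (mat 1)\<close>, not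
  \<open>mat 1\<close>.\<close>

definition supp :: "nat \<Rightarrow> 'n::{finite,linorder} cmat \<Rightarrow> bool" where
  "supp m A \<longleftrightarrow> (\<forall>i j. A $ i $ j \<noteq> 0 \<longrightarrow> rk i \<le> m \<and> rk j \<le> m)"

definition cut :: "nat \<Rightarrow> 'n cmat \<Rightarrow> 'n::{finite,linorder} cmat" where
  "cut m A = (\<chi> i j. if rk i \<le> m \<and> rk j \<le> m then A $ i $ j else 0)"

definition emb :: "nat \<Rightarrow> complex Matrix.mat \<Rightarrow> 'n::{finite,linorder} cmat" where
  "emb m A = (\<chi> i j. if rk i \<le> m \<and> rk j \<le> m then A $$ (rk i - 1, rk j - 1) else 0)"

lemma supp_emb [simp]: "supp m (emb m A)"
  by (simp add: supp_def emb_def)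

lemma mat1_nth: "(mat 1 :: 'n::finite cmat) $ i $ j = (if i = j then 1 else 0)"
  by (simp add: mat_def)

lemma mm_nth: "((A :: 'n::finite cmat) ** B) $ i $ j = (\<Sum>k\<in>UNIV. A $ i $ k * B $ k $ j)"
  by (simp add: matrix_matrix_mult_def)

lemma mv_nth: "((A :: 'n::finite cmat) *v v) $ i = (\<Sum>k\<in>UNIV. A $ i $ k * v $ k)"
  by (simp add: matrix_vector_mult_def)

lemma emb_mult:
  assumes "m \<le> CARD('n::{finite,linorder})" "A \<in> carrier_mat m m" "B \<in> carrier_mat m m"
  shows "emb m (A * B) = (emb m A :: 'n cmat) ** emb m B"
proof -
  have "(A * B) $$ (rk i - 1, rk j - 1) =
     (\<Sum>k\<in>UNIV. (emb m A :: 'n cmat) $ i $ k * (emb m B :: 'n cmat) $ k $ j)"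
    if ij: "rk i \<le> m" "rk j \<le> m" for i j :: 'n
  proof -
    have lt: "rk i - 1 < m" "rk j - 1 < m"
      using ij rk_ge1[of i] rk_ge1[of j] by linarith+
    have "(A * B) $$ (rk i - 1, rk j - 1) = (\<Sum>k=0..<m. A $$ (rk i - 1, k) * B $$ (k, rk j - 1))"
      using lt assms by (simp add: scalar_prod_def)
    also have "\<dots> = (\<Sum>k=0..<m. A $$ (rk i - 1, rk (ix (Suc k) :: 'n) - 1) *
        B $$ (rk (ix (Suc k) :: 'n) - 1, rk j - 1))"
      using assms by (intro sum.cong) auto
    also have "\<dots> = (\<Sum>k\<in>UNIV. if rk k \<le> m then A $$ (rk i - 1, rk (k :: 'n) - 1) *
        B $$ (rk k - 1, rk j - 1) else 0)"
      using assms by (intro sum_block)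
    also have "\<dots> = (\<Sum>k\<in>UNIV. (emb m A :: 'n cmat) $ i $ k * (emb m B :: 'n cmat) $ k $ j)"
      using ij by (intro sum.cong) (auto simp: emb_def)
    finally show ?thesis .
  qed
  then have "\<forall>i j. emb m (A * B) $ i $ j = ((emb m A :: 'n cmat) ** emb m B) $ i $ j"
    unfolding mm_nth by (auto simp: emb_def)
  then show ?thesis by (simp add: vec_eq_iff)
qed

lemma emb_block: "emb m (block m x) = cut m x"
proof -
  have "(block m x) $$ (rk i - 1, rk j - 1) = x $ i $ j" if "rk i \<le> m" "rk j \<le> m" for i j
    using that rk_ge1[of i] rk_ge1[of j] by (auto simp: block_def ent_def)
  then show ?thesis
    by (auto simp: emb_def cut_def vec_eq_iff)
qed

lemma emb_one: "emb m (1\<^sub>m m) = cut m (mat 1 :: 'n::{finite,linorder} cmat)"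
proof -
  have "(1\<^sub>m m :: complex Matrix.mat) $$ (rk i - 1, rk j - 1) = (mat 1 :: 'n cmat) $ i $ j"
    if "rk i \<le> m" "rk j \<le> m" for i j :: 'n
    using that rk_ge1[of i] rk_ge1[of j]
    by (auto simp: mat1_nth) (metis One_nat_def rk_Suc_diff rk_eq_iff)
  then show ?thesis
    by (auto simp: emb_def cut_def vec_eq_iff)
qed

lemma block_carrier [simp]: "block m x \<in> carrier_mat m m"
  by (simp add: block_def)

text \<open>Eigenvectors are padded by zeros. Padding the block adds vectors to the kernel;
  requiring \<open>w\<close> to vanish beyond position \<open>m\<close> keeps these from making 0 an
  eigenvalue.\<close>

lemma eigenvalue_block:
  fixes x :: "'n::{finite,linorder} cmat"
  assumes m: "m \<le> CARD('n)"
  shows "eigenvalue (block m x) c \<longleftrightarrow>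
    (\<exists>w. w \<noteq> 0 \<and> (\<forall>i. m < rk i \<longrightarrow> w $ i = 0) \<and> cut m x *v w = c *s w)"
proof
  assume "eigenvalue (block m x) c"
  then obtain v where v: "v \<in> carrier_vec m" "v \<noteq> 0\<^sub>v m" "block m x *\<^sub>v v = c \<cdot>\<^sub>v v"
    by (auto simp: eigenvalue_def eigenvector_def block_def)
  define w where "w = (\<chi> i::'n. if rk i \<le> m then vec_index v (rk i - 1) else 0)"
  have wix: "w $ ix (Suc k) = vec_index v k" if "k < m" for k
    using that m by (simp add: w_def)
  have "\<exists>k<m. vec_index v k \<noteq> 0"
  proof (rule ccontr)
    assume "\<not> ?thesis"
    then have "v = 0\<^sub>v m" using v(1) by (intro eq_vecI) auto
    with v show False by simp
  qed
  then obtain k where "k < m" "vec_index v k \<noteq> 0" by blast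
  then have "w \<noteq> 0" using wix[of k] by auto
  moreover have "cut m x *v w = c *s w"
  proof -
    have "(cut m x *v w) $ i = c * w $ i" for i
    proof (cases "rk i \<le> m")
      case True
      then have lt: "rk i - 1 < m" using rk_ge1[of i] by linarith
      have "(cut m x *v w) $ i = (\<Sum>j\<in>UNIV. if rk j \<le> m then x $ i $ j * w $ j else 0)"
        unfolding mv_nth using True by (intro sum.cong) (auto simp: cut_def)
      also have "\<dots> = (\<Sum>k=0..<m. x $ i $ ix (Suc k) * w $ ix (Suc k))"
        using m by (rule sum_block[symmetric])
      also have "\<dots> = (\<Sum>k=0..<m. x $ i $ ix (Suc k) * vec_index v k)"
        by (intro sum.cong) (auto simp: wix)
      also have "\<dots> = vec_index (block m x *\<^sub>v v) (rk i - 1)"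
        using lt v(1) rk_ge1[of i] by (auto simp: block_def scalar_prod_def ent_def intro!: sum.cong)
      also have "\<dots> = c * w $ i"
        using v(1,3) lt True by (simp add: w_def)
      finally show ?thesis .
    next
      case False
      then show ?thesis by (simp add: mv_nth cut_def w_def)
    qed
    then show ?thesis by (simp add: vec_eq_iff)
  qed
  moreover have "\<forall>i. m < rk i \<longrightarrow> w $ i = 0" by (auto simp: w_def)
  ultimately show "\<exists>w. w \<noteq> 0 \<and> (\<forall>i. m < rk i \<longrightarrow> w $ i = 0) \<and> cut m x *v w = c *s w"
    by blast
next
  assume "\<exists>w. w \<noteq> 0 \<and> (\<forall>i. m < rk i \<longrightarrow> w $ i = 0) \<and> cut m x *v w = c *s w"
  then obtain w where w: "w \<noteq> 0" "\<And>i. m < rk i \<Longrightarrow> w $ i = 0" "cut m x *v w = c *s w"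
    by blast
  define v where "v = Matrix.vec m (\<lambda>k. w $ ix (Suc k))"
  obtain i where i: "w $ i \<noteq> 0" using w(1) by (auto simp: vec_eq_iff)
  with w(2)[of i] have im: "rk i \<le> m" by (meson not_le)
  have "vec_index v (rk i - 1) \<noteq> 0"
    using i im rk_ge1[of i] by (auto simp: v_def)
  then have "v \<noteq> 0\<^sub>v m"
    using im rk_ge1[of i] by auto
  moreover have "block m x *\<^sub>v v = c \<cdot>\<^sub>v v"
  proof (rule eq_vecI)
    fix k assume "k < dim_vec (c \<cdot>\<^sub>v v)"
    then have k: "k < m" by (simp add: v_def)
    define i where "i = (ix (Suc k) :: 'n)"
    have ri: "rk i = Suc k" using k m by (simp add: i_def)
    have "vec_index (block m x *\<^sub>v v) k = (\<Sum>l=0..<m. x $ i $ ix (Suc l) * w $ ix (Suc l))"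
      using k by (auto simp: block_def scalar_prod_def ent_def i_def v_def intro!: sum.cong)
    also have "\<dots> = (\<Sum>j\<in>UNIV. if rk j \<le> m then x $ i $ j * w $ j else 0)"
      using m by (rule sum_block)
    also have "\<dots> = (cut m x *v w) $ i"
      unfolding mv_nth using ri k by (intro sum.cong) (auto simp: cut_def)
    finally show "vec_index (block m x *\<^sub>v v) k = vec_index (c \<cdot>\<^sub>v v) k"
      using w(3) k by (simp add: i_def v_def)
  qed (simp add: v_def block_def)
  ultimately show "eigenvalue (block m x) c"
    unfolding eigenvalue_def eigenvector_def by (intro exI[of _ v]) (simp add: v_def block_def)
qed

text \<open>The matrix with the eigenvectors as columns conjugates \<open>A\<close> to the diagonal
  matrix; it is invertible because eigenvectors for distinct eigenvalues are independent.\<close>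

lemma similar_mat_diag_if_distinct:
  fixes A :: "'a::field Matrix.mat"
  assumes A: "A \<in> carrier_mat m m"
    and ev: "\<And>k. k < m \<Longrightarrow> eigenvalue A (d k)"
    and inj: "inj_on d {..<m}"
  shows "similar_mat (Matrix.mat m m (\<lambda>(i, j). if i = j then d i else 0)) A"
proof -
  define D where "D = Matrix.mat m m (\<lambda>(i, j). if i = j then d i else 0)"
  have D: "D \<in> carrier_mat m m" by (simp add: D_def)
  have "\<forall>k\<in>{..<m}. \<exists>v. eigenvector A v (d k)"
    using ev by (auto simp: eigenvalue_def)
  then obtain v where v0: "\<And>k. k < m \<Longrightarrow> eigenvector A (v k) (d k)"
    by (metis lessThan_iff)
  then have v: "v k \<in> carrier_vec m" "v k \<noteq> 0\<^sub>v m" "A *\<^sub>v v k = d k \<cdot>\<^sub>v v k" if "k < m" for k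
    using A that by (auto simp: eigenvector_def)
  define S where "S = Matrix.mat m m (\<lambda>(i, k). vec_index (v k) i)"
  have S: "S \<in> carrier_mat m m" by (simp add: S_def)
  have colS: "col S k = v k" if "k < m" for k
    using v(1)[OF that] that by (intro eq_vecI) (auto simp: S_def)
  have AS: "A * S = S * D"
  proof (rule eq_matI)
    fix i k assume "i < dim_row (S * D)" "k < dim_col (S * D)"
    then have ik: "i < m" "k < m" by (auto simp: S_def D_def)
    have "(A * S) $$ (i, k) = vec_index (A *\<^sub>v v k) i"
      using ik A S colS by simp
    also have "\<dots> = S $$ (i, k) * d k"
      using ik v[of k] by (simp add: S_def)
    also have "\<dots> = (S * D) $$ (i, k)"
    proof -
      have "(S * D) $$ (i, k) = (\<Sum>j=0..<m. S $$ (i, j) * (if j = k then d j else 0))"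
        using ik by (auto simp: D_def S_def scalar_prod_def intro!: sum.cong)
      also have "\<dots> = (\<Sum>j=0..<m. if j = k then S $$ (i, k) * d k else 0)"
        by (intro sum.cong) auto
      also have "\<dots> = S $$ (i, k) * d k" using ik by simp
      finally show ?thesis by simp
    qed
    finally show "(A * S) $$ (i, k) = (S * D) $$ (i, k)" .
  qed (use A S D in auto)
  have "Determinant.det S \<noteq> 0"
  proof
    assume "Determinant.det S = 0"
    then obtain c where c: "c \<in> carrier_vec m" "c \<noteq> 0\<^sub>v m" "S *\<^sub>v c = 0\<^sub>v m"
      using det_0_iff_vec_prod_zero[OF S] by blast
    obtain k where k: "k < m" "vec_index c k \<noteq> 0"
    proof (rule ccontr)
      assume "\<not> thesis"
      with that have "c = 0\<^sub>v m" using c(1) by (intro eq_vecI) auto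
      with c show False by simp
    qed
    \<comment> \<open>Since \<open>S * D = A * S\<close>, the kernel of \<open>S\<close> is stable
      under \<open>D\<close> minus the scalar \<open>d a\<close>. Applying this for all
      \<open>a\<close> in \<open>F\<close> multiplies entry \<open>i\<close> of \<open>c\<close> by
      the product of the \<open>d i - d l\<close>.\<close>
    have step: "S *\<^sub>v Matrix.vec m (\<lambda>i. vec_index c i * (\<Prod>l\<in>F. d i - d l)) = 0\<^sub>v m" if "finite F" for F
      using that
    proof (induction F)
      case empty
      have "Matrix.vec m (\<lambda>i. vec_index c i * 1) = c" using c(1) by auto
      then show ?case using c(3) by simp
    next
      case (insert a F)
      let ?c = "Matrix.vec m (\<lambda>i. vec_index c i * (\<Prod>l\<in>F. d i - d l))"
      have cc: "?c \<in> carrier_vec m" by simp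
      have DD: "vec_index (D *\<^sub>v ?c) i = d i * vec_index ?c i" if "i < m" for i
      proof -
        have "vec_index (D *\<^sub>v ?c) i = (\<Sum>j=0..<m. (if i = j then d i else 0) * vec_index ?c j)"
          using that by (auto simp: D_def scalar_prod_def intro!: sum.cong)
        also have "\<dots> = (\<Sum>j=0..<m. (if i = j then d i * vec_index ?c i else 0))"
          by (intro sum.cong) auto
        also have "\<dots> = d i * vec_index ?c i" using that by simp
        finally show ?thesis .
      qed
      have "Matrix.vec m (\<lambda>i. vec_index c i * (\<Prod>l\<in>insert a F. d i - d l)) = D *\<^sub>v ?c - d a \<cdot>\<^sub>v ?c"
        using DD D insert.hyps by (intro eq_vecI) (auto simp: algebra_simps simp del: index_mult_mat_vec)
      also have "S *\<^sub>v \<dots> = S *\<^sub>v (D *\<^sub>v ?c) - S *\<^sub>v (d a \<cdot>\<^sub>v ?c)"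
        using S D by (intro mult_minus_distrib_mat_vec) (auto simp del: vec_carrier)
      also have "S *\<^sub>v (D *\<^sub>v ?c) = (S * D) *\<^sub>v ?c"
        using S D cc by (simp del: assoc_mult_mat_vec add: assoc_mult_mat_vec[symmetric])
      also have "\<dots> = (A * S) *\<^sub>v ?c" by (simp add: AS)
      also have "\<dots> = A *\<^sub>v (S *\<^sub>v ?c)"
        by (rule assoc_mult_mat_vec[OF A S cc])
      also have "\<dots> = 0\<^sub>v m" using insert.IH A by auto
      also have "S *\<^sub>v (d a \<cdot>\<^sub>v ?c) = d a \<cdot>\<^sub>v (S *\<^sub>v ?c)"
        using S cc by (intro mult_mat_vec) auto
      also have "\<dots> = 0\<^sub>v m" using insert.IH by auto
      finally show ?case by simp
    qed
    \<comment> \<open>With all indices but \<open>k\<close> in \<open>F\<close>, only entry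
      \<open>k\<close> survives, and \<open>S\<close> maps the result to a nonzero multiple of the
      eigenvector \<open>v k\<close>.\<close>
    let ?F = "{..<m} - {k}"
    let ?p = "vec_index c k * (\<Prod>l\<in>?F. d k - d l)"
    have p: "?p \<noteq> 0" using k inj by (auto simp: inj_on_def)
    have eq: "Matrix.vec m (\<lambda>i. vec_index c i * (\<Prod>l\<in>?F. d i - d l)) = Matrix.vec m (\<lambda>i. if i = k then ?p else 0)"
      by (intro eq_vecI) (auto intro!: prod_zero)
    have z: "S *\<^sub>v Matrix.vec m (\<lambda>i. if i = k then ?p else 0) = 0\<^sub>v m"
      using step[of ?F] eq by simp
    have "vec_index (v k) i = 0" if i: "i < m" for i
    proof -
      have "0 = vec_index (S *\<^sub>v Matrix.vec m (\<lambda>i. if i = k then ?p else 0)) i"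
        using z i by simp
      also have "\<dots> = (\<Sum>j=0..<m. S $$ (i, j) * (if j = k then ?p else 0))"
        using i by (auto simp: S_def scalar_prod_def intro!: sum.cong)
      also have "\<dots> = (\<Sum>j=0..<m. if j = k then S $$ (i, k) * ?p else 0)"
        by (intro sum.cong) auto
      also have "\<dots> = S $$ (i, k) * ?p" using k by simp
      finally show ?thesis using p i k by (auto simp: S_def)
    qed
    then have "v k = 0\<^sub>v m" using v(1)[OF k(1)] by (intro eq_vecI) auto
    with v(2)[OF k(1)] show False by simp
  qed
  from det_non_zero_imp_unit[OF S this, unfolded Units_def]
  obtain T where T: "T \<in> carrier_mat m m" "T * S = 1\<^sub>m m" "S * T = 1\<^sub>m m"
    by (auto simp: ring_mat_def)
  have "D = T * A * S"
  proof -
    have "T * A * S = T * (A * S)" by (rule assoc_mult_mat[OF T(1) A S])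
    also have "\<dots> = (T * S) * D" unfolding AS by (rule assoc_mult_mat[OF T(1) S D, symmetric])
    finally show ?thesis using T(2) D by simp
  qed
  then show ?thesis
    unfolding D_def[symmetric] using A D S T by (intro similar_matI[of _ _ T S m]) auto
qed

lemma eigenvalue_similar_diag:
  fixes A :: "complex Matrix.mat"
  assumes A: "A \<in> carrier_mat m m"
    and sim: "similar_mat (Matrix.mat m m (\<lambda>(i, j). if i = j then d i else 0)) A"
  shows "eigenvalue A c \<longleftrightarrow> (\<exists>k<m. c = d k)"
proof -
  let ?D = "Matrix.mat m m (\<lambda>(i, j). if i = j then d i else 0)"
  have "char_poly A = char_poly ?D" using char_poly_similar[OF sim] by simp
  also have "\<dots> = (\<Prod>a\<leftarrow>diag_mat ?D. [:- a, 1:])"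
    by (rule char_poly_upper_triangular[of _ m]) auto
  finally have "poly (char_poly A) c = (\<Prod>a\<leftarrow>diag_mat ?D. c - a)"
    by (simp add: poly_prod_list o_def)
  then have "poly (char_poly A) c = 0 \<longleftrightarrow> c \<in> set (diag_mat ?D)"
    by (auto simp: prod_list_zero_iff)
  also have "set (diag_mat ?D) = d ` {..<m}"
    by (force simp: diag_mat_def)
  finally show ?thesis
    using eigenvalue_root_char_poly[OF A] by auto
qed

lemma nu_mat_alt: "nu_mat \<nu> m = Matrix.mat m m (\<lambda>(i, j). if i = j then (\<lambda>i. \<nu> (Suc i) m) i else 0)"
  by (auto simp: nu_mat_def intro!: eq_matI)

lemma eigenvalue_nu_mat:
  assumes "similar_mat (nu_mat \<nu> m) (block m x)"
  shows "eigenvalue (block m x) c \<longleftrightarrow> (\<exists>k\<in>{1..m}. c = \<nu> k m)"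
proof -
  have "eigenvalue (block m x) c \<longleftrightarrow> (\<exists>k<m. c = \<nu> (Suc k) m)"
    using assms unfolding nu_mat_alt by (intro eigenvalue_similar_diag) auto
  also have "\<dots> \<longleftrightarrow> (\<exists>k\<in>{1..m}. c = \<nu> k m)"
    by (metis Suc_le_eq Suc_pred atLeastAtMost_iff le_zero_eq less_eq_Suc_le not_gr_zero One_nat_def zero_less_Suc)
  finally show ?thesis .
qed

text \<open>The numbers \<open>\<nu> k m\<close> being distinct, they exhaust the eigenvalues of a
  block of size m and force conjugacy to the diagonal matrix. So the conditions of
  \<open>M_Omega\<close> on \<open>x\<close> follow from those on \<nu>, and membership in the
  covering becomes a statement about eigenvectors.\<close>

lemma M_Omega_e_iff:
  fixes x :: "'n::{finite,linorder} cmat"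
  shows "(\<nu>, x) \<in> M_Omega_e \<longleftrightarrow> \<nu> \<in> e_Omega CARD('n) \<and>
    (\<forall>m\<in>{1..CARD('n)}. \<forall>k\<in>{1..m}. eigenvalue (block m x) (\<nu> k m))"
proof
  assume asm: "(\<nu>, x) \<in> M_Omega_e"
  have "eigenvalue (block m x) (\<nu> k m)" if "m \<in> {1..CARD('n)}" "k \<in> {1..m}" for m k
    using asm that eigenvalue_nu_mat[of \<nu> m x "\<nu> k m"] by (auto simp: M_Omega_e_def)
  with asm show "\<nu> \<in> e_Omega CARD('n) \<and>
    (\<forall>m\<in>{1..CARD('n)}. \<forall>k\<in>{1..m}. eigenvalue (block m x) (\<nu> k m))"
    by (auto simp: M_Omega_e_def)
next
  assume *: "\<nu> \<in> e_Omega CARD('n) \<and>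
    (\<forall>m\<in>{1..CARD('n)}. \<forall>k\<in>{1..m}. eigenvalue (block m x) (\<nu> k m))"
  have inj: "inj_on (\<lambda>k. \<nu> k m) {1..m}" if "m \<in> {1..CARD('n)}" for m
    using * that by (auto simp: e_Omega_def)
  have sim: "similar_mat (nu_mat \<nu> m) (block m x)" if m: "m \<in> {1..CARD('n)}" for m
    unfolding nu_mat_alt
  proof (rule similar_mat_diag_if_distinct[where d = "\<lambda>i. \<nu> (Suc i) m"])
    show "eigenvalue (block m x) (\<nu> (Suc k) m)" if "k < m" for k
      using *[THEN conjunct2, rule_format, of m "Suc k"] m that by simp
    show "inj_on (\<lambda>i. \<nu> (Suc i) m) {..<m}"
    proof (rule inj_onI)
      fix i j assume "i \<in> {..<m}" "j \<in> {..<m}" "\<nu> (Suc i) m = \<nu> (Suc j) m"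
      then show "i = j" using inj_onD[OF inj[OF m], of "Suc i" "Suc j"] by simp
    qed
  qed simp
  have ev: "{c. eigenvalue (block m x) c} = (\<lambda>k. \<nu> k m) ` {1..m}" if m: "m \<in> {1..CARD('n)}" for m
    using eigenvalue_nu_mat[OF sim[OF m]] by auto
  have "x \<in> M_Omega"
    unfolding M_Omega_def
  proof (intro CollectI conjI ballI notI)
    fix m assume m: "m \<in> {1..CARD('n)}"
    show "card {c. eigenvalue (block m x) c} = m"
      unfolding ev[OF m] using card_image[OF inj[OF m]] by simp
  next
    fix m assume m: "m \<in> {1..CARD('n) - 1}"
      and "\<exists>c. eigenvalue (block m x) c \<and> eigenvalue (block (m + 1) x) c"
    then obtain c where c: "c \<in> {c. eigenvalue (block m x) c}" "c \<in> {c. eigenvalue (block (m+1) x) c}"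
      by blast
    have "m \<in> {1..CARD('n)}" "m + 1 \<in> {1..CARD('n)}" using m by auto
    from c[unfolded ev[OF this(1)] ev[OF this(2)]] obtain i j
      where "i \<in> {1..m}" "j \<in> {1..m+1}" "\<nu> i m = \<nu> j (m+1)" by auto
    with m * show False by (auto simp: e_Omega_def)
  qed
  with * sim show "(\<nu>, x) \<in> M_Omega_e" by (auto simp: M_Omega_e_def)
qed


section \<open>Spectral projections of the blocks\<close>

lemma cscale_nth [simp]: "cscale c A $ i $ j = c * A $ i $ j"
  by (simp add: cscale_def)

lemma cmat_eqI: "(\<And>i j. A $ i $ j = B $ i $ j) \<Longrightarrow> A = (B :: 'n::finite cmat)"
  by (simp add: vec_eq_iff)

lemma mm_distrib:
  fixes A B C :: "'n::finite cmat"
  shows "A ** (B + C) = A ** B + A ** C" "(A + B) ** C = A ** C + B ** C"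
    and "A ** (B - C) = A ** B - A ** C" "(A - B) ** C = A ** C - B ** C"
    and "A ** (- B) = - (A ** B)" "(- A) ** B = - (A ** B)"
    and "A ** 0 = 0" "0 ** A = 0"
    and "A ** cscale c B = cscale c (A ** B)" "cscale c A ** B = cscale c (A ** B)"
  by (simp_all add: vec_eq_iff mm_nth algebra_simps sum.distrib sum_subtractf sum_negf sum_distrib_left)

lemma mm_sum:
  fixes A :: "'n::finite cmat"
  shows "A ** (\<Sum>k\<in>S. f k) = (\<Sum>k\<in>S. A ** f k)" "(\<Sum>k\<in>S. f k) ** A = (\<Sum>k\<in>S. f k ** A)"
  by (induction S rule: infinite_finite_induct) (simp_all add: mm_distrib)

lemma mm_one [simp]: "mat 1 ** A = A" "A ** mat 1 = (A :: 'n::finite cmat)"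
  by simp_all

lemmas mm_assoc = matrix_mul_assoc[symmetric]

lemma cscale_simps [simp]:
  "cscale 0 A = 0" "cscale 1 A = A" "cscale c 0 = 0" "cscale c (cscale d A) = cscale (c * d) A"
  by (simp_all add: vec_eq_iff)

lemma cscale_distrib:
  "cscale c (A + B) = cscale c A + cscale c B" "cscale c (A - B) = cscale c A - cscale c B"
  "cscale (c + d) A = cscale c A + cscale d A" "cscale (c - d) A = cscale c A - cscale d A"
  "cscale (- c) A = - cscale c A" "cscale c (- A) = - cscale c A"
  by (simp_all add: vec_eq_iff algebra_simps)

lemma trace_cscale [simp]: "trace (cscale c (A :: 'n::finite cmat)) = c * trace A"
  by (simp add: trace_def sum_distrib_left)

abbreviation Em :: "nat \<Rightarrow> 'n::{finite,linorder} cmat" where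
  "Em m \<equiv> cut m (mat 1)"

lemma Em_nth: "(Em m :: 'n::{finite,linorder} cmat) $ i $ j = (if i = j \<and> rk i \<le> m then 1 else 0)"
  by (simp add: cut_def mat1_nth)

lemma Em_mm_nth: "((Em m :: 'n::{finite,linorder} cmat) ** (A :: 'n cmat)) $ i $ j = (if rk i \<le> m then A $ i $ j else 0)"
proof -
  have "((Em m :: 'n cmat) ** A) $ i $ j = (\<Sum>k\<in>UNIV. if k = i then (if rk i \<le> m then A $ i $ j else 0) else 0)"
    unfolding mm_nth by (intro sum.cong) (auto simp: Em_nth)
  then show ?thesis by simp
qed

lemma mm_Em_nth: "((A :: 'n cmat) ** (Em m :: 'n::{finite,linorder} cmat)) $ i $ j = (if rk j \<le> m then A $ i $ j else 0)"
proof -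
  have "(A ** (Em m :: 'n cmat)) $ i $ j = (\<Sum>k\<in>UNIV. if k = j then (if rk j \<le> m then A $ i $ j else 0) else 0)"
    unfolding mm_nth by (intro sum.cong) (auto simp: Em_nth)
  then show ?thesis by simp
qed

lemma cut_eq: "cut m A = Em m ** A ** Em m"
  by (rule cmat_eqI) (simp add: Em_mm_nth mm_Em_nth, simp add: cut_def)

lemma cut_full: "cut CARD('n) A = (A :: 'n::{finite,linorder} cmat)"
  by (simp add: cut_def vec_eq_iff)

lemma supp_Em: "supp m A \<Longrightarrow> Em m ** A = A" "supp m A \<Longrightarrow> A ** Em m = A"
  by (auto simp: vec_eq_iff Em_mm_nth mm_Em_nth supp_def)

lemma suppI: "Em m ** A = A \<Longrightarrow> A ** Em m = A \<Longrightarrow> supp m A"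
  unfolding supp_def by (metis Em_mm_nth mm_Em_nth)

lemma supp_iff: "supp m A \<longleftrightarrow> Em m ** A = A \<and> A ** Em m = A"
  using suppI supp_Em by blast

lemma supp_mono: "supp m A \<Longrightarrow> m \<le> l \<Longrightarrow> supp l A"
  by (auto simp: supp_def intro: order_trans)

lemma supp_mm: "supp m A \<Longrightarrow> supp m B \<Longrightarrow> supp m (A ** B)"
  unfolding supp_iff by (metis matrix_mul_assoc)

lemma supp_cscale: "supp m A \<Longrightarrow> supp m (cscale c A)"
  by (auto simp: supp_def)

lemma supp_sum: "(\<And>k. k \<in> S \<Longrightarrow> supp m (f k)) \<Longrightarrow> supp m (\<Sum>k\<in>S. f k)"
  unfolding supp_iff by (simp add: mm_sum)

lemma cut_mm:
  assumes "supp m P" "m \<le> l"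
  shows "cut l (A ** P) = cut l A ** P" "cut l (P ** A) = P ** cut l A"
proof -
  have P: "Em l ** P = P" "P ** Em l = P"
    using supp_mono[OF assms] supp_Em by blast+
  show "cut l (A ** P) = cut l A ** P"
    unfolding cut_eq[of l "A ** P"] cut_eq[of l A] by (simp add: mm_assoc P)
  show "cut l (P ** A) = P ** cut l A"
    unfolding cut_eq[of l "P ** A"] cut_eq[of l A] by (simp add: matrix_mul_assoc P)
qed

lemma cut_add: "cut m (A + B) = cut m A + cut m B"
  and cut_diff: "cut m (A - B) = cut m A - cut m B"
  by (auto simp: cut_def vec_eq_iff)

lemma cut_cut: "m \<le> l \<Longrightarrow> cut m (cut l A) = cut m A"
  by (auto simp: cut_def vec_eq_iff)

definition dgm :: "(nat \<Rightarrow> complex) \<Rightarrow> nat \<Rightarrow> 'n::{finite,linorder} cmat" where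
  "dgm d m = (\<chi> i j. if i = j \<and> rk i \<le> m then d (rk i) else 0)"

lemma dgm_mm_nth: "((dgm d m :: 'n::{finite,linorder} cmat) ** (A :: 'n cmat)) $ i $ j = (if rk i \<le> m then d (rk i) * A $ i $ j else 0)"
proof -
  have "((dgm d m :: 'n cmat) ** A) $ i $ j = (\<Sum>k\<in>UNIV. if k = i then (if rk i \<le> m then d (rk i) * A $ i $ j else 0) else 0)"
    unfolding mm_nth by (intro sum.cong) (auto simp: dgm_def)
  then show ?thesis by simp
qed

lemma dgm_mult: "dgm d m ** dgm e m = dgm (\<lambda>k. d k * e k) m"
  by (rule cmat_eqI) (simp add: dgm_mm_nth, simp add: dgm_def)

lemma dgm_1: "dgm (\<lambda>_. 1) m = Em m"
  by (simp add: dgm_def vec_eq_iff Em_nth)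

lemma supp_dgm [simp]: "supp m (dgm d m)"
  by (auto simp: supp_def dgm_def)

lemma dgm_cscale: "cscale c (dgm d m) = dgm (\<lambda>k. c * d k) m"
  and dgm_diff: "dgm d m - dgm e m = dgm (\<lambda>k. d k - e k) m"
  by (auto simp: dgm_def vec_eq_iff)

text \<open>The conjugating matrices of size m are padded by zeros, hence \<open>g\<close> and
  \<open>g'\<close> are inverse to each other only relative to \<open>Em m\<close>.\<close>

lemma spectral:
  fixes x :: "'n::{finite,linorder} cmat"
  assumes z: "(\<nu>, x) \<in> M_Omega_e" and m: "1 \<le> m" "m \<le> CARD('n)"
  obtains g g' :: "'n cmat" where "supp m g" "supp m g'" "g ** g' = Em m" "g' ** g = Em m"
    "cut m x = g ** dgm (\<lambda>k. \<nu> k m) m ** g'"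
proof -
  have "similar_mat (nu_mat \<nu> m) (block m x)"
    using z m by (auto simp: M_Omega_e_def)
  from similar_matD[OF this] obtain r P Q where
    PQ: "{nu_mat \<nu> m, block m x, P, Q} \<subseteq> carrier_mat r r" "P * Q = 1\<^sub>m r" "Q * P = 1\<^sub>m r"
      "nu_mat \<nu> m = P * block m x * Q" by blast
  have r: "r = m" using PQ(1) by (auto simp: nu_mat_def)
  have c: "P \<in> carrier_mat m m" "Q \<in> carrier_mat m m" "nu_mat \<nu> m \<in> carrier_mat m m"
    using PQ(1) r by auto
  have "Q * nu_mat \<nu> m * P = Q * (P * (block m x * Q)) * P"
    unfolding PQ(4) using c by (simp add: assoc_mult_mat[where ?n\<^sub>1.0 = m and ?n\<^sub>2.0 = m and ?n\<^sub>3.0 = m and ?n\<^sub>4.0 = m])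
  also have "\<dots> = (Q * P) * (block m x * Q) * P"
    using assoc_mult_mat[OF c(2) c(1) mult_carrier_mat[OF block_carrier[of m x] c(2)]] by simp
  also have "\<dots> = block m x * (Q * P)"
    using c PQ(3) r assoc_mult_mat[of "block m x" m m Q m P m]
      left_mult_one_mat[OF mult_carrier_mat[OF block_carrier[of m x] c(2)]] by simp
  also have "\<dots> = block m x" using PQ(3) r right_mult_one_mat[OF block_carrier[of m x]] by simp
  finally have "(emb m (block m x) :: 'n cmat) = emb m (Q * nu_mat \<nu> m * P)" by simp
  also have "\<dots> = emb m Q ** emb m (nu_mat \<nu> m) ** emb m P"
    using c m by (simp add: emb_mult mult_carrier_mat[of _ m m _ m] mm_assoc)
  also have "emb m (nu_mat \<nu> m) = (dgm (\<lambda>k. \<nu> k m) m :: 'n cmat)"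
  proof (rule cmat_eqI)
    fix i j :: 'n
    have "rk i - Suc 0 = rk j - Suc 0 \<longleftrightarrow> i = j"
      by (metis rk_Suc_diff' rk_eq_iff)
    then show "(emb m (nu_mat \<nu> m) :: 'n cmat) $ i $ j = dgm (\<lambda>k. \<nu> k m) m $ i $ j"
      by (auto simp: emb_def dgm_def nu_mat_def rk_less)
  qed
  finally have "cut m x = emb m Q ** dgm (\<lambda>k. \<nu> k m) m ** emb m P"
    by (simp add: emb_block)
  moreover have "emb m Q ** emb m P = (Em m :: 'n cmat)" "emb m P ** emb m Q = (Em m :: 'n cmat)"
    using c m PQ(2,3) r by (simp_all add: emb_mult[symmetric] emb_one)
  ultimately show ?thesis using that[of "emb m Q" "emb m P"] by simp
qed

text \<open>The monic polynomial with root list \<open>cs\<close>, kept in factored form and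
  evaluated at \<open>X\<close>. It serves for Lagrange interpolation, for the characteristic
  polynomial of an orbit and, with all roots 0, for powers.\<close>

primrec mprod :: "complex list \<Rightarrow> 'n cmat \<Rightarrow> 'n::finite cmat" where
  "mprod [] X = mat 1"
| "mprod (c # cs) X = (X - cscale c (mat 1)) ** mprod cs X"

text \<open>Outside the block \<open>X\<close> vanishes, but the product is a scalar there; the
  factor \<open>Em m\<close> removes it.\<close>

lemma mprod_diag:
  fixes g g' :: "'n::{finite,linorder} cmat"
  assumes "supp m g" "supp m g'" "g ** g' = Em m" "g' ** g = Em m"
    and X: "X = g ** dgm d m ** g'"
  shows "mprod cs X ** Em m = g ** dgm (\<lambda>k. \<Prod>c\<leftarrow>cs. d k - c) m ** g'"
proof (induction cs)
  case Nil
  show ?case using assms by (simp add: dgm_1 supp_Em)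
next
  case (Cons c cs)
  let ?D = "dgm (\<lambda>k. \<Prod>c\<leftarrow>cs. d k - c) m :: 'n cmat"
  have "X ** (g ** ?D ** g') = g ** (dgm d m ** (g' ** g) ** ?D) ** g'"
    by (simp add: X mm_assoc)
  also have "\<dots> = g ** (dgm d m ** ?D) ** g'"
    using assms by (simp add: supp_Em)
  finally have "mprod (c # cs) X ** Em m = g ** (dgm d m ** ?D - cscale c ?D) ** g'"
    by (simp add: mm_assoc[of _ _ "Em m"] Cons mm_distrib)
  then show ?case by (simp add: dgm_mult dgm_cscale dgm_diff algebra_simps)
qed

text \<open>The Lagrange interpolation polynomial that is 1 at \<open>\<nu> k m\<close> and 0 at the
  other eigenvalues, evaluated at the block: on the covering this is the spectral projection. The
  formula is rational in \<nu> and \<open>x\<close>, which makes continuity immediate.\<close>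

definition Prj :: "tuple \<Rightarrow> nat \<Rightarrow> nat \<Rightarrow> 'n cmat \<Rightarrow> 'n::{finite,linorder} cmat" where
  "Prj \<nu> m k x = cscale (1 / (\<Prod>l\<in>{1..m} - {k}. \<nu> k m - \<nu> l m))
     (mprod (map (\<lambda>l. \<nu> l m) (filter (\<lambda>l. l \<noteq> k) [1..<Suc m])) (cut m x) ** Em m)"

lemma e_Omega_inj: "\<nu> \<in> e_Omega n \<Longrightarrow> m \<le> n \<Longrightarrow> k \<in> {1..m} \<Longrightarrow> l \<in> {1..m} \<Longrightarrow> \<nu> k m = \<nu> l m \<Longrightarrow> k = l"
proof -
  assume a: "\<nu> \<in> e_Omega n" "m \<le> n" "k \<in> {1..m}" "l \<in> {1..m}" "\<nu> k m = \<nu> l m"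
  then have "inj_on (\<lambda>k. \<nu> k m) {1..m}" by (auto simp: e_Omega_def)
  from inj_onD[OF this, of k l] a show "k = l" by simp
qed

lemma M_Omega_e_e: "(\<nu>, x :: 'n::{finite,linorder} cmat) \<in> M_Omega_e \<Longrightarrow> \<nu> \<in> e_Omega CARD('n)"
  by (simp add: M_Omega_e_iff)

lemma Prj_denom:
  assumes "\<nu> \<in> e_Omega n" "k \<in> {1..m}" "m \<le> n"
  shows "(\<Prod>l\<in>{1..m} - {k}. \<nu> k m - \<nu> l m) \<noteq> 0"
  using e_Omega_inj[OF assms(1,3,2)] by auto

lemma Prj_diag:
  fixes g g' x :: "'n::{finite,linorder} cmat"
  assumes g: "supp m g" "supp m g'" "g ** g' = Em m" "g' ** g = Em m"
    and X: "cut m x = g ** dgm (\<lambda>k. \<nu> k m) m ** g'"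
    and \<nu>: "\<nu> \<in> e_Omega CARD('n)" and k: "k \<in> {1..m}" and m: "m \<le> CARD('n)"
  shows "Prj \<nu> m k x = g ** dgm (\<lambda>l. if l = k then 1 else 0) m ** g'"
proof -
  let ?p = "\<Prod>l\<in>{1..m} - {k}. \<nu> k m - \<nu> l m"
  let ?cs = "filter (\<lambda>l. l \<noteq> k) [1..<Suc m]"
  have pl: "(\<Prod>c\<leftarrow>map (\<lambda>l. \<nu> l m) ?cs. \<nu> i m - c) = (\<Prod>l\<in>{1..m} - {k}. \<nu> i m - \<nu> l m)" for i
  proof -
    have "(\<Prod>c\<leftarrow>map (\<lambda>l. \<nu> l m) ?cs. \<nu> i m - c) = (\<Prod>l\<leftarrow>?cs. \<nu> i m - \<nu> l m)"
      by (simp add: o_def)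
    also have "\<dots> = (\<Prod>l\<in>set ?cs. \<nu> i m - \<nu> l m)"
      by (rule prod.distinct_set_conv_list[symmetric]) simp
    also have "set ?cs = {1..m} - {k}" by auto
    finally show ?thesis .
  qed
  have "Prj \<nu> m k x = g ** cscale (1 / ?p) (dgm (\<lambda>i. \<Prod>l\<in>{1..m} - {k}. \<nu> i m - \<nu> l m) m) ** g'"
    unfolding Prj_def mprod_diag[OF g X] pl by (simp add: mm_distrib)
  also have "cscale (1 / ?p) (dgm (\<lambda>i. \<Prod>l\<in>{1..m} - {k}. \<nu> i m - \<nu> l m) m) =
      (dgm (\<lambda>l. if l = k then 1 else 0) m :: 'n cmat)"
  proof (rule cmat_eqI)
    fix i j :: 'n
    define a where "a i = (\<Prod>l\<in>{1..m} - {k}. \<nu> i m - \<nu> l m)" for i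
    have "a k \<noteq> 0" using Prj_denom[OF \<nu> k m] by (simp add: a_def)
    moreover have "a (rk i) = 0" if "rk i \<le> m" "rk i \<noteq> k"
    proof -
      have "rk i \<in> {1..m} - {k}" using that rk_ge1[of i] by simp
      then show ?thesis unfolding a_def by (intro prod_zero) auto
    qed
    ultimately show "cscale (1 / ?p) (dgm (\<lambda>i. \<Prod>l\<in>{1..m} - {k}. \<nu> i m - \<nu> l m) m) $ i $ j =
      (dgm (\<lambda>l. if l = k then 1 else 0) m :: 'n cmat) $ i $ j"
      unfolding a_def[symmetric] by (auto simp: dgm_def)
  qed
  finally show ?thesis .
qed

lemma trace_mm_sym: "trace ((A :: 'n::finite cmat) ** B) = trace (B ** A)"
  by (rule trace_mul_sym)

text \<open>All identities are read off in the eigenbasis, where the projection is a diagonal matrix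
  unit.\<close>

lemma
  fixes x :: "'n::{finite,linorder} cmat"
  assumes z: "(\<nu>, x) \<in> M_Omega_e" and k: "k \<in> {1..m}" and m: "m \<le> CARD('n)"
  shows supp_Prj: "supp m (Prj \<nu> m k x)"
    and Prj_mm: "l \<in> {1..m} \<Longrightarrow> Prj \<nu> m k x ** Prj \<nu> m l x = (if k = l then Prj \<nu> m k x else 0)"
    and sum_Prj: "(\<Sum>l\<in>{1..m}. Prj \<nu> m l x) = Em m"
    and cut_Prj: "cut m x ** Prj \<nu> m k x = cscale (\<nu> k m) (Prj \<nu> m k x)"
    and Prj_cut: "Prj \<nu> m k x ** cut m x = cscale (\<nu> k m) (Prj \<nu> m k x)"
    and trace_Prj: "trace (Prj \<nu> m k x) = 1"
proof -
  have "1 \<le> m" using k by simp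
  from spectral[OF z this m] obtain g g' :: "'n cmat" where
    g: "supp m g" "supp m g'" "g ** g' = Em m" "g' ** g = Em m"
    and X: "cut m x = g ** dgm (\<lambda>k. \<nu> k m) m ** g'" .
  note P = Prj_diag[OF g X M_Omega_e_e[OF z] _ m]
  have mul: "(g ** dgm a m ** g') ** (g ** dgm b m ** g') = g ** dgm (\<lambda>k. a k * b k) m ** g'" for a b
  proof -
    have "(g ** dgm a m ** g') ** (g ** dgm b m ** g') = g ** (dgm a m ** (g' ** g) ** dgm b m) ** g'"
      by (simp add: mm_assoc)
    then show ?thesis using g by (simp add: supp_Em dgm_mult)
  qed
  have cs: "g ** dgm (\<lambda>k. c * a k) m ** g' = cscale c (g ** dgm a m ** g')" for c a
    by (simp add: dgm_cscale[symmetric] mm_distrib)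
  show "supp m (Prj \<nu> m k x)"
    unfolding P[OF k] using g by (simp add: supp_mm)
  show "Prj \<nu> m k x ** Prj \<nu> m l x = (if k = l then Prj \<nu> m k x else 0)" if l: "l \<in> {1..m}"
  proof -
    have "(dgm (\<lambda>i. (if i = k then 1 else 0) * (if i = l then 1 else 0)) m :: 'n cmat) =
      (if k = l then dgm (\<lambda>i. if i = k then 1 else 0) m else 0)"
      by (auto simp: dgm_def vec_eq_iff)
    then show ?thesis unfolding P[OF k] P[OF l] mul by (simp add: mm_distrib)
  qed
  have "(\<Sum>l\<in>{1..m}. Prj \<nu> m l x) = (\<Sum>l\<in>{1..m}. g ** dgm (\<lambda>i. if i = l then 1 else 0) m ** g')"
    by (intro sum.cong P refl)
  also have "\<dots> = g ** (\<Sum>l\<in>{1..m}. dgm (\<lambda>i. if i = l then 1 else 0) m) ** g'"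
    by (simp add: mm_sum)
  also have "(\<Sum>l\<in>{1..m}. dgm (\<lambda>i. if i = l then 1 else 0) m) = (Em m :: 'n cmat)"
  proof (rule cmat_eqI)
    fix i j :: 'n
    have "(\<Sum>l\<in>{1..m}. dgm (\<lambda>i. if i = l then 1 else 0) m) $ i $ j =
       (\<Sum>l\<in>{1..m}. if rk i = l then (if i = j then 1 else 0 :: complex) else 0)"
      unfolding sum_component by (intro sum.cong) (auto simp: dgm_def)
    then show "(\<Sum>l\<in>{1..m}. dgm (\<lambda>i. if i = l then 1 else 0) m) $ i $ j = (Em m :: 'n cmat) $ i $ j"
      using rk_ge1[of i] by (auto simp: Em_nth)
  qed
  finally show "(\<Sum>l\<in>{1..m}. Prj \<nu> m l x) = Em m" using g by (simp add: supp_Em)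
  have c1: "(dgm (\<lambda>i. \<nu> i m * (if i = k then 1 else 0)) m :: 'n cmat) = dgm (\<lambda>i. \<nu> k m * (if i = k then 1 else 0)) m"
    "(dgm (\<lambda>i. (if i = k then 1 else 0) * \<nu> i m) m :: 'n cmat) = dgm (\<lambda>i. \<nu> k m * (if i = k then 1 else 0)) m"
    by (auto simp: dgm_def vec_eq_iff)
  show "cut m x ** Prj \<nu> m k x = cscale (\<nu> k m) (Prj \<nu> m k x)"
    "Prj \<nu> m k x ** cut m x = cscale (\<nu> k m) (Prj \<nu> m k x)"
    unfolding P[OF k] X mul c1 cs by (rule refl)+
  have "trace (Prj \<nu> m k x) = trace (g' ** (g ** dgm (\<lambda>i. if i = k then 1 else 0) m))"
    unfolding P[OF k] by (rule trace_mm_sym)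
  also have "\<dots> = trace (dgm (\<lambda>i. if i = k then 1 else 0) m :: 'n cmat)"
    using g by (simp add: matrix_mul_assoc supp_Em)
  also have "\<dots> = (\<Sum>i\<in>UNIV. if (i::'n) = ix k then 1 else 0)"
    unfolding trace_def using k m by (intro sum.cong) (auto simp: dgm_def)
  finally show "trace (Prj \<nu> m k x) = 1" by simp
qed

text \<open>A flow of level m fixes the block of size m, so this makes its projections of level m
  constant along the flow.\<close>

lemma Prj_cut_cong: "cut m x = cut m y \<Longrightarrow> Prj \<nu> m k x = Prj \<nu> m k y"
  by (simp add: Prj_def)

section \<open>Continuity of matrix operations and of the spectral projections\<close>

lemma cmat_tendstoI:
  fixes A :: "'n::finite cmat"
  assumes "\<And>i j. ((\<lambda>t. f t $ i $ j) \<longlongrightarrow> A $ i $ j) F"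
  shows "(f \<longlongrightarrow> A) F"
  by (intro vec_tendstoI assms)

lemma tendsto_mm [tendsto_intros]:
  fixes A B :: "'n::finite cmat"
  assumes "(f \<longlongrightarrow> A) F" "(g \<longlongrightarrow> B) F"
  shows "((\<lambda>t. f t ** g t) \<longlongrightarrow> A ** B) F"
  unfolding matrix_matrix_mult_def
  by (rule cmat_tendstoI) (simp, intro tendsto_intros assms)

lemma tendsto_cscale [tendsto_intros]:
  fixes A :: "'n::finite cmat"
  assumes "(c \<longlongrightarrow> d) F" "(f \<longlongrightarrow> A) F"
  shows "((\<lambda>t. cscale (c t) (f t)) \<longlongrightarrow> cscale d A) F"
  by (rule cmat_tendstoI) (simp, intro tendsto_intros assms)

lemma tendsto_cut [tendsto_intros]:
  assumes "(f \<longlongrightarrow> A) F"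
  shows "((\<lambda>t. cut m (f t)) \<longlongrightarrow> cut m A) F"
  by (rule cmat_tendstoI) (auto simp: cut_def intro!: tendsto_intros assms)

lemma tendsto_trace [tendsto_intros]:
  fixes A :: "'n::finite cmat"
  assumes "(f \<longlongrightarrow> A) F"
  shows "((\<lambda>t. trace (f t)) \<longlongrightarrow> trace A) F"
  unfolding trace_def by (intro tendsto_intros assms)

lemma tendsto_mprod:
  fixes X :: "'n::finite cmat"
  assumes "\<And>l. ((\<lambda>t. c t l) \<longlongrightarrow> d l) F" "(f \<longlongrightarrow> X) F"
  shows "((\<lambda>t. mprod (map (c t) ls) (f t)) \<longlongrightarrow> mprod (map d ls) X) F"
  by (induction ls) (auto intro!: tendsto_intros assms)

lemma tendsto_Prj:
  assumes "\<And>l. ((\<lambda>t. \<nu>f t l m) \<longlongrightarrow> \<nu> l m) F" "(f \<longlongrightarrow> x) F"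
    and "\<nu> \<in> e_Omega n" "k \<in> {1..m}" "m \<le> n"
  shows "((\<lambda>t. Prj (\<nu>f t) m k (f t)) \<longlongrightarrow> Prj \<nu> m k x) F"
  unfolding Prj_def
  by (intro tendsto_intros tendsto_mprod assms Prj_denom[OF assms(3-5)])


section \<open>Local sections of the covering\<close>

text \<open>The Leibniz expansion exhibits the value as a polynomial in the entries of
  \<open>y\<close>, hence as continuous in \<open>y\<close>.\<close>

lemma poly_char_poly_block:
  "poly (char_poly (block m y)) c = (\<Sum>p | p permutes {0..<m}.
     signof p * (\<Prod>i=0..<m. (if i = p i then c else 0) - y $ ix (Suc i) $ ix (Suc (p i))))"
proof -
  have "poly (char_poly (block m y)) c = Determinant.det (- (char_matrix (block m y) c))"
    by (rule char_poly_matrix[OF block_carrier])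
  also have "\<dots> = (\<Sum>p | p permutes {0..<m}.
     signof p * (\<Prod>i=0..<m. (- (char_matrix (block m y) c)) $$ (i, p i)))"
    by (subst det_def'[of _ m]) (auto simp: char_matrix_def block_def)
  also have "\<dots> = (\<Sum>p | p permutes {0..<m}.
     signof p * (\<Prod>i=0..<m. (if i = p i then c else 0) - y $ ix (Suc i) $ ix (Suc (p i))))"
  proof (intro sum.cong refl, goal_cases)
    case (1 p)
    then have "p i < m" if "i < m" for i
      using that permutes_in_image[of p "{0..<m}" i] by simp
    then show ?case
      by (intro arg_cong2[of _ _ _ _ "(*)"] refl prod.cong)
         (auto simp: char_matrix_def block_def ent_def)
  qed
  finally show ?thesis .
qed

lemma prod_list_ge_power:
  assumes "\<And>a. a \<in> set as \<Longrightarrow> e \<le> cmod (c - a)" "0 \<le> e"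
  shows "e ^ length as \<le> cmod (\<Prod>a\<leftarrow>as. c - a)"
  using assms(1)
proof (induction as)
  case (Cons a as)
  then have "e * e ^ length as \<le> cmod (c - a) * cmod (\<Prod>a\<leftarrow>as. c - a)"
    using assms(2) by (intro mult_mono) auto
  then show ?case by (simp add: norm_mult)
qed simp

text \<open>If all roots of the characteristic polynomial of the block of \<open>y\<close> had
  distance at least \<open>e\<close> from \<open>c\<close>, its value at \<open>c\<close> would have
  modulus at least \<open>e ^ m\<close>; but this value tends to 0 as \<open>y\<close> tends to
  \<open>x\<close>.\<close>

lemma eigenvalue_near:
  fixes x :: "'n::{finite,linorder} cmat"
  assumes ev: "eigenvalue (block m x) c" and e: "0 < e"
  shows "\<forall>\<^sub>F y in nhds x. \<exists>c'. eigenvalue (block m y) c' \<and> cmod (c' - c) < e"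
proof -
  let ?f = "\<lambda>y. poly (char_poly (block m y)) c"
  have 0: "?f x = 0"
    using ev eigenvalue_root_char_poly[OF block_carrier[of m x]] by blast
  have "(?f \<longlongrightarrow> ?f x) (nhds x)"
    unfolding poly_char_poly_block by (intro tendsto_intros filterlim_ident)
  then have "\<forall>\<^sub>F y in nhds x. cmod (?f y) < e ^ m"
    using e unfolding 0 tendsto_iff by (auto simp: dist_norm)
  then show ?thesis
  proof eventually_elim
    case (elim y)
    obtain as where as: "char_poly (block m y) = (\<Prod>a\<leftarrow>as. [:- a, 1:])" "length as = m"
      using char_poly_factorized[OF block_carrier] by blast
    have p: "poly (char_poly (block m y)) d = (\<Prod>a\<leftarrow>as. d - a)" for d
      unfolding as by (simp add: poly_prod_list o_def)
    have "\<exists>a\<in>set as. cmod (c - a) < e"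
    proof (rule ccontr)
      assume "\<not> ?thesis"
      then have "e ^ length as \<le> cmod (\<Prod>a\<leftarrow>as. c - a)"
        using e by (intro prod_list_ge_power) auto
      with elim p as show False by simp
    qed
    then obtain a where a: "a \<in> set as" "cmod (c - a) < e" by blast
    have "poly (char_poly (block m y)) a = 0"
      unfolding p using a(1) by (auto simp: prod_list_zero_iff)
    then have "eigenvalue (block m y) a"
      using eigenvalue_root_char_poly[OF block_carrier[of m y]] by blast
    with a show ?case by (metis norm_minus_commute)
  qed
qed

section \<open>Gaps between eigenvalues and uniqueness of nearby lifts\<close>

lemma e_Omega_gap:
  fixes \<nu> :: tuple
  obtains \<delta> where "0 < \<delta>"
    "\<And>a b c d. a \<le> n \<Longrightarrow> b \<le> n \<Longrightarrow> c \<le> n \<Longrightarrow> d \<le> n \<Longrightarrow> cmod (\<nu> a b - \<nu> c d) < \<delta> \<Longrightarrow> \<nu> a b = \<nu> c d"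
proof -
  \<comment> \<open>The element 1 keeps the set nonempty, so that its minimum exists.\<close>
  define Z where "Z = insert 1 ((\<lambda>(a, b, c, d). cmod (\<nu> a b - \<nu> c d)) ` ({..n} \<times> {..n} \<times> {..n} \<times> {..n}) - {0})"
  have Z: "finite Z" "Z \<noteq> {}" "\<forall>z\<in>Z. 0 < z" by (auto simp: Z_def)
  show ?thesis
  proof
    show "0 < Min Z" using Z by simp
    fix a b c d assume *: "a \<le> n" "b \<le> n" "c \<le> n" "d \<le> n" "cmod (\<nu> a b - \<nu> c d) < Min Z"
    show "\<nu> a b = \<nu> c d"
    proof (rule ccontr)
      assume "\<nu> a b \<noteq> \<nu> c d"
      then have "cmod (\<nu> a b - \<nu> c d) \<in> Z"
        using * by (auto simp: Z_def intro!: rev_image_eqI[of "(a,b,c,d)"])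
      with Z * show False by (meson Min_le not_le)
    qed
  qed
qed

text \<open>Eigenvalues of \<open>y\<close> within half a gap of those of \<open>x\<close> inherit
  their labels and all required inequalities, since a coincidence would bring two different original
  ones closer than the gap. In particular every \<open>y\<close> near \<open>x\<close> lies in
  \<open>M_Omega\<close>.\<close>

lemma M_Omega_e_near:
  fixes x :: "'n::{finite,linorder} cmat"
  assumes z: "(\<nu>, x) \<in> M_Omega_e" and e: "0 < e"
  shows "\<forall>\<^sub>F y in nhds x. \<exists>\<nu>'. (\<nu>', y) \<in> M_Omega_e \<and> (\<forall>k m. cmod (\<nu>' k m - \<nu> k m) < e)"
proof -
  let ?n = "CARD('n)"
  obtain \<delta> where \<delta>: "0 < \<delta>"
    "\<And>a b c d. a \<le> ?n \<Longrightarrow> b \<le> ?n \<Longrightarrow> c \<le> ?n \<Longrightarrow> d \<le> ?n \<Longrightarrow> cmod (\<nu> a b - \<nu> c d) < \<delta> \<Longrightarrow> \<nu> a b = \<nu> c d"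
    using e_Omega_gap[of ?n \<nu>] by metis
  define e' where "e' = min e (\<delta> / 2)"
  have e': "0 < e'" "e' \<le> e" "e' \<le> \<delta> / 2" using e \<delta>(1) by (auto simp: e'_def)
  have \<nu>: "\<nu> \<in> e_Omega ?n" using z by (rule M_Omega_e_e)
  have "\<forall>\<^sub>F y in nhds x. \<forall>m\<in>{1..?n}. \<forall>k\<in>{1..m}. \<exists>c. eigenvalue (block m y) c \<and> cmod (c - \<nu> k m) < e'"
    using z e' by (intro eventually_ball_finite ballI eigenvalue_near) (auto simp: M_Omega_e_iff)
  then show ?thesis
  proof eventually_elim
    case (elim y)
    then have "\<forall>m k. \<exists>c. m \<in> {1..?n} \<and> k \<in> {1..m} \<longrightarrow> eigenvalue (block m y) c \<and> cmod (c - \<nu> k m) < e'"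
      by blast
    then obtain f where f: "\<And>m k. m \<in> {1..?n} \<Longrightarrow> k \<in> {1..m} \<Longrightarrow> eigenvalue (block m y) (f m k) \<and> cmod (f m k - \<nu> k m) < e'"
      by metis
    define \<nu>' where "\<nu>' k m = (if 1 \<le> k \<and> k \<le> m \<and> m \<le> ?n then f m k else 0)" for k m
    have eq: "\<nu> a b = \<nu> c d" if "\<nu>' a b = \<nu>' c d" "1 \<le> a" "a \<le> b" "b \<le> ?n" "1 \<le> c" "c \<le> d" "d \<le> ?n" for a b c d
    proof (rule \<delta>(2))
      have "cmod (\<nu>' a b - \<nu> a b) < e'" "cmod (\<nu>' c d - \<nu> c d) < e'"
        using f[of b a] f[of d c] that by (auto simp: \<nu>'_def)
      then have "cmod ((\<nu>' c d - \<nu> c d) - (\<nu>' a b - \<nu> a b)) < e' + e'"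
        using norm_triangle_ineq4[of "\<nu>' c d - \<nu> c d" "\<nu>' a b - \<nu> a b"] by linarith
      then show "cmod (\<nu> a b - \<nu> c d) < \<delta>" using e' that(1) by simp
    qed (use that in auto)
    have "\<nu>' \<in> e_Omega ?n"
      unfolding e_Omega_def
    proof (intro CollectI conjI allI impI ballI notI)
      fix k m assume "\<not> (1 \<le> k \<and> k \<le> m \<and> m \<le> ?n)"
      then show "\<nu>' k m = 0" by (auto simp: \<nu>'_def)
    next
      fix m assume m: "m \<in> {1..?n}"
      show "inj_on (\<lambda>k. \<nu>' k m) {1..m}"
      proof (rule inj_onI)
        fix k l assume *: "k \<in> {1..m}" "l \<in> {1..m}" "\<nu>' k m = \<nu>' l m"
        then have "\<nu> k m = \<nu> l m" using m by (intro eq) auto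
        then show "k = l" using e_Omega_inj[OF \<nu>, of m k l] * m by simp
      qed
    next
      fix m i j assume *: "m \<in> {1..?n - 1}" "i \<in> {1..m}" "j \<in> {1..m+1}" "\<nu>' i m = \<nu>' j (m+1)"
      then have "\<nu> i m = \<nu> j (m+1)" by (intro eq) auto
      with \<nu> * show False by (auto simp: e_Omega_def)
    qed
    moreover have "cmod (\<nu>' k m - \<nu> k m) < e" for k m
    proof (cases "1 \<le> k \<and> k \<le> m \<and> m \<le> ?n")
      case True
      then show ?thesis using f[of m k] e' by (simp add: \<nu>'_def)
    next
      case False
      then have "\<nu> k m = 0" using \<nu> by (auto simp: e_Omega_def)
      with False show ?thesis using e by (auto simp: \<nu>'_def)
    qed
    moreover have "eigenvalue (block m y) (\<nu>' k m)" if "m \<in> {1..?n}" "k \<in> {1..m}" for m k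
      using f[OF that] that by (simp add: \<nu>'_def)
    ultimately show ?case
      by (intro exI[of _ \<nu>']) (simp add: M_Omega_e_iff)
  qed
qed

lemma M_Omega_e_same:
  fixes y :: "'n::{finite,linorder} cmat"
  assumes z: "(\<nu>', y) \<in> M_Omega_e" "(\<nu>'', y) \<in> M_Omega_e" "k \<in> {1..m}" "m \<le> CARD('n)"
  obtains l where "l \<in> {1..m}" "\<nu>' k m = \<nu>'' l m"
proof -
  have "eigenvalue (block m y) (\<nu>' k m)"
    using z(1,3,4) by (auto simp: M_Omega_e_iff)
  moreover have "similar_mat (nu_mat \<nu>'' m) (block m y)"
    using z(2,3,4) by (auto simp: M_Omega_e_def)
  ultimately show ?thesis using eigenvalue_nu_mat that by blast
qed

text \<open>Both tuples list the spectra of the same blocks. An eigenvalue within half a gap of both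
  \<open>\<nu> k m\<close> and \<open>\<nu> l m\<close> forces k = l, so the two labellings
  agree.\<close>

lemma M_Omega_e_unique:
  fixes y :: "'n::{finite,linorder} cmat"
  assumes \<nu>: "\<nu> \<in> e_Omega CARD('n)"
    and \<delta>: "\<And>a b c d. a \<le> CARD('n) \<Longrightarrow> b \<le> CARD('n) \<Longrightarrow> c \<le> CARD('n) \<Longrightarrow> d \<le> CARD('n) \<Longrightarrow>
      cmod (\<nu> a b - \<nu> c d) < \<delta> \<Longrightarrow> \<nu> a b = \<nu> c d"
    and z: "(\<nu>', y) \<in> M_Omega_e" "(\<nu>'', y) \<in> M_Omega_e"
    and n: "\<And>k m. k \<in> {1..m} \<Longrightarrow> m \<le> CARD('n) \<Longrightarrow> cmod (\<nu>' k m - \<nu> k m) < \<delta> / 2"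
      "\<And>k m. k \<in> {1..m} \<Longrightarrow> m \<le> CARD('n) \<Longrightarrow> cmod (\<nu>'' k m - \<nu> k m) < \<delta> / 2"
  shows "\<nu>' = \<nu>''"
proof (intro ext)
  fix k m
  show "\<nu>' k m = \<nu>'' k m"
  proof (cases "1 \<le> k \<and> k \<le> m \<and> m \<le> CARD('n)")
    case True
    then have k: "k \<in> {1..m}" "m \<le> CARD('n)" by auto
    obtain l where l: "l \<in> {1..m}" "\<nu>' k m = \<nu>'' l m"
      using M_Omega_e_same[OF z k] by blast
    have "cmod ((\<nu>'' l m - \<nu> l m) - (\<nu>' k m - \<nu> k m)) < \<delta> / 2 + \<delta> / 2"
      using norm_triangle_ineq4[of "\<nu>'' l m - \<nu> l m" "\<nu>' k m - \<nu> k m"] n(1)[OF k] n(2)[OF l(1) k(2)]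
      by linarith
    then have "cmod (\<nu> k m - \<nu> l m) < \<delta>" using l by simp
    then have "\<nu> k m = \<nu> l m" using k l by (intro \<delta>) auto
    then have "k = l" using e_Omega_inj[OF \<nu> k(2,1) l(1)] by simp
    with l show ?thesis by simp
  next
    case False
    then show ?thesis
      using M_Omega_e_e[OF z(1)] M_Omega_e_e[OF z(2)] by (auto simp: e_Omega_def)
  qed
qed

text \<open>Provides the witness behind the \<open>SOME\<close> in
  \<open>section_at\<close>.\<close>

lemma section_exists:
  fixes z :: "tuple \<times> 'n::{finite,linorder} cmat"
  assumes z: "z \<in> M_Omega_e"
  shows "\<exists>s U. open U \<and> pi_n z \<in> U \<and> continuous_on U s \<and>
      (\<forall>x\<in>U. s x \<in> M_Omega_e \<and> pi_n (s x) = x) \<and> s (pi_n z) = z"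
proof -
  let ?n = "CARD('n)"
  obtain \<nu> x where zz: "z = (\<nu>, x)" by (cases z)
  obtain \<delta> where \<delta>: "0 < \<delta>"
    "\<And>a b c d. a \<le> ?n \<Longrightarrow> b \<le> ?n \<Longrightarrow> c \<le> ?n \<Longrightarrow> d \<le> ?n \<Longrightarrow> cmod (\<nu> a b - \<nu> c d) < \<delta> \<Longrightarrow> \<nu> a b = \<nu> c d"
    using e_Omega_gap[of ?n \<nu>] by metis
  have \<nu>: "\<nu> \<in> e_Omega ?n" using z zz M_Omega_e_e by blast
  note uniq = M_Omega_e_unique[OF \<nu> \<delta>(2)]
  \<comment> \<open>Lifts are chosen within \<delta>/3 of \<nu>, while uniqueness holds within
    \<delta>/2. The remaining \<delta>/6 lets any lift near \<open>t y\<close> be identified with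
    the chosen one, which gives continuity.\<close>
  let ?N = "\<lambda>y \<nu>'. (\<nu>', y) \<in> M_Omega_e \<and> (\<forall>k m. cmod (\<nu>' k m - \<nu> k m) < \<delta> / 3)"
  define t where "t y = (SOME \<nu>'. ?N y \<nu>')" for y :: "'n cmat"
  have "\<forall>\<^sub>F y in nhds x. \<exists>\<nu>'. ?N y \<nu>'"
    using z zz \<delta>(1) by (intro M_Omega_e_near) auto
  then obtain U where U: "open U" "x \<in> U" "\<And>y. y \<in> U \<Longrightarrow> \<exists>\<nu>'. ?N y \<nu>'"
    by (auto simp: eventually_nhds)
  have t: "?N y (t y)" if "y \<in> U" for y
    unfolding t_def using someI_ex[OF U(3)[OF that]] .
  have "cmod (t x k m - \<nu> k m) < \<delta> / 2" for k m
    using t[OF U(2), THEN conjunct2, rule_format, of k m] \<delta>(1) by linarith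
  then have tx: "t x = \<nu>"
    using t[OF U(2)] z \<delta>(1) unfolding zz by (intro uniq[where y = x]) auto
  have c: "continuous_on U (\<lambda>y. t y k m)" for k m
    unfolding continuous_on
  proof (intro ballI tendstoI)
    fix y and e :: real assume y: "y \<in> U" and e: "0 < e"
    let ?e = "min e (\<delta> / 6)"
    have "\<forall>\<^sub>F y' in nhds y. \<exists>\<nu>'. (\<nu>', y') \<in> M_Omega_e \<and> (\<forall>k m. cmod (\<nu>' k m - t y k m) < ?e)"
      using t[OF y] e \<delta>(1) by (intro M_Omega_e_near) auto
    moreover have "\<forall>\<^sub>F y' in nhds y. y' \<in> U"
      using U(1) y by (rule eventually_nhds_in_open)
    ultimately have "\<forall>\<^sub>F y' in nhds y. dist (t y' k m) (t y k m) < e"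
    proof eventually_elim
      case (elim y')
      then obtain \<nu>' where \<nu>': "(\<nu>', y') \<in> M_Omega_e" "\<And>k m. cmod (\<nu>' k m - t y k m) < ?e" by blast
      have "cmod (\<nu>' k m - \<nu> k m) < \<delta> / 2" for k m
        using norm_triangle_ineq[of "\<nu>' k m - t y k m" "t y k m - \<nu> k m"] \<nu>'(2)[of k m]
          t[OF y, THEN conjunct2, rule_format, of k m] by simp
      moreover have "cmod (t y' k m - \<nu> k m) < \<delta> / 2" for k m
        using t[OF elim(2), THEN conjunct2, rule_format, of k m] \<delta>(1) by linarith
      ultimately have "t y' = \<nu>'"
        using t[OF elim(2)] \<nu>'(1) by (intro uniq[where y = y']) auto
      with \<nu>'(2)[of k m] show ?case by (simp add: dist_norm)
    qed
    then show "\<forall>\<^sub>F y' in at y within U. dist (t y' k m) (t y k m) < e"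
      unfolding eventually_at_filter by (rule eventually_mono) simp
  qed
  have "continuous_on U t"
    by (intro continuous_on_coordinatewise_then_product c)
  then have "continuous_on U (\<lambda>y. (t y, y))"
    by (intro continuous_on_Pair continuous_on_id)
  with U t tx zz show ?thesis
    by (intro exI[of _ "\<lambda>y. (t y, y)"] exI[of _ U]) auto
qed

definition local_section ::
  "('n::{finite,linorder} cmat) set \<Rightarrow> ('n cmat \<Rightarrow> tuple \<times> 'n cmat) \<Rightarrow> bool" where
  "local_section U s \<longleftrightarrow> open U \<and> continuous_on U s \<and> (\<forall>x\<in>U. s x \<in> M_Omega_e \<and> pi_n (s x) = x)"

lemma section_at:
  fixes z :: "tuple \<times> 'n::{finite,linorder} cmat"
  assumes "z \<in> M_Omega_e"
  obtains U where "local_section U (section_at z)" "pi_n z \<in> U" "section_at z (pi_n z) = z"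
  using someI_ex[OF section_exists[OF assms], folded section_at_def] that
  unfolding local_section_def by blast

lemma local_section_eq:
  assumes "local_section U s" "x \<in> U"
  shows "(fst (s x), x) \<in> M_Omega_e"
  using assms unfolding local_section_def by (metis prod.collapse)

lemma local_section_tendsto:
  assumes s: "local_section U s" and x: "x \<in> U"
  shows "((\<lambda>y. fst (s y) k m) \<longlongrightarrow> fst (s x) k m) (nhds x)"
proof -
  have "continuous_on U (\<lambda>y. fst (s y))"
    using s unfolding local_section_def by (intro continuous_on_fst) simp
  then have "continuous_on U (\<lambda>y. fst (s y) k)"
    by (rule continuous_on_product_then_coordinatewise)
  then have "continuous_on U (\<lambda>y. fst (s y) k m)"
    by (rule continuous_on_product_then_coordinatewise)
  then have "((\<lambda>y. fst (s y) k m) \<longlongrightarrow> fst (s x) k m) (at x)"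
    using s x unfolding local_section_def by (auto simp: continuous_on_eq_continuous_at isCont_def)
  then show ?thesis
    by (simp add: tendsto_nhds_iff)
qed

section \<open>Derivatives\<close>

lemma trace_mm_nth: "trace ((A :: 'n::finite cmat) ** B) = (\<Sum>i\<in>UNIV. \<Sum>k\<in>UNIV. A $ i $ k * B $ k $ i)"
  by (simp add: trace_def mm_nth)

lemma bounded_linear_trace: "bounded_linear (\<lambda>v. trace ((W :: 'n::finite cmat) ** v))"
  unfolding trace_mm_nth
  by (intro bounded_linear_sum bounded_linear_const_mult bounded_linear_compose[OF bounded_linear_vec_nth bounded_linear_vec_nth])

lemma norm_cmat_nth: "cmod ((A :: 'n::finite cmat) $ i $ j) \<le> norm A"
  by (meson Finite_Cartesian_Product.norm_nth_le order_trans)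

text \<open>Caratheodory's form of differentiability: the increment is an exact pairing with a
  convergent matrix \<open>R y\<close>, so the remainder is bounded by the entries of
  \<open>R y - W\<close>.\<close>

lemma has_derivative_trace:
  fixes f :: "'n::finite cmat \<Rightarrow> complex"
  assumes eq: "\<forall>\<^sub>F y in at x. f y - f x = trace (R y ** (y - x))"
    and R: "(R \<longlongrightarrow> W) (at x)"
  shows "(f has_derivative (\<lambda>v. trace (W ** v))) (at x)"
  unfolding has_derivative_within
proof (intro conjI bounded_linear_trace)
  let ?g = "\<lambda>y. \<Sum>i\<in>UNIV. \<Sum>k\<in>UNIV. cmod ((R y - W) $ i $ k)"
  have g: "(?g \<longlongrightarrow> 0) (at x)"
  proof -
    have "(?g \<longlongrightarrow> (\<Sum>i\<in>UNIV. \<Sum>k\<in>UNIV. cmod ((W - W) $ i $ k))) (at x)"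
      by (intro tendsto_intros R)
    then show ?thesis by simp
  qed
  show "((\<lambda>y. (1 / norm (y - x)) *\<^sub>R (f y - (f x + trace (W ** (y - x))))) \<longlongrightarrow> 0) (at x)"
  proof (rule Lim_null_comparison[OF _ g])
    show "\<forall>\<^sub>F y in at x. norm ((1 / norm (y - x)) *\<^sub>R (f y - (f x + trace (W ** (y - x))))) \<le> ?g y"
      using eq
    proof eventually_elim
      case (elim y)
      let ?h = "y - x"
      have "trace ((R y - W) ** ?h) = trace (R y ** ?h) - trace (W ** ?h)"
        by (simp only: mm_distrib(4) trace_sub)
      then have "f y - (f x + trace (W ** ?h)) = trace ((R y - W) ** ?h)"
        using elim by simp
      moreover have "cmod (trace ((R y - W) ** ?h)) \<le> ?g y * norm ?h"
        unfolding trace_mm_nth sum_distrib_right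
        by (intro order_trans[OF norm_sum] sum_mono)
           (auto simp: norm_mult intro!: mult_left_mono norm_cmat_nth simp del: vector_minus_component)
      ultimately show ?case
        by (cases "y = x") (auto simp: divide_simps sum_nonneg)
    qed
  qed
qed

definition munit :: "'n \<Rightarrow> 'n \<Rightarrow> 'n::finite cmat" where
  "munit a b = (\<chi> i j. if i = a \<and> j = b then 1 else 0)"

lemma trace_munit: "trace (W ** munit a b) = W $ b $ (a::'n::finite)"
proof -
  have "trace (W ** munit a b) = (\<Sum>i\<in>UNIV. \<Sum>k\<in>UNIV. if k = a then if i = b then W $ b $ a else 0 else 0)"
    unfolding trace_mm_nth by (intro sum.cong) (auto simp: munit_def)
  then show ?thesis by simp
qed

text \<open>The trace form is nondegenerate, so the matrix in \<open>grad\<close> is unique; pairing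
  with matrix units recovers its entries.\<close>

lemma grad_eqI:
  assumes "(f has_derivative (\<lambda>v. trace ((W :: 'n::finite cmat) ** v))) (at x)"
  shows "grad f x = W"
  unfolding grad_def
proof (rule the_equality[where P = "\<lambda>w. (f has_derivative (\<lambda>v. trace (w ** v))) (at x)", OF assms])
  fix w assume "(f has_derivative (\<lambda>v. trace (w ** v))) (at x)"
  from has_derivative_unique[OF this assms] have "trace (w ** v) = trace (W ** v)" for v
    by metis
  then have "trace (w ** munit b a) = trace (W ** munit b a)" for a b by blast
  then show "w = W" by (simp add: trace_munit vec_eq_iff)
qed

lemma complex_linear_trace:
  fixes D :: "'n::finite cmat \<Rightarrow> complex"
  assumes D: "bounded_linear D" "\<And>c v. D (cscale c v) = c * D v"
  obtains W where "D = (\<lambda>v. trace (W ** v))"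
proof
  interpret bounded_linear D by fact
  show "D = (\<lambda>v. trace ((\<chi> a b. D (munit b a)) ** v))"
  proof
    fix v :: "'n cmat"
    have "v = (\<Sum>i\<in>UNIV. \<Sum>j\<in>UNIV. cscale (v $ i $ j) (munit i j))"
    proof (rule cmat_eqI)
      fix a b
      have "(\<Sum>i\<in>UNIV. \<Sum>j\<in>UNIV. cscale (v $ i $ j) (munit i j)) $ a $ b =
        (\<Sum>i\<in>UNIV. \<Sum>j\<in>UNIV. if j = b then if i = a then v $ a $ b else 0 else 0)"
        unfolding sum_component by (intro sum.cong) (auto simp: munit_def)
      then show "v $ a $ b = (\<Sum>i\<in>UNIV. \<Sum>j\<in>UNIV. cscale (v $ i $ j) (munit i j)) $ a $ b" by simp
    qed
    then have "D v = D (\<Sum>i\<in>UNIV. \<Sum>j\<in>UNIV. cscale (v $ i $ j) (munit i j))" by simp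
    also have "\<dots> = (\<Sum>i\<in>UNIV. \<Sum>j\<in>UNIV. v $ i $ j * D (munit i j))"
      by (simp add: sum D(2))
    also have "\<dots> = (\<Sum>j\<in>UNIV. \<Sum>i\<in>UNIV. v $ i $ j * D (munit i j))"
      by (rule sum.swap)
    finally show "D v = trace ((\<chi> a b. D (munit b a)) ** v)"
      by (simp add: trace_mm_nth mult.commute)
  qed
qed

lemma has_derivative_entry: "((\<lambda>y. (y :: 'n::finite cmat) $ i $ j) has_derivative (\<lambda>v. trace (munit j i ** v))) (at x)"
proof -
  have "trace (munit j i ** v) = v $ i $ j" for v :: "'n cmat"
    using trace_munit[of v j i] by (simp add: trace_mm_sym)
  then show ?thesis
    by (simp add: bounded_linear_imp_has_derivative bounded_linear_compose[OF bounded_linear_vec_nth bounded_linear_vec_nth])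
qed

text \<open>Let \<open>P\<close> be the projection at \<open>x\<close> and \<open>P'\<close> the one
  at \<open>y\<close>. Multiplying \<open>y - x\<close> by \<open>P\<close> on the left and
  \<open>P'\<close> on the right gives exactly the difference of the eigenvalues times
  \<open>P ** P'\<close>. Taking traces and dividing by the trace of \<open>P ** P'\<close>, which
  tends to 1, expresses the increment through a convergent \<open>R y\<close>.\<close>

lemma has_derivative_eigenvalue:
  fixes x :: "'n::{finite,linorder} cmat"
  assumes s: "local_section U s" and x: "x \<in> U" and k: "k \<in> {1..m}" and m: "m \<le> CARD('n)"
  shows "((\<lambda>y. fst (s y) k m) has_derivative (\<lambda>v. trace (Prj (fst (s x)) m k x ** v))) (at x)"
proof -
  let ?\<nu> = "\<lambda>y. fst (s y)"
  let ?Q = "\<lambda>y. Prj (?\<nu> y) m k y"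
  let ?P = "?Q x"
  have zx: "(?\<nu> x, x) \<in> M_Omega_e" using s x by (rule local_section_eq)
  note eO = M_Omega_e_e[OF zx]
  have Qt: "(?Q \<longlongrightarrow> ?P) (at x)"
    by (rule tendsto_Prj[OF _ _ eO k m])
       (auto intro!: local_section_tendsto[OF s x, THEN tendsto_mono[rotated]] simp: at_within_le_nhds)
  have PP: "?P ** ?P = ?P" using Prj_mm[OF zx k m k] by simp
  have tr: "((\<lambda>y. trace (?P ** ?Q y)) \<longlongrightarrow> 1) (at x)"
  proof -
    have "((\<lambda>y. trace (?P ** ?Q y)) \<longlongrightarrow> trace (?P ** ?P)) (at x)"
      by (intro tendsto_intros Qt)
    then show ?thesis by (simp add: PP trace_Prj[OF zx k m])
  qed
  define R where "R y = cscale (1 / trace (?P ** ?Q y)) (?Q y ** ?P)" for y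
  have "(R \<longlongrightarrow> cscale (1 / 1) (?P ** ?P)) (at x)"
    unfolding R_def by (intro tendsto_intros Qt tr) simp
  then have Rt: "(R \<longlongrightarrow> ?P) (at x)" by (simp add: PP)
  have "\<forall>\<^sub>F y in at x. trace (?P ** ?Q y) \<noteq> 0"
    using tr by (rule tendsto_imp_eventually_ne) simp
  moreover have "\<forall>\<^sub>F y in at x. y \<in> U"
    using s x by (intro eventually_at_in_open') (auto simp: local_section_def)
  ultimately have "\<forall>\<^sub>F y in at x. ?\<nu> y k m - ?\<nu> x k m = trace (R y ** (y - x))"
  proof eventually_elim
    case (elim y)
    have zy: "(?\<nu> y, y) \<in> M_Omega_e" using s elim(2) by (rule local_section_eq)
    let ?P' = "?Q y"
    have sP: "?P ** Em m = ?P" "Em m ** ?P' = ?P'"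
      using supp_Em supp_Prj[OF zx k m] supp_Prj[OF zy k m] by blast+
    have "?P ** (y - x) ** ?P' = ?P ** cut m (y - x) ** ?P'"
      unfolding cut_eq[of m "y - x"] using sP by (metis matrix_mul_assoc)
    also have "\<dots> = ?P ** (cut m y ** ?P') - (?P ** cut m x) ** ?P'"
      by (simp add: cut_diff mm_distrib mm_assoc)
    also have "\<dots> = cscale (?\<nu> y k m - ?\<nu> x k m) (?P ** ?P')"
      unfolding cut_Prj[OF zy k m] Prj_cut[OF zx k m] by (simp add: mm_distrib cscale_distrib)
    finally have "trace (?P ** (y - x) ** ?P') = (?\<nu> y k m - ?\<nu> x k m) * trace (?P ** ?P')"
      by simp
    moreover have "trace (?P' ** (?P ** (y - x))) = trace (?P ** (y - x) ** ?P')"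
      by (rule trace_mm_sym)
    moreover have "trace (R y ** (y - x)) = 1 / trace (?P ** ?P') * trace (?P' ** (?P ** (y - x)))"
      by (simp add: R_def mm_distrib(10) mm_assoc)
    ultimately show ?case
      using elim(1) by simp
  qed
  then show ?thesis by (rule has_derivative_trace) (rule Rt)
qed


section \<open>Hamiltonian flows of the eigenvalues\<close>

lemma cut_conj:
  assumes "supp m (H - mat 1)" "m \<le> l"
  shows "cut l (x ** H) = cut l x ** H" "cut l (H ** x) = H ** cut l x"
proof -
  define A where "A = H - mat 1"
  have H: "H = mat 1 + A" "supp m A" using assms by (auto simp: A_def)
  show "cut l (x ** H) = cut l x ** H" "cut l (H ** x) = H ** cut l x"
    unfolding H(1) by (simp_all add: mm_distrib cut_add cut_mm[OF H(2) assms(2)])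
qed

text \<open>Blocks of size at most \<open>m\<close> do not change because \<open>H\<close> commutes
  with the block of size \<open>m\<close>. Larger blocks are conjugated, and \<open>H'\<close>
  carries their eigenvectors along without leaving the block. Hence the same \<nu> remains a
  lift.\<close>

lemma M_Omega_e_conj:
  fixes x :: "'n::{finite,linorder} cmat"
  assumes z: "(\<nu>, x) \<in> M_Omega_e" and m: "m \<le> CARD('n)"
    and H: "H ** H' = mat 1" "H' ** H = mat 1" "supp m (H - mat 1)" "supp m (H' - mat 1)"
    and com: "H ** cut m x = cut m x ** H"
  shows "(\<nu>, H' ** x ** H) \<in> M_Omega_e" "l \<le> m \<Longrightarrow> cut l (H' ** x ** H) = cut l x"
proof -
  have c: "cut l (H' ** x ** H) = H' ** cut l x ** H" if "m \<le> l" for l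
    by (simp add: cut_conj[OF H(3) that] cut_conj[OF H(4) that])
  have "cut m (H' ** x ** H) = H' ** (H ** cut m x)"
    unfolding c[OF order_refl] by (simp add: com mm_assoc)
  also have "\<dots> = cut m x" by (simp add: matrix_mul_assoc H)
  finally have cm: "cut m (H' ** x ** H) = cut m x" .
  then show cl: "cut l (H' ** x ** H) = cut l x" if "l \<le> m" for l
    by (metis cut_cut that)
  have "eigenvalue (block l (H' ** x ** H)) (\<nu> k l)" if l: "l \<in> {1..CARD('n)}" and k: "k \<in> {1..l}" for l k
  proof -
    have lN: "l \<le> CARD('n)" using l by simp
    have "eigenvalue (block l x) (\<nu> k l)" using z l k by (simp add: M_Omega_e_iff)
    then obtain w where w: "w \<noteq> 0" "\<And>i. l < rk i \<Longrightarrow> w $ i = 0" "cut l x *v w = \<nu> k l *s w"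
      unfolding eigenvalue_block[OF lN] by blast
    show ?thesis
    proof (cases "l \<le> m")
      case True
      show ?thesis unfolding eigenvalue_block[OF lN] cl[OF True] using w by blast
    next
      case False
      then have ml: "m \<le> l" by simp
      let ?w = "H' *v w"
      have "H *v ?w = w" by (simp add: matrix_vector_mul_assoc H)
      then have "?w \<noteq> 0" using w(1) by auto
      moreover have "?w $ i = 0" if i: "l < rk i" for i
      proof -
        have "H' $ i $ j = (if i = j then 1 else 0)" for j
        proof (rule ccontr)
          assume "H' $ i $ j \<noteq> (if i = j then 1 else 0)"
          then have "(H' - mat 1) $ i $ j \<noteq> 0" by (auto simp: mat1_nth)
          then have "rk i \<le> m" using H(4) unfolding supp_def by blast
          with i ml show False by simp
        qed
        then have "?w $ i = (\<Sum>j\<in>UNIV. if i = j then w $ j else 0)"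
          unfolding mv_nth by (intro sum.cong) auto
        then show ?thesis using w(2)[OF i] by simp
      qed
      moreover have "cut l (H' ** x ** H) *v ?w = \<nu> k l *s ?w"
      proof -
        have "cut l (H' ** x ** H) *v ?w = H' *v (cut l x *v (H *v ?w))"
          unfolding c[OF ml] by (simp add: matrix_vector_mul_assoc mm_assoc)
        also have "\<dots> = H' *v (\<nu> k l *s w)" using \<open>H *v ?w = w\<close> w(3) by simp
        finally show ?thesis by (simp add: vec_eq_iff mv_nth sum_distrib_left ac_simps)
      qed
      ultimately show ?thesis unfolding eigenvalue_block[OF lN] by blast
    qed
  qed
  then show "(\<nu>, H' ** x ** H) \<in> M_Omega_e"
    using z by (simp add: M_Omega_e_iff)
qed

text \<open>For idempotent \<open>P\<close>, \<open>dil (exp q) P\<close> is the matrix exponential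
  of \<open>q\<close> times \<open>P\<close>. The argument is the multiplier \<open>a\<close> rather
  than \<open>q\<close>, so that products and inverses follow from arithmetic in
  \<open>a\<close>.\<close>

definition dil :: "complex \<Rightarrow> 'n cmat \<Rightarrow> 'n::finite cmat" where
  "dil a P = mat 1 + cscale (a - 1) P"

lemma dil_mm:
  assumes "P ** P = (P :: 'n::finite cmat)"
  shows "dil a P ** dil b P = dil (a * b) P" "dil a P ** P = cscale a P" "P ** dil a P = cscale a P"
  unfolding dil_def by (simp_all add: mm_distrib assms vec_eq_iff algebra_simps)

lemma dil_1 [simp]: "dil 1 P = mat 1"
  by (simp add: dil_def)

lemma supp_dil: "supp m P \<Longrightarrow> supp m (dil a P - mat 1)"
  by (simp add: dil_def supp_cscale)

lemma M_Omega_e_dil: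
  fixes x :: "'n::{finite,linorder} cmat"
  assumes z: "(\<nu>, x) \<in> M_Omega_e" and k: "k \<in> {1..m}" and m: "m \<le> CARD('n)" and a: "a \<noteq> 0"
  defines "P \<equiv> Prj \<nu> m k x"
  shows "(\<nu>, dil (1 / a) P ** x ** dil a P) \<in> M_Omega_e"
    and "l \<le> m \<Longrightarrow> cut l (dil (1 / a) P ** x ** dil a P) = cut l x"
proof -
  have PP: "P ** P = P" using Prj_mm[OF z k m k] by (simp add: P_def)
  have com: "dil a P ** cut m x = cut m x ** dil a P"
    using cut_Prj[OF z k m] Prj_cut[OF z k m] by (simp add: dil_def mm_distrib P_def)
  have s: "supp m P" unfolding P_def by (rule supp_Prj[OF z k m])
  note * = M_Omega_e_conj[OF z m _ _ supp_dil[OF s] supp_dil[OF s] com, of "1 / a"]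
  show "(\<nu>, dil (1 / a) P ** x ** dil a P) \<in> M_Omega_e"
    by (rule *(1)) (simp_all add: dil_mm PP a)
  show "cut l (dil (1 / a) P ** x ** dil a P) = cut l x" if "l \<le> m"
    by (rule *(2)) (simp_all add: dil_mm PP a that)
qed

lemma trace_commutator: "trace (x ** commutator P W) = trace (W ** commutator x (P :: 'n::finite cmat))"
proof -
  have "trace (x ** (P ** W)) = trace (W ** (x ** P))"
    using trace_mm_sym[of "x ** P" W] by (simp add: mm_assoc)
  moreover have "trace (x ** (W ** P)) = trace (W ** (P ** x))"
    using trace_mm_sym[of x "W ** P"] by (simp add: mm_assoc)
  ultimately show ?thesis by (simp add: commutator_def mm_distrib trace_sub)
qed

lemma cut_commutator_Prj:
  fixes x :: "'n::{finite,linorder} cmat"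
  assumes z: "(\<nu>, x) \<in> M_Omega_e" and k: "k \<in> {1..m}" and m: "m \<le> CARD('n)"
  shows "cut m (commutator x (Prj \<nu> m k x)) = 0"
  unfolding commutator_def cut_diff
  by (simp add: cut_mm[OF supp_Prj[OF z k m]] cut_Prj[OF z k m] Prj_cut[OF z k m])

text \<open>This is the Poisson commutativity of the eigenvalue functions. The projection of the
  smaller level pairs only with the upper left block of the commutator of \<open>x\<close> with the
  other projection, and that block is zero; antisymmetry covers the other order.\<close>

lemma trace_commutator_Prj:
  fixes x :: "'n::{finite,linorder} cmat"
  assumes z: "(\<nu>, x) \<in> M_Omega_e" and k: "k \<in> {1..m}" "m \<le> CARD('n)" and l: "l \<in> {1..p}" "p \<le> CARD('n)"
  shows "trace (x ** commutator (Prj \<nu> m k x) (Prj \<nu> p l x)) = 0"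
proof -
  have *: "trace (x ** commutator (Prj \<nu> m k x) (Prj \<nu> p l x)) = 0"
    if k: "k \<in> {1..m}" "m \<le> CARD('n)" and l: "l \<in> {1..p}" "p \<le> CARD('n)" and "p \<le> m" for m k p l
  proof -
    let ?Q = "Prj \<nu> p l x" and ?C = "commutator x (Prj \<nu> m k x)"
    have "supp m ?Q" using supp_mono[OF supp_Prj[OF z l]] that by simp
    then have Q: "?Q = Em m ** ?Q ** Em m" by (simp add: supp_Em)
    have "trace (?Q ** ?C) = trace (Em m ** (?Q ** Em m ** ?C))"
      by (subst Q) (simp add: mm_assoc)
    also have "\<dots> = trace (?Q ** cut m ?C)"
      by (subst trace_mm_sym) (simp add: mm_assoc cut_eq[of m ?C])
    also have "\<dots> = 0"
      by (simp add: cut_commutator_Prj[OF z k] mm_distrib trace_def)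
    finally show ?thesis by (simp add: trace_commutator)
  qed
  have anti: "commutator A B = - commutator B (A :: 'n cmat)" for A B by (simp add: commutator_def)
  show ?thesis
  proof (cases "p \<le> m")
    case True then show ?thesis using * k l by blast
  next
    case False
    then have "trace (x ** commutator (Prj \<nu> p l x) (Prj \<nu> m k x)) = 0" using *[OF l k] by simp
    then show ?thesis
      by (subst anti) (simp add: mm_distrib trace_def sum_negf)
  qed
qed

text \<open>Close to \<open>x\<close> the tuple returned by the section is within half a gap of
  \<nu>, and so it must be \<nu> itself wherever \<open>(\<nu>, f t)\<close> is a lift. This lets a
  curve with constant \<nu> be recovered from its matrix part.\<close>

lemma lift_eventually:
  fixes x :: "'n::{finite,linorder} cmat"
  assumes z: "(\<nu>, x) \<in> M_Omega_e" and f: "(f \<longlongrightarrow> x) F"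
    and ev: "\<forall>\<^sub>F t in F. (\<nu>, f t) \<in> M_Omega_e"
  shows "\<forall>\<^sub>F t in F. section_at (\<nu>, x) (f t) = (\<nu>, f t)"
proof -
  obtain U where s: "local_section U (section_at (\<nu>, x))" and x: "x \<in> U"
    and sx: "section_at (\<nu>, x) x = (\<nu>, x)"
    using section_at[OF z] by auto
  have \<nu>: "\<nu> \<in> e_Omega CARD('n)" using z by (rule M_Omega_e_e)
  obtain \<delta> where \<delta>: "0 < \<delta>"
    "\<And>a b c d. a \<le> CARD('n) \<Longrightarrow> b \<le> CARD('n) \<Longrightarrow> c \<le> CARD('n) \<Longrightarrow> d \<le> CARD('n) \<Longrightarrow> cmod (\<nu> a b - \<nu> c d) < \<delta> \<Longrightarrow> \<nu> a b = \<nu> c d"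
    using e_Omega_gap[of "CARD('n)" \<nu>] by metis
  have "\<forall>\<^sub>F t in F. \<forall>m\<in>{..CARD('n)}. \<forall>k\<in>{1..m}. cmod (fst (section_at (\<nu>, x) (f t)) k m - \<nu> k m) < \<delta> / 2"
  proof (intro eventually_ball_finite ballI)
    fix m k
    have "((\<lambda>t. fst (section_at (\<nu>, x) (f t)) k m) \<longlongrightarrow> fst (section_at (\<nu>, x) x) k m) F"
      using local_section_tendsto[OF s x] f by (rule filterlim_compose)
    then show "\<forall>\<^sub>F t in F. cmod (fst (section_at (\<nu>, x) (f t)) k m - \<nu> k m) < \<delta> / 2"
      unfolding sx fst_conv tendsto_iff dist_norm using half_gt_zero[OF \<delta>(1)] by blast
  qed auto
  moreover have "\<forall>\<^sub>F t in F. f t \<in> U"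
    using f s x by (intro topological_tendstoD) (auto simp: local_section_def)
  ultimately show ?thesis using ev
  proof eventually_elim
    case (elim t)
    have "fst (section_at (\<nu>, x) (f t)) = \<nu>"
      by (rule M_Omega_e_unique[OF \<nu> \<delta>(2) local_section_eq[OF s elim(2)] elim(3)])
         (use elim(1) \<delta>(1) in auto)
    moreover have "snd (section_at (\<nu>, x) (f t)) = f t"
      using s elim(2) by (simp add: local_section_def)
    ultimately show ?case by (metis prod.collapse)
  qed
qed

section \<open>Complex derivatives of matrix curves and the flow in closed form\<close>

definition mderiv :: "(complex \<Rightarrow> 'n::finite cmat) \<Rightarrow> 'n cmat \<Rightarrow> complex \<Rightarrow> bool" where
  "mderiv f D q \<longleftrightarrow> (\<forall>i j. ((\<lambda>q. f q $ i $ j) has_field_derivative D $ i $ j) (at q))"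

lemma mderiv_mm:
  assumes "mderiv f D q" "mderiv g E q"
  shows "mderiv (\<lambda>q. f q ** g q) (D ** g q + f q ** E) q"
  unfolding mderiv_def
proof (intro allI)
  fix i j
  have "((\<lambda>q. \<Sum>k\<in>UNIV. f q $ i $ k * g q $ k $ j) has_field_derivative
    (\<Sum>k\<in>UNIV. D $ i $ k * g q $ k $ j + E $ k $ j * f q $ i $ k)) (at q)"
    using assms unfolding mderiv_def by (intro DERIV_sum DERIV_mult) auto
  then show "((\<lambda>q. (f q ** g q) $ i $ j) has_field_derivative (D ** g q + f q ** E) $ i $ j) (at q)"
    by (simp add: mm_nth sum.distrib mult.commute)
qed

lemma mderiv_const: "mderiv (\<lambda>_. A) 0 q"
  by (simp add: mderiv_def)

lemma mderiv_dil: "mderiv (\<lambda>q. dil (exp (c * q)) P) (cscale (c * exp (c * q)) P) q"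
  unfolding mderiv_def dil_def
  by (auto intro!: derivative_eq_intros)

lemma mderiv_has_derivative:
  assumes f: "mderiv f D q"
  shows "(f has_derivative (\<lambda>h. cscale h D)) (at q)"
  unfolding has_derivative_within
proof
  have "linear (\<lambda>h. cscale h D)"
    by (rule linearI) (simp_all add: vec_eq_iff algebra_simps)
  then show "bounded_linear (\<lambda>h. cscale h D)" by (simp add: linear_conv_bounded_linear)
  show "((\<lambda>y. (1 / norm (y - q)) *\<^sub>R (f y - (f q + cscale (y - q) D))) \<longlongrightarrow> 0) (at q)"
  proof (rule cmat_tendstoI)
    fix i j
    have "((\<lambda>q. f q $ i $ j) has_derivative (\<lambda>h. h * D $ i $ j)) (at q)"
    proof -
      have "(\<lambda>h. h * D $ i $ j) = (*) (D $ i $ j)" by (simp add: fun_eq_iff mult.commute)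
      then show ?thesis using f unfolding mderiv_def has_field_derivative_def by simp
    qed
    then show "((\<lambda>y. ((1 / norm (y - q)) *\<^sub>R (f y - (f q + cscale (y - q) D))) $ i $ j) \<longlongrightarrow> 0 $ i $ j) (at q)"
      unfolding has_derivative_within by simp
  qed
qed

lemma r_fun_eq:
  "1 \<le> k \<Longrightarrow> k \<le> m \<Longrightarrow> r_fun (d_fun (m - 1) + k) = (\<lambda>z. fst z k m)"
  by (rule ext) (metis r_index prod.collapse)

text \<open>Invariance of the trace turns the bracket into a pairing of the gradient
  \<open>W\<close> with the commutator of \<open>x\<close> and its projection: this commutator is
  the Hamiltonian vector field of the eigenvalue.\<close>

lemma lifted_poisson_eigenvalue:
  fixes z :: "tuple \<times> 'n::{finite,linorder} cmat"
  assumes z: "z \<in> M_Omega_e" and k: "k \<in> {1..m}" "m \<le> CARD('n)"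
    and W: "((\<psi> \<circ> section_at z) has_derivative (\<lambda>v. trace (W ** v))) (at (snd z))"
  shows "lifted_poisson (\<lambda>z. fst z k m) \<psi> z = trace (W ** commutator (snd z) (Prj (fst z) m k (snd z)))"
proof -
  obtain U where s: "local_section U (section_at z)" and x: "snd z \<in> U"
    and sx: "section_at z (snd z) = z"
    using section_at[OF z] by auto
  have "grad (\<psi> \<circ> section_at z) (snd z) = W" by (rule grad_eqI[OF W])
  moreover have "grad ((\<lambda>z. fst z k m) \<circ> section_at z) (snd z) = Prj (fst z) m k (snd z)"
    using has_derivative_eigenvalue[OF s x k] unfolding sx o_def by (rule grad_eqI)
  ultimately show ?thesis
    by (simp add: lifted_poisson_def poisson_def trace_commutator)
qed

text \<open>The factor with \<open>exp (- q)\<close> stands on the left because the velocity is x P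
  - P x. The projection is that of the initial point, and it remains the projection along the whole
  curve.\<close>

definition flow :: "tuple \<Rightarrow> nat \<Rightarrow> nat \<Rightarrow> complex \<Rightarrow> 'n cmat \<Rightarrow> 'n::{finite,linorder} cmat" where
  "flow \<nu> m k q x = dil (exp (- q)) (Prj \<nu> m k x) ** x ** dil (exp q) (Prj \<nu> m k x)"

lemma
  fixes x :: "'n::{finite,linorder} cmat"
  assumes z: "(\<nu>, x) \<in> M_Omega_e" and k: "k \<in> {1..m}" and m: "m \<le> CARD('n)"
  shows M_Omega_e_flow: "(\<nu>, flow \<nu> m k q x) \<in> M_Omega_e"
    and cut_flow: "l \<le> m \<Longrightarrow> cut l (flow \<nu> m k q x) = cut l x"
    and Prj_flow: "Prj \<nu> m k' (flow \<nu> m k q x) = Prj \<nu> m k' x"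
  using M_Omega_e_dil[OF z k m, of "exp q"]
  by (auto simp: flow_def exp_minus divide_inverse intro!: Prj_cut_cong)

lemma mderiv_flow:
  fixes x :: "'n::{finite,linorder} cmat"
  assumes z: "(\<nu>, x) \<in> M_Omega_e" and k: "k \<in> {1..m}" and m: "m \<le> CARD('n)"
  shows "mderiv (\<lambda>q. flow \<nu> m k q x) (commutator (flow \<nu> m k q x) (Prj \<nu> m k x)) q"
proof -
  let ?P = "Prj \<nu> m k x"
  have PP: "?P ** ?P = ?P" using Prj_mm[OF z k m k] by simp
  have "mderiv (\<lambda>q. flow \<nu> m k q x)
     ((cscale (- exp (- q)) ?P ** x + dil (exp (- q)) ?P ** 0) ** dil (exp q) ?P +
      dil (exp (- q)) ?P ** x ** cscale (exp q) ?P) q"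
    unfolding flow_def
    using mderiv_mm[OF mderiv_mm[OF mderiv_dil[of "-1" ?P q] mderiv_const[of x q]] mderiv_dil[of 1 ?P q]]
    by simp
  also have "(cscale (- exp (- q)) ?P ** x + dil (exp (- q)) ?P ** 0) ** dil (exp q) ?P +
      dil (exp (- q)) ?P ** x ** cscale (exp q) ?P =
      dil (exp (- q)) ?P ** x ** (dil (exp q) ?P ** ?P) - (?P ** dil (exp (- q)) ?P) ** x ** dil (exp q) ?P"
    by (simp add: mm_distrib dil_mm[OF PP] cscale_distrib)
  also have "\<dots> = commutator (flow \<nu> m k q x) ?P"
    by (simp add: commutator_def flow_def mm_assoc)
  finally show ?thesis .
qed

text \<open>A test function is known to be differentiable only after composition with the section
  through the current point. Near \<open>q\<close> that section maps the matrix curve back to the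
  curve in the covering, so the chain rule on matrices applies.\<close>

lemma integral_curve_flow:
  fixes x :: "'n::{finite,linorder} cmat"
  assumes z: "(\<nu>, x) \<in> M_Omega_e" and k: "k \<in> {1..m}" and m: "m \<le> CARD('n)"
  shows "integral_curve (\<lambda>z. fst z k m) (\<lambda>q. (\<nu>, flow \<nu> m k q x))"
  unfolding integral_curve_def
proof (intro conjI allI impI)
  show "range (\<lambda>q. (\<nu>, flow \<nu> m k q x)) \<subseteq> M_Omega_e"
    using M_Omega_e_flow[OF z k m] by auto
next
  fix q and \<psi> :: "tuple \<times> 'n cmat \<Rightarrow> complex"
  let ?\<gamma> = "\<lambda>q. (\<nu>, flow \<nu> m k q x)" and ?X = "\<lambda>q. flow \<nu> m k q x"
  let ?g = "\<psi> \<circ> section_at (?\<gamma> q)"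
  assume "holo_near (?\<gamma> q) \<psi>"
  then obtain D where D: "(?g has_derivative D) (at (?X q))" "\<And>c v. D (cscale c v) = c * D v"
    unfolding holo_near_def holo_on_def by auto
  obtain W where W: "D = (\<lambda>v. trace (W ** v))"
    using complex_linear_trace[OF has_derivative_bounded_linear[OF D(1)] D(2)] by blast
  note zq = M_Omega_e_flow[OF z k m, of q]
  let ?C = "commutator (?X q) (Prj \<nu> m k x)"
  have "lifted_poisson (\<lambda>z. fst z k m) \<psi> (?\<gamma> q) = trace (W ** ?C)"
    using lifted_poisson_eigenvalue[OF zq k m, of \<psi> W] D(1) by (simp add: W Prj_flow[OF z k m])
  moreover have "((\<psi> \<circ> ?\<gamma>) has_field_derivative trace (W ** ?C)) (at q)"
  proof -
    have X: "(?X has_derivative (\<lambda>h. cscale h ?C)) (at q)"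
      by (rule mderiv_has_derivative[OF mderiv_flow[OF z k m]])
    have "((\<lambda>t. ?g (?X t)) has_derivative (\<lambda>h. D (cscale h ?C))) (at q)"
      by (rule has_derivative_compose[OF X D(1)])
    then have *: "((\<lambda>t. ?g (?X t)) has_field_derivative trace (W ** ?C)) (at q)"
    proof -
      assume that: "((\<lambda>t. ?g (?X t)) has_derivative (\<lambda>h. D (cscale h ?C))) (at q)"
      have "(\<lambda>h. trace (W ** cscale h ?C)) = (*) (trace (W ** ?C))"
        by (simp add: fun_eq_iff mm_distrib mult.commute)
      with that show ?thesis unfolding has_field_derivative_def W by simp
    qed
    have lim: "(?X \<longlongrightarrow> ?X q) (nhds q)"
      using has_derivative_continuous[OF X] by (simp add: isCont_def continuous_within tendsto_nhds_iff)
    have "\<forall>\<^sub>F t in nhds q. section_at (?\<gamma> q) (?X t) = (\<nu>, ?X t)"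
      using M_Omega_e_flow[OF z k m] by (intro lift_eventually[OF zq lim]) auto
    then have "\<forall>\<^sub>F t in nhds q. ?g (?X t) = (\<psi> \<circ> ?\<gamma>) t"
      by eventually_elim simp
    from DERIV_cong_ev[OF refl this refl] * show ?thesis by (simp add: o_def)
  qed
  ultimately show "((\<psi> \<circ> ?\<gamma>) has_field_derivative lifted_poisson (\<lambda>z. fst z k m) \<psi> (?\<gamma> q)) (at q)"
    by simp
qed

text \<open>The defining condition is tested on two families of functions, the coordinates of the
  tuple and the entries of the matrix, which together determine the curve.\<close>

lemma integral_curve_unique:
  fixes x :: "'n::{finite,linorder} cmat"
  assumes k: "k \<in> {1..m}" and m: "m \<le> CARD('n)"
    and \<gamma>: "integral_curve (\<lambda>z. fst z k m) \<gamma>" "\<gamma> 0 = (\<nu>, x)"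
  shows "\<gamma> q = (\<nu>, flow \<nu> m k q x)"
proof -
  have zq: "\<gamma> q \<in> M_Omega_e" for q using \<gamma>(1) by (auto simp: integral_curve_def)
  have z: "(\<nu>, x) \<in> M_Omega_e" using zq[of 0] \<gamma>(2) by simp
  have const: "f q = f (0::complex)" if "\<And>q. (f has_field_derivative 0) (at q)" for f :: "complex \<Rightarrow> complex" and q
    using has_field_derivative_zero_constant[of UNIV f] that by auto
  \<comment> \<open>The derivative is required at every point of the domain of the section because
    \<open>holo_near\<close> asks for holomorphy on a neighbourhood.\<close>
  have deriv: "((\<psi> \<circ> \<gamma>) has_field_derivative
      trace (W (snd (\<gamma> q)) ** commutator (snd (\<gamma> q)) (Prj (fst (\<gamma> q)) m k (snd (\<gamma> q))))) (at q)"
    if W: "\<And>U x. local_section U (section_at (\<gamma> q)) \<Longrightarrow> x \<in> U \<Longrightarrow>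
       ((\<psi> \<circ> section_at (\<gamma> q)) has_derivative (\<lambda>v. trace (W x ** v))) (at x)" for \<psi> W q
  proof -
    obtain U where s: "local_section U (section_at (\<gamma> q))" and x: "snd (\<gamma> q) \<in> U"
      using section_at[OF zq] by blast
    have "holo_near (\<gamma> q) \<psi>"
      unfolding holo_near_def holo_on_def
    proof (intro exI[of _ U] conjI ballI)
      fix y assume "y \<in> U"
      from W[OF s this]
      show "\<exists>D. (\<psi> \<circ> section_at (\<gamma> q) has_derivative D) (at y) \<and> (\<forall>c v. D (cscale c v) = c * D v)"
        by (intro exI[of _ "\<lambda>v. trace (W y ** v)"]) (simp add: mm_distrib)
    qed (use s x in \<open>auto simp: local_section_def\<close>)
    with \<gamma>(1) have "((\<psi> \<circ> \<gamma>) has_field_derivative lifted_poisson (\<lambda>z. fst z k m) \<psi> (\<gamma> q)) (at q)"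
      by (auto simp: integral_curve_def)
    then show ?thesis
      using lifted_poisson_eigenvalue[OF zq k m W[OF s x]] by simp
  qed
  \<comment> \<open>Along the curve the derivative of a coordinate is the Poisson bracket of two
    eigenvalues, hence zero; outside the index range all tuples are 0 by convention.\<close>
  have \<nu>: "fst (\<gamma> q) = \<nu>" for q
  proof (intro ext)
    fix l p
    show "fst (\<gamma> q) l p = \<nu> l p"
    proof (cases "1 \<le> l \<and> l \<le> p \<and> p \<le> CARD('n)")
      case True
      then have l: "l \<in> {1..p}" "p \<le> CARD('n)" by auto
      have "((\<lambda>q. fst (\<gamma> q) l p) has_field_derivative 0) (at q)" for q
      proof -
        have zq': "(fst (\<gamma> q), snd (\<gamma> q)) \<in> M_Omega_e" using zq by simp
        let ?W = "\<lambda>y. Prj (fst (section_at (\<gamma> q) y)) p l y"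
        have "(((\<lambda>z. fst z l p) \<circ> \<gamma>) has_field_derivative
          trace (?W (snd (\<gamma> q)) ** commutator (snd (\<gamma> q)) (Prj (fst (\<gamma> q)) m k (snd (\<gamma> q))))) (at q)"
        proof (rule deriv[where W = ?W])
          fix U y assume "local_section U (section_at (\<gamma> q))" "y \<in> U"
          from has_derivative_eigenvalue[OF this l]
          show "((\<lambda>z. fst z l p) \<circ> section_at (\<gamma> q) has_derivative (\<lambda>v. trace (?W y ** v))) (at y)"
            by (simp add: o_def)
        qed
        moreover have "section_at (\<gamma> q) (snd (\<gamma> q)) = \<gamma> q" using section_at[OF zq] by blast
        ultimately show ?thesis
          using trace_commutator_Prj[OF zq' k m l] by (simp add: o_def trace_commutator)
      qed
      from const[OF this, of q] show ?thesis using \<gamma>(2) by simp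
    next
      case False
      moreover have "fst (\<gamma> q) \<in> e_Omega CARD('n)" "\<nu> \<in> e_Omega CARD('n)"
        using zq[of q] z M_Omega_e_e by (metis prod.collapse)+
      ultimately show ?thesis by (auto simp: e_Omega_def)
    qed
  qed
  define X where "X q = snd (\<gamma> q)" for q
  define P where "P = Prj \<nu> m k x"
  have \<gamma>X: "\<gamma> q = (\<nu>, X q)" for q using \<nu>[of q] by (metis X_def prod.collapse)
  have zX: "(\<nu>, X q) \<in> M_Omega_e" for q using zq[of q] by (simp add: \<gamma>X)
  have dX: "mderiv X (commutator (X q) (Prj \<nu> m k (X q))) q" for q
    unfolding mderiv_def
  proof (intro allI)
    fix i j
    have "(((\<lambda>z. snd z $ i $ j) \<circ> \<gamma>) has_field_derivative
       trace (munit j i ** commutator (snd (\<gamma> q)) (Prj (fst (\<gamma> q)) m k (snd (\<gamma> q))))) (at q)"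
    proof (rule deriv[where W = "\<lambda>_. munit j i"])
      fix U y assume s: "local_section U (section_at (\<gamma> q))" and y: "y \<in> U"
      show "((\<lambda>z. snd z $ i $ j) \<circ> section_at (\<gamma> q) has_derivative (\<lambda>v. trace (munit j i ** v))) (at y)"
        by (rule has_derivative_transform_within_open[OF has_derivative_entry[of i j y], of U])
           (use s y in \<open>auto simp: local_section_def\<close>)
    qed
    moreover have "trace (munit j i ** C) = C $ i $ j" for C :: "'n cmat"
      using trace_munit[of C j i] by (simp add: trace_mm_sym)
    ultimately show "((\<lambda>q. X q $ i $ j) has_field_derivative commutator (X q) (Prj \<nu> m k (X q)) $ i $ j) (at q)"
      by (simp add: o_def \<gamma>X)
  qed
  \<comment> \<open>The velocity has zero block of size \<open>m\<close>, so this block stands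
    still, and with it the projection \<open>P\<close>.\<close>
  have cX: "cut m (X q) = cut m x" for q
  proof (rule cmat_eqI)
    fix i j
    show "cut m (X q) $ i $ j = cut m x $ i $ j"
    proof (cases "rk i \<le> m \<and> rk j \<le> m")
      case True
      have "((\<lambda>q. X q $ i $ j) has_field_derivative 0) (at q)" for q
      proof -
        have "commutator (X q) (Prj \<nu> m k (X q)) $ i $ j = cut m (commutator (X q) (Prj \<nu> m k (X q))) $ i $ j"
          using True by (simp add: cut_def)
        also have "\<dots> = 0" by (simp add: cut_commutator_Prj[OF zX k m])
        finally show ?thesis using dX[of q] by (simp add: mderiv_def) metis
      qed
      from const[OF this, of q] show ?thesis using True \<gamma>(2) by (simp add: cut_def X_def)
    qed (auto simp: cut_def)
  qed
  have PX: "Prj \<nu> m k (X q) = P" for q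
    unfolding P_def by (rule Prj_cut_cong[OF cX])
  have PP: "P ** P = P" using Prj_mm[OF z k m k] by (simp add: P_def)
  \<comment> \<open>Undoing the expected conjugation leaves a curve with derivative zero.\<close>
  define Y where "Y q = dil (exp q) P ** X q ** dil (exp (- q)) P" for q
  have "mderiv Y 0 q" for q
  proof -
    have "mderiv Y ((cscale (exp q) P ** X q + dil (exp q) P ** commutator (X q) P) ** dil (exp (- q)) P +
       dil (exp q) P ** X q ** cscale (- exp (- q)) P) q"
      unfolding Y_def
      using mderiv_mm[OF mderiv_mm[OF mderiv_dil[of 1 P q] dX[of q]] mderiv_dil[of "-1" P q]]
      by (simp add: PX)
    also have "(cscale (exp q) P ** X q + dil (exp q) P ** commutator (X q) P) ** dil (exp (- q)) P +
       dil (exp q) P ** X q ** cscale (- exp (- q)) P =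
       (cscale (exp q) P - dil (exp q) P ** P) ** X q ** dil (exp (- q)) P +
       dil (exp q) P ** X q ** (P ** dil (exp (- q)) P - cscale (exp (- q)) P)"
      by (simp add: commutator_def mm_distrib mm_assoc cscale_distrib)
    also have "\<dots> = 0"
      by (simp add: dil_mm[OF PP] mm_distrib)
    finally show ?thesis .
  qed
  then have "((\<lambda>q. Y q $ i $ j) has_field_derivative 0) (at q)" for i j q
    by (simp add: mderiv_def)
  from const[OF this, of q] have "Y q = Y 0" by (intro cmat_eqI) simp
  also have "Y 0 = x" using \<gamma>(2) by (simp add: Y_def X_def)
  finally have "flow \<nu> m k q x = dil (exp (- q)) P ** Y q ** dil (exp q) P"
    by (simp add: flow_def P_def)
  also have "\<dots> = (dil (exp (- q)) P ** dil (exp q) P) ** X q ** (dil (exp (- q)) P ** dil (exp q) P)"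
    by (simp add: Y_def mm_assoc)
  also have "\<dots> = X q"
    by (simp add: dil_mm[OF PP] mult_exp_exp)
  finally show ?thesis by (simp add: \<gamma>X)
qed

lemma exp_xi_eq:
  fixes x :: "'n::{finite,linorder} cmat"
  assumes z: "(\<nu>, x) \<in> M_Omega_e" and k: "k \<in> {1..m}" and m: "m \<le> CARD('n)"
  shows "exp_xi (r_fun (d_fun (m - 1) + k)) q (\<nu>, x) = (\<nu>, flow \<nu> m k q x)"
proof -
  have r: "r_fun (d_fun (m - 1) + k) = (\<lambda>z :: tuple \<times> 'n cmat. fst z k m)"
    using k by (intro r_fun_eq) auto
  have "(THE \<gamma>. integral_curve (\<lambda>z. fst z k m) \<gamma> \<and> \<gamma> 0 = (\<nu>, x)) = (\<lambda>q. (\<nu>, flow \<nu> m k q x))"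
  proof (rule the_equality)
    show "integral_curve (\<lambda>z. fst z k m) (\<lambda>q. (\<nu>, flow \<nu> m k q x)) \<and> (\<nu>, flow \<nu> m k 0 x) = (\<nu>, x)"
      using integral_curve_flow[OF z k m] by (simp add: flow_def)
  next
    fix \<gamma> assume "integral_curve (\<lambda>z. fst z k m) \<gamma> \<and> \<gamma> 0 = (\<nu>, x)"
    then show "\<gamma> = (\<lambda>q. (\<nu>, flow \<nu> m k q x))"
      using integral_curve_unique[OF k m] by blast
  qed
  then show ?thesis unfolding exp_xi_def r by simp
qed


section \<open>Moving a matrix to Hessenberg form by the torus\<close>

text \<open>Distinct projections of one level annihilate each other, so the product of the matrices
  \<open>dil (\<eta> k)\<close> of these projections for k up to \<open>K\<close> collapses to this
  sum. It is the conjugating matrix of the joint flow of a level.\<close>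

definition dils :: "(nat \<Rightarrow> complex) \<Rightarrow> tuple \<Rightarrow> nat \<Rightarrow> nat \<Rightarrow> 'n cmat \<Rightarrow> 'n::{finite,linorder} cmat" where
  "dils \<eta> \<nu> m K x = mat 1 + (\<Sum>k\<in>{1..K}. cscale (\<eta> k - 1) (Prj \<nu> m k x))"

lemma
  fixes x :: "'n::{finite,linorder} cmat"
  assumes z: "(\<nu>, x) \<in> M_Omega_e" and K: "Suc K \<le> m" and m: "m \<le> CARD('n)"
  shows dils_Suc: "dils \<eta> \<nu> m (Suc K) x = dils \<eta> \<nu> m K x ** dil (\<eta> (Suc K)) (Prj \<nu> m (Suc K) x)"
    and dils_Suc': "dils \<eta> \<nu> m (Suc K) x = dil (\<eta> (Suc K)) (Prj \<nu> m (Suc K) x) ** dils \<eta> \<nu> m K x"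
proof -
  have 0: "Prj \<nu> m k x ** Prj \<nu> m (Suc K) x = 0" "Prj \<nu> m (Suc K) x ** Prj \<nu> m k x = 0" if "k \<in> {1..K}" for k
    using Prj_mm[OF z _ m, of k "Suc K"] Prj_mm[OF z _ m, of "Suc K" k] that K by auto
  define T where "T = (\<Sum>k\<in>{1..K}. cscale (\<eta> k - 1) (Prj \<nu> m k x))"
  have S: "T ** Prj \<nu> m (Suc K) x = 0" "Prj \<nu> m (Suc K) x ** T = 0"
    using 0 by (simp_all add: T_def mm_sum mm_distrib)
  have d: "dils \<eta> \<nu> m K x = mat 1 + T"
    "dils \<eta> \<nu> m (Suc K) x = mat 1 + T + cscale (\<eta> (Suc K) - 1) (Prj \<nu> m (Suc K) x)"
    by (simp_all add: dils_def T_def add.assoc)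
  show "dils \<eta> \<nu> m (Suc K) x = dils \<eta> \<nu> m K x ** dil (\<eta> (Suc K)) (Prj \<nu> m (Suc K) x)"
    "dils \<eta> \<nu> m (Suc K) x = dil (\<eta> (Suc K)) (Prj \<nu> m (Suc K) x) ** dils \<eta> \<nu> m K x"
    unfolding d dil_def by (simp_all add: mm_distrib S)
qed

lemma dils_inverse:
  fixes x :: "'n::{finite,linorder} cmat"
  assumes z: "(\<nu>, x) \<in> M_Omega_e" and m: "m \<le> CARD('n)"
    and \<eta>: "\<And>k. k \<in> {1..m} \<Longrightarrow> \<eta> k * \<theta> k = 1"
  shows "K \<le> m \<Longrightarrow> dils \<eta> \<nu> m K x ** dils \<theta> \<nu> m K x = mat 1"
proof (induction K)
  case (Suc K)
  let ?P = "Prj \<nu> m (Suc K) x"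
  have PP: "?P ** ?P = ?P" using Prj_mm[OF z _ m, of "Suc K" "Suc K"] Suc.prems by simp
  have "dils \<eta> \<nu> m (Suc K) x ** dils \<theta> \<nu> m (Suc K) x =
      dils \<eta> \<nu> m K x ** (dil (\<eta> (Suc K)) ?P ** dil (\<theta> (Suc K)) ?P) ** dils \<theta> \<nu> m K x"
    unfolding dils_Suc[OF z Suc.prems m, of \<eta>] dils_Suc'[OF z Suc.prems m, of \<theta>] by (simp add: mm_assoc)
  also have "dil (\<eta> (Suc K)) ?P ** dil (\<theta> (Suc K)) ?P = mat 1"
    using \<eta>[of "Suc K"] Suc.prems by (simp add: dil_mm[OF PP])
  finally show ?case using Suc by simp
qed (simp add: dils_def)

lemma dils_cong: "(\<And>k. k \<in> {1..K} \<Longrightarrow> \<eta> k = \<theta> k) \<Longrightarrow> dils \<eta> \<nu> m K x = dils \<theta> \<nu> m K x"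
  by (simp add: dils_def)

lemma dils_cut_cong: "cut m x = cut m y \<Longrightarrow> dils \<eta> \<nu> m K x = dils \<eta> \<nu> m K y"
  unfolding dils_def by (simp add: Prj_cut_cong[of m x y])

text \<open>Each flow of the level fixes the block of size \<open>m\<close>, so all projections may
  be evaluated at the initial \<open>y\<close> and the flows compose to one conjugation. Membership
  and the unchanged block are carried through the induction because the next flow requires
  them.\<close>

lemma level_flow:
  fixes y :: "'n::{finite,linorder} cmat"
  assumes z: "(\<nu>, y) \<in> M_Omega_e" and m: "m \<le> CARD('n)"
  shows "K \<le> m \<Longrightarrow>
    fold (\<lambda>j. exp_xi (r_fun j) (q j)) (map (\<lambda>k. d_fun (m - 1) + k) [1..<Suc K]) (\<nu>, y) =
      (\<nu>, dils (\<lambda>k. exp (- q (d_fun (m - 1) + k))) \<nu> m K y ** y **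
          dils (\<lambda>k. exp (q (d_fun (m - 1) + k))) \<nu> m K y) \<and>
    (\<nu>, dils (\<lambda>k. exp (- q (d_fun (m - 1) + k))) \<nu> m K y ** y **
          dils (\<lambda>k. exp (q (d_fun (m - 1) + k))) \<nu> m K y) \<in> M_Omega_e \<and>
    cut m (dils (\<lambda>k. exp (- q (d_fun (m - 1) + k))) \<nu> m K y ** y **
          dils (\<lambda>k. exp (q (d_fun (m - 1) + k))) \<nu> m K y) = cut m y"
proof (induction K)
  case 0
  then show ?case using z by (simp add: dils_def)
next
  case (Suc K)
  let ?a = "\<lambda>k. exp (- q (d_fun (m - 1) + k))" and ?b = "\<lambda>k. exp (q (d_fun (m - 1) + k))"
  let ?Y = "dils ?a \<nu> m K y ** y ** dils ?b \<nu> m K y"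
  have IH: "fold (\<lambda>j. exp_xi (r_fun j) (q j)) (map (\<lambda>k. d_fun (m - 1) + k) [1..<Suc K]) (\<nu>, y) = (\<nu>, ?Y)"
    "(\<nu>, ?Y) \<in> M_Omega_e" "cut m ?Y = cut m y"
    using Suc by auto
  have k: "Suc K \<in> {1..m}" using Suc.prems by simp
  let ?q = "q (d_fun (m - 1) + Suc K)"
  let ?Y' = "dils ?a \<nu> m (Suc K) y ** y ** dils ?b \<nu> m (Suc K) y"
  have eq: "flow \<nu> m (Suc K) ?q ?Y = ?Y'"
    unfolding flow_def Prj_cut_cong[OF IH(3)] dils_Suc'[OF z Suc.prems m, of ?a] dils_Suc[OF z Suc.prems m, of ?b]
    by (simp only: mm_assoc)
  have "fold (\<lambda>j. exp_xi (r_fun j) (q j)) (map (\<lambda>k. d_fun (m - 1) + k) [1..<Suc (Suc K)]) (\<nu>, y) =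
     exp_xi (r_fun (d_fun (m - 1) + Suc K)) ?q (\<nu>, ?Y)"
    using IH(1) by simp
  also have "\<dots> = (\<nu>, ?Y')"
    unfolding exp_xi_eq[OF IH(2) k m] eq by (rule refl)
  finally show ?case
    using M_Omega_e_flow[OF IH(2) k m, of ?q] cut_flow[OF IH(2) k m order_refl, of ?q] IH(3)
    unfolding eq by simp
qed

lemma level_flow_inverse:
  fixes x :: "'n::{finite,linorder} cmat"
  assumes z: "(\<nu>, x) \<in> M_Omega_e" and m: "m \<le> CARD('n)"
    and q: "\<And>k. k \<in> {1..m} \<Longrightarrow> exp (q (d_fun (m - 1) + k)) = \<eta> k"
  defines "y \<equiv> dils \<eta> \<nu> m m x ** x ** dils (\<lambda>k. 1 / \<eta> k) \<nu> m m x"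
  shows "(\<nu>, y) \<in> M_Omega_e"
    "fold (\<lambda>j. exp_xi (r_fun j) (q j)) (map (\<lambda>k. d_fun (m - 1) + k) [1..<Suc m]) (\<nu>, y) = (\<nu>, x)"
proof -
  have \<eta>: "\<eta> k \<noteq> 0" if "k \<in> {1..m}" for k using q[OF that] by (metis exp_not_eq_zero)
  let ?a = "\<lambda>k. exp (- q (d_fun (m - 1) + k))" and ?b = "\<lambda>k. exp (q (d_fun (m - 1) + k))"
  have a: "dils ?a \<nu> m m x' = dils (\<lambda>k. 1 / \<eta> k) \<nu> m m x'" for x' :: "'n cmat"
  proof (rule dils_cong)
    fix k assume "k \<in> {1..m}"
    from q[OF this] show "exp (- q (d_fun (m - 1) + k)) = 1 / \<eta> k" by (simp add: exp_minus divide_inverse)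
  qed
  have b: "dils ?b \<nu> m m x' = dils \<eta> \<nu> m m x'" for x' :: "'n cmat"
    by (rule dils_cong) (rule q)
  have y: "(\<nu>, y) \<in> M_Omega_e" "cut m y = cut m x"
    \<comment> \<open>By its definition \<open>y\<close> is the result of running the level from
      \<open>x\<close> with the parameters negated.\<close>
    using level_flow[OF z m order_refl, of "\<lambda>j. - q j"] unfolding minus_minus a b y_def by blast+
  then show "(\<nu>, y) \<in> M_Omega_e" by simp
  have inv: "dils (\<lambda>k. 1 / \<eta> k) \<nu> m m x ** dils \<eta> \<nu> m m x = mat 1"
    using \<eta> by (intro dils_inverse[OF z m _ order_refl]) simp
  have "fold (\<lambda>j. exp_xi (r_fun j) (q j)) (map (\<lambda>k. d_fun (m - 1) + k) [1..<Suc m]) (\<nu>, y) =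
     (\<nu>, dils (\<lambda>k. 1 / \<eta> k) \<nu> m m x ** y ** dils \<eta> \<nu> m m x)"
    using level_flow[OF y(1) m order_refl, of q]
    unfolding a b dils_cut_cong[OF y(2)] by blast
  also have "dils (\<lambda>k. 1 / \<eta> k) \<nu> m m x ** y ** dils \<eta> \<nu> m m x =
     (dils (\<lambda>k. 1 / \<eta> k) \<nu> m m x ** dils \<eta> \<nu> m m x) ** x ** (dils (\<lambda>k. 1 / \<eta> k) \<nu> m m x ** dils \<eta> \<nu> m m x)"
    by (simp add: y_def mm_assoc)
  finally show "fold (\<lambda>j. exp_xi (r_fun j) (q j)) (map (\<lambda>k. d_fun (m - 1) + k) [1..<Suc m]) (\<nu>, y) = (\<nu>, x)"
    by (simp add: inv)
qed

text \<open>The Hessenberg condition on the part of row \<open>r\<close> left of the diagonal.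
  Splitting \<open>b_e\<close> into these conditions allows the rows to be normalised one at a
  time.\<close>

definition hrow :: "nat \<Rightarrow> 'n::{finite,linorder} cmat \<Rightarrow> bool" where
  "hrow r y \<longleftrightarrow> (\<forall>j. rk j < r \<longrightarrow> y $ ix r $ j = (if rk j = r - 1 then 1 else 0))"

lemma b_e_iff: "(y :: 'n::{finite,linorder} cmat) \<in> b_e \<longleftrightarrow> (\<forall>r\<in>{2..CARD('n)}. hrow r y)"
proof
  assume y: "y \<in> b_e"
  show "\<forall>r\<in>{2..CARD('n)}. hrow r y"
    unfolding hrow_def
  proof (intro ballI allI impI)
    fix r and j :: 'n assume r: "r \<in> {2..CARD('n)}" and j: "rk j < r"
    show "y $ ix r $ j = (if rk j = r - 1 then 1 else 0)"
    proof (cases "rk j = r - 1")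
      case True
      have "\<forall>i\<in>{1..CARD('n) - 1}. ent y (i + 1) i = 1" using y unfolding b_e_def by simp
      moreover have "r - 1 \<in> {1..CARD('n) - 1}" using r by auto
      ultimately have "ent y ((r - 1) + 1) (r - 1) = 1" by blast
      moreover have "r - 1 + 1 = r" using r by simp
      moreover have "ix (r - 1) = j" by (metis True ix_rk)
      ultimately show ?thesis using True by (simp add: ent_def)
    next
      case False
      have "ent y r (rk j) = 0" using y r j False rk_ge1[of j] unfolding b_e_def by auto
      then show ?thesis using False by (simp add: ent_def)
    qed
  qed
next
  assume h: "\<forall>r\<in>{2..CARD('n)}. hrow r y"
  show "y \<in> b_e"
    unfolding b_e_def
  proof (intro CollectI conjI ballI impI)
    fix i assume i: "i \<in> {1..CARD('n) - 1}"
    then have "hrow (i + 1) y" using h by auto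
    then show "ent y (i + 1) i = 1" using i unfolding hrow_def ent_def by auto
  next
    fix i j assume ij: "i \<in> {1..CARD('n)}" "j \<in> {1..CARD('n)}" "i > j + 1"
    then have "hrow i y" using h by auto
    then show "ent y i j = 0" using ij unfolding hrow_def ent_def by auto
  qed
qed

text \<open>The projection onto a simple eigenvalue is a column times a row, so its 2 by 2 minors
  vanish. This is why one scalar per projection can correct a whole row.\<close>

lemma Prj_rank_one:
  fixes x :: "'n::{finite,linorder} cmat"
  assumes z: "(\<nu>, x) \<in> M_Omega_e" and k: "k \<in> {1..m}" and m: "m \<le> CARD('n)"
  shows "Prj \<nu> m k x $ a $ b * Prj \<nu> m k x $ c $ d = Prj \<nu> m k x $ a $ d * Prj \<nu> m k x $ c $ b"
proof -
  have "1 \<le> m" using k by simp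
  from spectral[OF z this m] obtain g g' :: "'n cmat" where
    g: "supp m g" "supp m g'" "g ** g' = Em m" "g' ** g = Em m"
    and X: "cut m x = g ** dgm (\<lambda>k. \<nu> k m) m ** g'" .
  have *: "Prj \<nu> m k x $ a $ b = g $ a $ ix k * g' $ ix k $ b" for a b
  proof -
    have "Prj \<nu> m k x $ a $ b = (g ** (dgm (\<lambda>l. if l = k then 1 else 0) m ** g')) $ a $ b"
      unfolding Prj_diag[OF g X M_Omega_e_e[OF z] k m] by (simp add: mm_assoc)
    also have "\<dots> = (\<Sum>l::'n\<in>UNIV. g $ a $ l * (if rk l \<le> m then (if rk l = k then 1 else 0) * g' $ l $ b else 0))"
      unfolding mm_nth[of g] dgm_mm_nth by (rule refl)
    also have "\<dots> = (\<Sum>l::'n\<in>UNIV. if l = ix k then g $ a $ ix k * g' $ ix k $ b else 0)"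
      using k m by (intro sum.cong) auto
    finally show ?thesis by simp
  qed
  show ?thesis unfolding * by simp
qed

lemma hrow_mm:
  fixes p :: "'n::{finite,linorder} cmat"
  assumes h: "hrow (Suc m) p" and m: "1 \<le> m" "m < CARD('n)" and A: "supp m A"
  shows "(p ** A) $ ix (Suc m) $ j = A $ ix m $ j"
proof -
  have "(p ** A) $ ix (Suc m) $ j = (\<Sum>l::'n\<in>UNIV. if l = ix m then A $ ix m $ j else 0)"
    unfolding mm_nth
  proof (intro sum.cong refl)
    fix l :: 'n
    show "p $ ix (Suc m) $ l * A $ l $ j = (if l = ix m then A $ ix m $ j else 0)"
    proof (cases "rk l \<le> m")
      case True
      then have "p $ ix (Suc m) $ l = (if rk l = m then 1 else 0)"
        using h unfolding hrow_def by simp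
      then show ?thesis using m by auto
    next
      case False
      then have "A $ l $ j = 0" using A unfolding supp_def by blast
      then show ?thesis using False m by auto
    qed
  qed
  then show ?thesis by simp
qed

text \<open>If row \<open>m\<close> of the projection were zero, a nonzero column of it would be an
  eigenvector of the block of size \<open>m\<close> with last entry 0. Row \<open>m + 1\<close> of
  \<open>p\<close> picks out just that entry, so the vector would also be an eigenvector of the next
  block, against the disjointness of the spectra.\<close>

lemma Prj_row_nonzero:
  fixes p :: "'n::{finite,linorder} cmat"
  assumes z: "(\<nu>, p) \<in> M_Omega_e" and k: "k \<in> {1..m}" and m: "m < CARD('n)" and h: "hrow (Suc m) p"
  obtains j where "Prj \<nu> m k p $ ix m $ j \<noteq> 0"
proof -
  let ?P = "Prj \<nu> m k p"
  have m1: "1 \<le> m" and mN: "m \<le> CARD('n)" using k m by auto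
  have sP: "supp m ?P" by (rule supp_Prj[OF z k mN])
  have False if row0: "\<forall>j. ?P $ ix m $ j = 0"
  proof -
    have "?P \<noteq> 0" using trace_Prj[OF z k mN] by (auto simp: trace_def)
    then obtain i j where ij: "?P $ i $ j \<noteq> 0" by (metis vec_eq_iff zero_index)
    define w where "w = (\<chi> i. ?P $ i $ j)"
    have mv: "(A *v w) $ a = (A ** ?P) $ a $ j" for A :: "'n cmat" and a
      by (simp add: mv_nth mm_nth w_def)
    have "w \<noteq> 0" using ij by (auto simp: w_def vec_eq_iff)
    moreover have w0: "w $ i = 0" if "m < rk i" for i
      using sP that unfolding supp_def w_def by (metis not_le vec_lambda_beta)
    moreover have "cut (Suc m) p *v w = \<nu> k m *s w"
    proof -
      have "(cut (Suc m) p *v w) $ a = \<nu> k m * w $ a" for a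
      proof -
        have c: "(cut (Suc m) p *v w) $ a = (if rk a \<le> Suc m then (p *v w) $ a else 0)"
          unfolding mv_nth using w0 by (auto simp: cut_def intro!: sum.cong)
        consider "rk a \<le> m" | "rk a = Suc m" | "Suc m < rk a" by linarith
        then show ?thesis
        proof cases
          case 1
          have "(p *v w) $ a = (cut m p *v w) $ a"
            unfolding mv_nth using w0 1 by (auto simp: cut_def intro!: sum.cong)
          also have "\<dots> = \<nu> k m * w $ a"
            unfolding mv by (simp add: cut_Prj[OF z k mN] w_def)
          finally show ?thesis using c 1 by simp
        next
          case 2
          then have "a = ix (Suc m)" by (metis ix_rk)
          then have "(p *v w) $ a = ?P $ ix m $ j"
            unfolding mv using hrow_mm[OF h m1 m sP] by simp
          then show ?thesis using c 2 w0[of a] row0 by simp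
        next
          case 3
          then show ?thesis using c w0[of a] by simp
        qed
      qed
      then show ?thesis by (simp add: vec_eq_iff)
    qed
    ultimately have "eigenvalue (block (Suc m) p) (\<nu> k m)"
      using m by (subst eigenvalue_block) auto
    moreover have "similar_mat (nu_mat \<nu> (Suc m)) (block (Suc m) p)"
      using z m by (auto simp: M_Omega_e_def)
    ultimately obtain l where "l \<in> {1..Suc m}" "\<nu> k m = \<nu> l (Suc m)"
      using eigenvalue_nu_mat by blast
    moreover have "m \<in> {1..CARD('n) - 1}" using m m1 by auto
    ultimately show False
      using M_Omega_e_e[OF z] k unfolding e_Omega_def by fastforce
  qed
  then show ?thesis using that by blast
qed

lemma supp_dils:
  fixes x :: "'n::{finite,linorder} cmat"
  assumes "(\<nu>, x) \<in> M_Omega_e" "m \<le> CARD('n)"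
  shows "supp m (dils \<eta> \<nu> m m x - mat 1)"
  unfolding dils_def using assms by (auto intro!: supp_sum supp_cscale supp_Prj)

lemma row_mm_low:
  assumes "supp m (H - mat 1)" "m < rk i"
  shows "(H ** A) $ i $ j = (A :: 'n::{finite,linorder} cmat) $ i $ j"
proof -
  have "H $ i $ l = (if i = l then 1 else 0)" for l
  proof (rule ccontr)
    assume "H $ i $ l \<noteq> (if i = l then 1 else 0)"
    then have "(H - mat 1) $ i $ l \<noteq> 0" by (auto simp: mat1_nth)
    then have "rk i \<le> m" using assms(1) unfolding supp_def by blast
    with assms(2) show False by simp
  qed
  then have "(H ** A) $ i $ j = (\<Sum>l\<in>UNIV. if i = l then A $ l $ j else 0)"
    unfolding mm_nth by (intro sum.cong) auto
  then show ?thesis by simp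
qed

text \<open>Conjugation by \<open>dils\<close> divides the part of row \<open>m + 1\<close> lying in
  the k-th projection by \<open>\<eta> t k\<close>. The scalar is chosen so that this part becomes
  row \<open>m\<close> of the projection; as the projections sum to \<open>Em m\<close>, the row
  becomes the last unit vector. At \<open>p\<close> the row has this form already, hence \<eta>
  tends to 1 and \<open>Y'\<close> to \<open>p\<close>.\<close>

lemma level_step:
  fixes p :: "'n::{finite,linorder} cmat"
  assumes \<nu>t: "\<And>k m. ((\<lambda>t. \<nu>f t k m) \<longlongrightarrow> \<nu> k m) F" and Yt: "(Yf \<longlongrightarrow> p) F"
    and zt: "\<forall>\<^sub>F t in F. (\<nu>f t, Yf t) \<in> M_Omega_e" and z: "(\<nu>, p) \<in> M_Omega_e"
    and m: "1 \<le> m" "m < CARD('n)" and h: "hrow (Suc m) p"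
  obtains Y' \<eta> where "(Y' \<longlongrightarrow> p) F"
    "\<forall>\<^sub>F t in F. \<forall>q. (\<forall>k\<in>{1..m}. exp (q (d_fun (m - 1) + k)) = \<eta> t k) \<longrightarrow>
       (\<nu>f t, Y' t) \<in> M_Omega_e \<and>
       fold (\<lambda>j. exp_xi (r_fun j) (q j)) (map (\<lambda>k. d_fun (m - 1) + k) [1..<Suc m]) (\<nu>f t, Y' t) = (\<nu>f t, Yf t)"
    "\<forall>\<^sub>F t in F. \<forall>k\<in>{1..m}. \<eta> t k \<noteq> 0"
    "\<forall>\<^sub>F t in F. hrow (Suc m) (Y' t)"
    "\<forall>\<^sub>F t in F. \<forall>r\<in>{Suc (Suc m)..CARD('n)}. hrow r (Yf t) \<longrightarrow> hrow r (Y' t)"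
proof -
  have mN: "m \<le> CARD('n)" using m by simp
  have "\<forall>k\<in>{1..m}. \<exists>j. Prj \<nu> m k p $ ix m $ j \<noteq> 0"
    using Prj_row_nonzero[OF z _ m(2) h] by blast
  then obtain J where J: "\<And>k. k \<in> {1..m} \<Longrightarrow> Prj \<nu> m k p $ ix m $ J k \<noteq> 0" by metis
  define P where "P t k = Prj (\<nu>f t) m k (Yf t)" for t k
  have Pt: "((\<lambda>t. P t k) \<longlongrightarrow> Prj \<nu> m k p) F" if "k \<in> {1..m}" for k
    unfolding P_def by (rule tendsto_Prj[OF _ Yt M_Omega_e_e[OF z] that mN]) (rule \<nu>t)
  \<comment> \<open>\<open>J k\<close> is a column where row \<open>m\<close> of the limit
    projection is nonzero, so the denominator is eventually nonzero.\<close>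
  define \<eta> where "\<eta> t k = (Yf t ** P t k) $ ix (Suc m) $ J k / P t k $ ix m $ J k" for t k
  have \<eta>t: "((\<lambda>t. \<eta> t k) \<longlongrightarrow> 1) F" if k: "k \<in> {1..m}" for k
  proof -
    have "((\<lambda>t. \<eta> t k) \<longlongrightarrow> (p ** Prj \<nu> m k p) $ ix (Suc m) $ J k / Prj \<nu> m k p $ ix m $ J k) F"
      unfolding \<eta>_def by (intro tendsto_intros Yt Pt k J)
    then show ?thesis
      unfolding hrow_mm[OF h m supp_Prj[OF z k mN]] using J[OF k] by simp
  qed
  have ev0: "\<forall>\<^sub>F t in F. \<forall>k\<in>{1..m}. \<eta> t k \<noteq> 0"
    by (intro eventually_ball_finite ballI tendsto_imp_eventually_ne[OF \<eta>t]) auto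
  have evP: "\<forall>\<^sub>F t in F. \<forall>k\<in>{1..m}. P t k $ ix m $ J k \<noteq> 0"
  proof (intro eventually_ball_finite ballI)
    fix k assume k: "k \<in> {1..m}"
    have "((\<lambda>t. P t k $ ix m $ J k) \<longlongrightarrow> Prj \<nu> m k p $ ix m $ J k) F"
      by (intro tendsto_vec_nth Pt k)
    then show "\<forall>\<^sub>F t in F. P t k $ ix m $ J k \<noteq> 0"
      by (rule tendsto_imp_eventually_ne) (rule J[OF k])
  qed simp
  define A where "A t = dils (\<eta> t) (\<nu>f t) m m (Yf t)" for t
  define B where "B t = dils (\<lambda>k. 1 / \<eta> t k) (\<nu>f t) m m (Yf t)" for t
  define Y' where "Y' t = A t ** Yf t ** B t" for t
  show ?thesis
  proof (rule that[of Y' \<eta>])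
    have "(A \<longlongrightarrow> mat 1 + (\<Sum>k\<in>{1..m}. cscale (1 - 1) (Prj \<nu> m k p))) F"
      unfolding A_def dils_def P_def[symmetric] by (intro tendsto_intros \<eta>t Pt) auto
    moreover have "(B \<longlongrightarrow> mat 1 + (\<Sum>k\<in>{1..m}. cscale (1 / 1 - 1) (Prj \<nu> m k p))) F"
      unfolding B_def dils_def P_def[symmetric] by (intro tendsto_intros \<eta>t Pt) auto
    ultimately have "(A \<longlongrightarrow> mat 1) F" "(B \<longlongrightarrow> mat 1) F" by simp_all
    then have "(Y' \<longlongrightarrow> mat 1 ** p ** mat 1) F"
      unfolding Y'_def by (intro tendsto_intros Yt)
    then show "(Y' \<longlongrightarrow> p) F" by simp
    show "\<forall>\<^sub>F t in F. \<forall>q. (\<forall>k\<in>{1..m}. exp (q (d_fun (m - 1) + k)) = \<eta> t k) \<longrightarrow>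
       (\<nu>f t, Y' t) \<in> M_Omega_e \<and>
       fold (\<lambda>j. exp_xi (r_fun j) (q j)) (map (\<lambda>k. d_fun (m - 1) + k) [1..<Suc m]) (\<nu>f t, Y' t) = (\<nu>f t, Yf t)"
      using zt
    proof eventually_elim
      case (elim t)
      show ?case
        using level_flow_inverse[OF elim mN, of _ "\<eta> t"] unfolding Y'_def A_def B_def by blast
    qed
    show "\<forall>\<^sub>F t in F. \<forall>k\<in>{1..m}. \<eta> t k \<noteq> 0" by (rule ev0)
    show "\<forall>\<^sub>F t in F. hrow (Suc m) (Y' t)"
      using zt ev0 evP
    proof eventually_elim
      case (elim t)
      \<comment> \<open>The ratio was formed in column \<open>J k\<close> only; rank one makes it
        the same in every column.\<close>
      have row: "(Yf t ** P t k) $ ix (Suc m) $ j = \<eta> t k * P t k $ ix m $ j" if k: "k \<in> {1..m}" for k j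
      proof -
        have "(Yf t ** P t k) $ ix (Suc m) $ j * P t k $ ix m $ J k =
          (\<Sum>l\<in>UNIV. Yf t $ ix (Suc m) $ l * (P t k $ l $ j * P t k $ ix m $ J k))"
          by (simp add: mm_nth sum_distrib_right mult.assoc)
        also have "\<dots> = (\<Sum>l\<in>UNIV. Yf t $ ix (Suc m) $ l * (P t k $ l $ J k * P t k $ ix m $ j))"
          unfolding P_def by (subst Prj_rank_one[OF elim(1) k mN]) (rule refl)
        also have "\<dots> = (Yf t ** P t k) $ ix (Suc m) $ J k * P t k $ ix m $ j"
          by (simp add: mm_nth sum_distrib_right mult.assoc)
        finally show ?thesis using elim(3) k by (simp add: \<eta>_def field_simps)
      qed
      have sumP: "(\<Sum>k\<in>{1..m}. P t k) = Em m"
        using sum_Prj[OF elim(1) _ mN, of m] m by (simp add: P_def)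
      show ?case
        unfolding hrow_def
      proof (intro allI impI)
        fix j :: 'n assume j: "rk j < Suc m"
        \<comment> \<open>The left factor \<open>A t\<close> is the identity on rows beyond
          \<open>m\<close>, so only the right factor acts on row \<open>m + 1\<close>.\<close>
        have "Y' t $ ix (Suc m) $ j = (Yf t ** B t) $ ix (Suc m) $ j"
          unfolding Y'_def A_def mm_assoc
          by (rule row_mm_low[OF supp_dils[OF elim(1) mN]]) (use m in simp)
        also have "\<dots> = Yf t $ ix (Suc m) $ j + (\<Sum>k\<in>{1..m}. (1 / \<eta> t k - 1) * (Yf t ** P t k) $ ix (Suc m) $ j)"
          unfolding B_def dils_def P_def[symmetric] by (simp add: mm_distrib mm_sum sum_component)
        also have "Yf t $ ix (Suc m) $ j = (Yf t ** Em m) $ ix (Suc m) $ j"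
          using j by (simp add: mm_Em_nth)
        also have "\<dots> = (\<Sum>k\<in>{1..m}. (Yf t ** P t k) $ ix (Suc m) $ j)"
          by (simp only: sumP[symmetric] mm_sum sum_component)
        finally have "Y' t $ ix (Suc m) $ j = (\<Sum>k\<in>{1..m}. 1 / \<eta> t k * (Yf t ** P t k) $ ix (Suc m) $ j)"
          by (simp add: sum.distrib[symmetric] algebra_simps)
        also have "\<dots> = (\<Sum>k\<in>{1..m}. P t k $ ix m $ j)"
          using elim(2) by (intro sum.cong refl) (simp add: row)
        also have "\<dots> = Em m $ ix m $ j"
          by (simp only: sumP[symmetric] sum_component)
        also have "\<dots> = (if rk j = Suc m - 1 then 1 else 0)"
          using m by (auto simp: Em_nth)
        finally show "Y' t $ ix (Suc m) $ j = (if rk j = Suc m - 1 then 1 else 0)" .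
      qed
    qed
    \<comment> \<open>A normalised row beyond row \<open>m + 1\<close> is zero in its first
      \<open>m\<close> columns, and \<open>B t - mat 1\<close> is supported there, so rows
      normalised earlier are not disturbed.\<close>
    show "\<forall>\<^sub>F t in F. \<forall>r\<in>{Suc (Suc m)..CARD('n)}. hrow r (Yf t) \<longrightarrow> hrow r (Y' t)"
      using zt
    proof eventually_elim
      case (elim t)
      show ?case
      proof (intro ballI impI)
        fix r assume r: "r \<in> {Suc (Suc m)..CARD('n)}" and hr: "hrow r (Yf t)"
        let ?C = "B t - mat 1"
        have C: "supp m ?C" unfolding B_def by (rule supp_dils[OF elim mN])
        have "Y' t $ ix r $ j = Yf t $ ix r $ j" for j
        proof -
          have "Y' t $ ix r $ j = (Yf t ** B t) $ ix r $ j"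
            unfolding Y'_def A_def mm_assoc
            by (rule row_mm_low[OF supp_dils[OF elim mN]]) (use r in simp)
          also have "\<dots> = Yf t $ ix r $ j + (Yf t ** ?C) $ ix r $ j"
            by (simp add: mm_distrib)
          also have "(Yf t ** ?C) $ ix r $ j = 0"
            unfolding mm_nth
          proof (intro sum.neutral ballI)
            fix l
            show "Yf t $ ix r $ l * ?C $ l $ j = 0"
            proof (cases "rk l \<le> m")
              case True
              then show ?thesis using hr r unfolding hrow_def by auto
            next
              case False
              then have "?C $ l $ j = 0" using C unfolding supp_def by blast
              then show ?thesis by (simp only: mult_zero_right)
            qed
          qed
          finally show ?thesis by simp
        qed
        then show "hrow r (Y' t)" using hr unfolding hrow_def by simp
      qed
    qed
  qed
qed

lemma d_fun_Suc: "d_fun (Suc m) = d_fun m + Suc m"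
  by (simp add: d_fun_def)

lemma d_fun_mono: "m \<le> l \<Longrightarrow> d_fun m \<le> d_fun l"
  using lift_Suc_mono_le[of d_fun m l] by (simp add: d_fun_Suc)

text \<open>\<open>A_act\<close> applies the low levels first, so it has to be undone from the top
  level downwards. At stage \<open>m\<close> the rows from \<open>m + 2\<close> on are normalised
  and the levels above \<open>m\<close> have been used.\<close>

lemma levels:
  fixes p :: "'n::{finite,linorder} cmat"
  assumes \<nu>t: "\<And>k m. ((\<lambda>x. \<nu>f x k m) \<longlongrightarrow> \<nu> k m) (nhds p)"
    and zt: "\<forall>\<^sub>F x in nhds p. (\<nu>f x, x) \<in> M_Omega_e" and z: "(\<nu>, p) \<in> M_Omega_e"
    and p: "p \<in> b_e" and m: "m < CARD('n)"
  shows "\<exists>Y q. (Y \<longlongrightarrow> p) (nhds p) \<and> (\<forall>\<^sub>F x in nhds p. (\<nu>f x, Y x) \<in> M_Omega_e \<and>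
     (\<forall>r\<in>{Suc (Suc m)..CARD('n)}. hrow r (Y x)) \<and>
     fold (\<lambda>j. exp_xi (r_fun j) (q x j)) [Suc (d_fun m)..<Suc (d_fun (CARD('n) - 1))] (\<nu>f x, Y x) = (\<nu>f x, x))"
proof -
  have "m \<le> CARD('n) - 1" using m by simp
  then show ?thesis
  proof (induction m rule: inc_induct)
    \<comment> \<open>At m = n - 1 both the set of rows and the list of flows are empty, so the
      identity map serves as \<open>Y\<close>.\<close>
    case base
    then show ?case
      using zt by (intro exI[of _ "\<lambda>x. x"] exI) (auto simp: filterlim_ident elim: eventually_mono)
  next
    case (step m)
    then have m: "1 \<le> Suc m" "Suc m < CARD('n)" by auto
    from step.IH obtain Y q where Y: "(Y \<longlongrightarrow> p) (nhds p)" and ev: "\<forall>\<^sub>F x in nhds p. (\<nu>f x, Y x) \<in> M_Omega_e \<and>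
     (\<forall>r\<in>{Suc (Suc (Suc m))..CARD('n)}. hrow r (Y x)) \<and>
     fold (\<lambda>j. exp_xi (r_fun j) (q x j)) [Suc (d_fun (Suc m))..<Suc (d_fun (CARD('n) - 1))] (\<nu>f x, Y x) = (\<nu>f x, x)"
      by blast
    have zY: "\<forall>\<^sub>F x in nhds p. (\<nu>f x, Y x) \<in> M_Omega_e" using ev by eventually_elim simp
    have h: "hrow (Suc (Suc m)) p" using p m by (simp add: b_e_iff)
    obtain Y' \<eta> where Y': "(Y' \<longlongrightarrow> p) (nhds p)"
      "\<forall>\<^sub>F t in nhds p. \<forall>q. (\<forall>k\<in>{1..Suc m}. exp (q (d_fun (Suc m - 1) + k)) = \<eta> t k) \<longrightarrow>
         (\<nu>f t, Y' t) \<in> M_Omega_e \<and>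
         fold (\<lambda>j. exp_xi (r_fun j) (q j)) (map (\<lambda>k. d_fun (Suc m - 1) + k) [1..<Suc (Suc m)]) (\<nu>f t, Y' t) = (\<nu>f t, Y t)"
      "\<forall>\<^sub>F t in nhds p. \<forall>k\<in>{1..Suc m}. \<eta> t k \<noteq> 0"
      "\<forall>\<^sub>F t in nhds p. hrow (Suc (Suc m)) (Y' t)"
      "\<forall>\<^sub>F t in nhds p. \<forall>r\<in>{Suc (Suc (Suc m))..CARD('n)}. hrow r (Y t) \<longrightarrow> hrow r (Y' t)"
      by (rule level_step[OF \<nu>t Y zY z m h]) blast
    \<comment> \<open>Indices up to \<open>d_fun (Suc m)\<close> belong to the level being added,
      with the logarithm of \<eta> as parameter; larger ones keep the parameters found
      before.\<close>
    define q' where "q' x j = (if j \<le> d_fun (Suc m) then Ln (\<eta> x (j - d_fun m)) else q x j)" for x j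
    have "\<forall>\<^sub>F x in nhds p. (\<nu>f x, Y' x) \<in> M_Omega_e \<and>
       (\<forall>r\<in>{Suc (Suc m)..CARD('n)}. hrow r (Y' x)) \<and>
       fold (\<lambda>j. exp_xi (r_fun j) (q' x j)) [Suc (d_fun m)..<Suc (d_fun (CARD('n) - 1))] (\<nu>f x, Y' x) = (\<nu>f x, x)"
      using ev Y'(2-5)
    proof eventually_elim
      case (elim x)
      have "\<forall>k\<in>{1..Suc m}. exp (q' x (d_fun (Suc m - 1) + k)) = \<eta> x k"
        using elim(3) by (auto simp: q'_def d_fun_Suc)
      with elim(2) have *: "(\<nu>f x, Y' x) \<in> M_Omega_e"
        "fold (\<lambda>j. exp_xi (r_fun j) (q' x j)) (map (\<lambda>k. d_fun m + k) [1..<Suc (Suc m)]) (\<nu>f x, Y' x) = (\<nu>f x, Y x)"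
        by simp_all
      have le: "d_fun (Suc m) \<le> d_fun (CARD('n) - 1)" using m by (intro d_fun_mono) simp
      have "[Suc (d_fun m)..<Suc (d_fun (CARD('n) - 1))] =
        [Suc (d_fun m)..<Suc (d_fun (Suc m))] @ [Suc (d_fun (Suc m))..<Suc (d_fun (CARD('n) - 1))]"
        using upt_add_eq_append[of "Suc (d_fun m)" "Suc (d_fun (Suc m))" "d_fun (CARD('n) - 1) - d_fun (Suc m)"] le
        by (simp add: d_fun_Suc del: upt_Suc)
      also have "[Suc (d_fun m)..<Suc (d_fun (Suc m))] = map (\<lambda>k. d_fun m + k) [1..<Suc (Suc m)]"
        by (rule nth_equalityI) (auto simp: d_fun_Suc simp del: upt_Suc)
      finally have "fold (\<lambda>j. exp_xi (r_fun j) (q' x j)) [Suc (d_fun m)..<Suc (d_fun (CARD('n) - 1))] (\<nu>f x, Y' x) =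
        fold (\<lambda>j. exp_xi (r_fun j) (q' x j)) [Suc (d_fun (Suc m))..<Suc (d_fun (CARD('n) - 1))] (\<nu>f x, Y x)"
        using *(2) by (simp del: upt_Suc)
      also have "\<dots> = fold (\<lambda>j. exp_xi (r_fun j) (q x j)) [Suc (d_fun (Suc m))..<Suc (d_fun (CARD('n) - 1))] (\<nu>f x, Y x)"
        by (rule fold_cong) (auto simp: q'_def simp del: upt_Suc)
      also have "\<dots> = (\<nu>f x, x)" using elim(1) by blast
      finally have f: "fold (\<lambda>j. exp_xi (r_fun j) (q' x j)) [Suc (d_fun m)..<Suc (d_fun (CARD('n) - 1))] (\<nu>f x, Y' x) = (\<nu>f x, x)" .
      have "hrow r (Y' x)" if "r \<in> {Suc (Suc m)..CARD('n)}" for r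
        using elim(1,4,5) that by (cases "r = Suc (Suc m)") auto
      with f *(1) show ?case by blast
    qed
    with Y'(1) show ?case by blast
  qed
qed

text \<open>The freedom in \<open>T\<close> matters: it forces the Hessenberg point \<open>w\<close>
  onto a prescribed sheet of the covering, not merely over a matrix near \<open>p\<close>.\<close>

lemma A_act_near:
  fixes p :: "'n::{finite,linorder} cmat"
  assumes z: "(\<nu>, p) \<in> M_Omega_e" and p: "p \<in> b_e" and T: "open T" "(\<nu>, p) \<in> T"
  shows "\<forall>\<^sub>F x in nhds p. \<exists>w q. w \<in> T \<and> w \<in> M_Omega_e \<and> snd w \<in> b_e \<and> snd (A_act q w) = x"
proof -
  let ?\<nu> = "\<lambda>x. fst (section_at (\<nu>, p) x)"
  obtain U where s: "local_section U (section_at (\<nu>, p))" and x: "p \<in> U"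
    and sx: "section_at (\<nu>, p) p = (\<nu>, p)"
    using section_at[OF z] by auto
  have U: "\<forall>\<^sub>F x in nhds p. x \<in> U"
    using s x by (intro eventually_nhds_in_open) (auto simp: local_section_def)
  have \<nu>t: "((\<lambda>x. ?\<nu> x k m) \<longlongrightarrow> \<nu> k m) (nhds p)" for k m
    using local_section_tendsto[OF s x, of k m] by (simp add: sx)
  have "continuous_on U ?\<nu>"
    using s unfolding local_section_def by (intro continuous_on_fst) simp
  then have "isCont ?\<nu> p"
    using s x unfolding local_section_def by (auto simp: continuous_on_eq_continuous_at)
  then have \<nu>t': "(?\<nu> \<longlongrightarrow> \<nu>) (nhds p)"
    by (simp add: isCont_def tendsto_nhds_iff sx)
  have zt: "\<forall>\<^sub>F x in nhds p. (?\<nu> x, x) \<in> M_Omega_e"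
    using U by eventually_elim (rule local_section_eq[OF s])
  obtain Y q where Y: "(Y \<longlongrightarrow> p) (nhds p)" and ev: "\<forall>\<^sub>F x in nhds p. (?\<nu> x, Y x) \<in> M_Omega_e \<and>
     (\<forall>r\<in>{Suc (Suc 0)..CARD('n)}. hrow r (Y x)) \<and>
     fold (\<lambda>j. exp_xi (r_fun j) (q x j)) [Suc (d_fun 0)..<Suc (d_fun (CARD('n) - 1))] (?\<nu> x, Y x) = (?\<nu> x, x)"
    using levels[OF \<nu>t zt z p, of 0] by auto
  have "((\<lambda>x. (?\<nu> x, Y x)) \<longlongrightarrow> (\<nu>, p)) (nhds p)"
    by (intro tendsto_Pair \<nu>t' Y)
  then have "\<forall>\<^sub>F x in nhds p. (?\<nu> x, Y x) \<in> T"
    using T by (rule topological_tendstoD)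
  with ev show ?thesis
  proof eventually_elim
    case (elim x)
    then have "A_act (q x) (?\<nu> x, Y x) = (?\<nu> x, x)"
      by (simp add: A_act_def d_fun_def)
    moreover have "Y x \<in> b_e" using elim(1) by (simp add: b_e_iff numeral_2_eq_2)
    ultimately show ?case using elim
      by (intro exI[of _ "(?\<nu> x, Y x)"] exI[of _ "q x"]) simp
  qed
qed


section \<open>Holomorphic maps\<close>

lemma holo_on_const: "holo_on U (\<lambda>_. c)"
  unfolding holo_on_def by (intro ballI exI[of _ "\<lambda>_. 0"]) simp

lemma holo_on_entry: "holo_on U (\<lambda>x. x $ i $ j)"
  unfolding holo_on_def
  by (intro ballI exI[of _ "\<lambda>v. trace (munit j i ** v)"]) (simp add: has_derivative_entry mm_distrib)

lemma holo_on_add: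
  assumes "holo_on U f" "holo_on U g"
  shows "holo_on U (\<lambda>x. f x + g x)"
  unfolding holo_on_def
proof
  fix x assume x: "x \<in> U"
  obtain D E where "(f has_derivative D) (at x)" "\<forall>c v. D (cscale c v) = c * D v"
    "(g has_derivative E) (at x)" "\<forall>c v. E (cscale c v) = c * E v"
    using assms x unfolding holo_on_def by blast
  then show "\<exists>D. ((\<lambda>x. f x + g x) has_derivative D) (at x) \<and> (\<forall>c v. D (cscale c v) = c * D v)"
    by (intro exI[of _ "\<lambda>v. D v + E v"]) (auto intro!: has_derivative_add simp: algebra_simps)
qed

lemma holo_on_mult:
  assumes "holo_on U f" "holo_on U g"
  shows "holo_on U (\<lambda>x. f x * g x)"
  unfolding holo_on_def
proof
  fix x assume x: "x \<in> U"
  obtain D E where "(f has_derivative D) (at x)" "\<forall>c v. D (cscale c v) = c * D v"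
    "(g has_derivative E) (at x)" "\<forall>c v. E (cscale c v) = c * E v"
    using assms x unfolding holo_on_def by blast
  then show "\<exists>D. ((\<lambda>x. f x * g x) has_derivative D) (at x) \<and> (\<forall>c v. D (cscale c v) = c * D v)"
    using has_derivative_mult[of f D x UNIV g E]
    by (intro exI[of _ "\<lambda>v. f x * E v + D v * g x"] conjI) (simp_all add: distrib_left mult.left_commute mult.assoc)
qed

lemma holo_on_sum:
  assumes "\<And>k. k \<in> S \<Longrightarrow> holo_on U (f k)"
  shows "holo_on U (\<lambda>x. \<Sum>k\<in>S. f k x)"
  using assms by (induction S rule: infinite_finite_induct) (auto intro: holo_on_const holo_on_add)

lemma holo_map_on_const: "holo_map_on U (\<lambda>_. A)"
  and holo_map_on_id: "holo_map_on U (\<lambda>x. x)"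
  by (simp_all add: holo_map_on_def holo_on_const holo_on_entry)

lemma holo_map_on_add: "holo_map_on U f \<Longrightarrow> holo_map_on U g \<Longrightarrow> holo_map_on U (\<lambda>x. f x + g x)"
  by (simp add: holo_map_on_def holo_on_add)

lemma holo_map_on_diff:
  assumes "holo_map_on U f" "holo_map_on U g"
  shows "holo_map_on U (\<lambda>x. f x - g x)"
  unfolding holo_map_on_def
proof (intro allI)
  fix i j
  have "holo_on U (\<lambda>x. f x $ i $ j + (- 1) * g x $ i $ j)"
    using assms by (intro holo_on_add holo_on_mult holo_on_const) (auto simp: holo_map_on_def)
  then show "holo_on U (\<lambda>x. (f x - g x) $ i $ j)" by simp
qed

lemma holo_map_on_mm: "holo_map_on U f \<Longrightarrow> holo_map_on U g \<Longrightarrow> holo_map_on U (\<lambda>x. f x ** g x)"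
  unfolding holo_map_on_def mm_nth by (intro allI holo_on_sum holo_on_mult) auto

lemma holo_map_on_mprod: "holo_map_on U f \<Longrightarrow> holo_map_on U (\<lambda>x. mprod cs (f x))"
  by (induction cs) (auto intro!: holo_map_on_const holo_map_on_mm holo_map_on_diff)

lemma holo_map_on_continuous:
  assumes "holo_map_on UNIV F"
  shows "continuous_on UNIV F"
proof -
  have "isCont F x" for x
    unfolding isCont_def
  proof (rule cmat_tendstoI)
    fix i j
    obtain D where "((\<lambda>x. F x $ i $ j) has_derivative D) (at x)"
      using assms unfolding holo_map_on_def holo_on_def by blast
    from has_derivative_continuous[OF this]
    show "((\<lambda>x. F x $ i $ j) \<longlongrightarrow> F x $ i $ j) (at x)" by (simp add: continuous_within)
  qed
  then show ?thesis by (simp add: continuous_on_eq_continuous_at)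
qed


section \<open>Hessenberg matrices\<close>

text \<open>The principal nilpotent matrix with ones on the subdiagonal. \<open>b_e\<close> is its
  translate by the upper triangular matrices, which makes the Hessenberg condition affine.\<close>

definition eH :: "'n::{finite,linorder} cmat" where
  "eH = (\<chi> i j. if rk i = Suc (rk j) then 1 else 0)"

definition upper :: "'n::{finite,linorder} cmat \<Rightarrow> bool" where
  "upper A \<longleftrightarrow> (\<forall>i j. rk j < rk i \<longrightarrow> A $ i $ j = 0)"

definition strictly_upper :: "'n::{finite,linorder} cmat \<Rightarrow> bool" where
  "strictly_upper A \<longleftrightarrow> (\<forall>i j. rk j \<le> rk i \<longrightarrow> A $ i $ j = 0)"

lemma b_e_upper: "y \<in> b_e \<longleftrightarrow> upper (y - eH)"
proof
  assume y: "y \<in> b_e"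
  show "upper (y - eH)"
    unfolding upper_def
  proof (intro allI impI)
    fix i j :: 'a assume ij: "rk j < rk i"
    then have "rk i \<in> {2..CARD('a)}" using rk_ge1[of j] by simp
    with y have "hrow (rk i) y" by (simp add: b_e_iff)
    with ij show "(y - eH) $ i $ j = 0" unfolding hrow_def by (auto simp: eH_def)
  qed
next
  assume u: "upper (y - eH)"
  show "y \<in> b_e"
    unfolding b_e_iff hrow_def
  proof (intro ballI allI impI)
    fix r and j :: 'a assume r: "r \<in> {2..CARD('a)}" "rk j < r"
    then have "rk (ix r :: 'a) = r" by simp
    then have "(y - eH) $ ix r $ j = 0" using u r unfolding upper_def by simp
    then show "y $ ix r $ j = (if rk j = r - 1 then 1 else 0)"
      using r by (auto simp: eH_def)
  qed
qed

lemma b_e_nth: "y \<in> b_e \<Longrightarrow> rk j < rk i \<Longrightarrow> y $ i $ j = (if rk i = Suc (rk j) then 1 else 0)"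
  unfolding b_e_upper upper_def eH_def by auto

lemma upper_add: "upper A \<Longrightarrow> upper B \<Longrightarrow> upper (A + B)"
  and upper_cscale: "upper A \<Longrightarrow> upper (cscale c A)"
  by (auto simp: upper_def)

lemma upper_mm: "upper A \<Longrightarrow> upper B \<Longrightarrow> upper (A ** B)"
  unfolding upper_def mm_nth
proof (intro allI impI sum.neutral ballI)
  fix i j l :: 'a assume *: "\<forall>i j. rk j < rk i \<longrightarrow> A $ i $ j = 0" "\<forall>i j. rk j < rk i \<longrightarrow> B $ i $ j = 0" "rk j < rk i"
  show "A $ i $ l * B $ l $ j = 0"
    using * by (cases "rk l < rk i") auto
qed

text \<open>A Hessenberg matrix has entries at most one diagonal below the main one, so its products
  with a strictly upper triangular matrix reach no further down than the main diagonal.\<close>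

lemma upper_commutator:
  assumes u: "strictly_upper u" and y: "y \<in> b_e"
  shows "upper (commutator y u)"
  unfolding upper_def commutator_def
proof (intro allI impI)
  fix i j :: 'a assume ij: "rk j < rk i"
  have "(y ** u) $ i $ j = 0"
    unfolding mm_nth
  proof (intro sum.neutral ballI)
    fix l :: 'a
    show "y $ i $ l * u $ l $ j = 0"
      using u ij b_e_nth[OF y, of l i] unfolding strictly_upper_def by (cases "rk j \<le> rk l") auto
  qed
  moreover have "(u ** y) $ i $ j = 0"
    unfolding mm_nth
  proof (intro sum.neutral ballI)
    fix l :: 'a
    show "u $ i $ l * y $ l $ j = 0"
      using u ij b_e_nth[OF y, of j l] unfolding strictly_upper_def by (cases "rk l \<le> rk i") auto
  qed
  ultimately show "(y ** u - u ** y) $ i $ j = 0" by simp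
qed

lemma trace_upper_strictly_upper: "upper A \<Longrightarrow> strictly_upper v \<Longrightarrow> trace (A ** v) = 0"
  unfolding trace_mm_nth
proof (intro sum.neutral ballI)
  fix i l :: 'a assume "upper A" "strictly_upper v"
  then show "A $ i $ l * v $ l $ i = 0"
    unfolding upper_def strictly_upper_def by (cases "rk l < rk i") auto
qed

lemma upper_if_trace_strictly_upper:
  assumes "\<And>v. strictly_upper v \<Longrightarrow> trace (A ** v) = 0"
  shows "upper A"
  unfolding upper_def
proof (intro allI impI)
  fix i j :: 'a assume "rk j < rk i"
  then have "strictly_upper (munit j i)" by (auto simp: strictly_upper_def munit_def)
  from assms[OF this] show "A $ i $ j = 0" by (simp add: trace_munit)
qed

section \<open>Cyclicity of the first unit vector\<close>

lemma mv_distrib: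
  fixes A B :: "'n::finite cmat"
  shows "(A + B) *v w = A *v w + B *v w" "(A - B) *v w = A *v w - B *v w"
    and "cscale c A *v w = c *s (A *v w)" "A *v (c *s w) = c *s (A *v w)"
    and "A *v (w + w') = A *v w + A *v w'" "A *v (w - w') = A *v w - A *v w'"
    and "mat 1 *v w = w"
  by (simp_all add: vec_eq_iff mv_nth algebra_simps sum.distrib sum_subtractf sum_distrib_left matrix_vector_mul_lid)

lemma mv_sum: "(\<Sum>k\<in>S. f k :: 'n::finite cmat) *v w = (\<Sum>k\<in>S. f k *v w)"
  by (induction S rule: infinite_finite_induct) (simp_all add: mv_distrib)

abbreviation e1 :: "complex^'n::{finite,linorder}" where
  "e1 \<equiv> axis (ix (Suc 0)) 1"

lemma mv_axis: "((A :: 'n::finite cmat) *v axis j 1) $ i = A $ i $ j"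
proof -
  have "(A *v axis j 1) $ i = (\<Sum>k\<in>UNIV. if k = j then A $ i $ j else 0)"
    unfolding mv_nth by (intro sum.cong) (auto simp: axis_def)
  then show ?thesis by simp
qed

text \<open>\<open>y\<close> sends each unit vector but the last to the next one plus a combination
  of itself and earlier ones, so inductively every unit vector is the image of \<open>e1\<close>
  under a polynomial in \<open>y\<close>. Of these polynomials only the commutation with
  \<open>y\<close> is recorded.\<close>

lemma b_e_cyclic:
  fixes y :: "'n::{finite,linorder} cmat"
  assumes y: "y \<in> b_e"
  obtains Q where "Q ** y = y ** Q" "Q *v e1 = v"
proof -
  have ax: "\<exists>Q. Q ** y = y ** Q \<and> Q *v e1 = axis j 1" for j :: 'n
  proof (induction "rk j" arbitrary: j rule: less_induct)
    case less
    show ?case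
    proof (cases "rk j = Suc 0")
      case True
      then have "j = ix (Suc 0)" by (metis ix_rk)
      then show ?thesis by (intro exI[of _ "mat 1"]) (simp add: mv_distrib)
    next
      case False
      define k where "k = (ix (rk j - 1) :: 'n)"
      have b: "1 \<le> rk j - 1" "rk j - 1 \<le> CARD('n)"
        using False rk_ge1[of j] rk_le[of j] by linarith+
      then have k: "rk j = Suc (rk k)" by (simp add: k_def)
      have "\<forall>i\<in>{i. rk i \<le> rk k}. \<exists>Q. Q ** y = y ** Q \<and> Q *v e1 = axis i 1"
        using less k by auto
      then obtain Q where Q: "\<And>i. rk i \<le> rk k \<Longrightarrow> Q i ** y = y ** Q i \<and> Q i *v e1 = axis i 1"
        by (metis mem_Collect_eq)
      let ?Q = "y ** Q k - (\<Sum>i\<in>{i. rk i \<le> rk k}. cscale (y $ i $ k) (Q i))"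
      have "?Q ** y = y ** ?Q"
        using Q by (simp add: mm_distrib mm_sum mm_assoc)
      moreover have "?Q *v e1 = axis j 1"
      proof -
        have "(y ** Q k) *v e1 = y *v axis k 1"
          using Q[of k] by (simp flip: matrix_vector_mul_assoc)
        moreover have "(\<Sum>i\<in>{i. rk i \<le> rk k}. cscale (y $ i $ k) (Q i)) *v e1 =
           (\<Sum>i\<in>{i. rk i \<le> rk k}. y $ i $ k *s axis i 1)"
          unfolding mv_sum mv_distrib using Q by (intro sum.cong) auto
        ultimately have eq: "?Q *v e1 = y *v axis k 1 - (\<Sum>i\<in>{i. rk i \<le> rk k}. y $ i $ k *s axis i 1)"
          by (simp add: mv_distrib)
        have "(?Q *v e1) $ a = axis j 1 $ a" for a
        proof -
          have s: "(\<Sum>i\<in>{i. rk i \<le> rk k}. y $ i $ k *s axis i 1) $ a = (if rk a \<le> rk k then y $ a $ k else 0)"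
          proof -
            have "(\<Sum>i\<in>{i. rk i \<le> rk k}. y $ i $ k *s axis i 1) $ a =
              (\<Sum>i\<in>{i. rk i \<le> rk k}. if i = a then y $ a $ k else 0)"
              unfolding sum_component by (intro sum.cong) (auto simp: axis_def)
            then show ?thesis by simp
          qed
          show ?thesis
            unfolding eq vector_minus_component s mv_axis
            using b_e_nth[OF y, of k a] k by (auto simp: axis_def simp flip: rk_eq_iff)
        qed
        then show ?thesis by (simp add: vec_eq_iff)
      qed
      ultimately show ?thesis by blast
    qed
  qed
  then obtain Q where Q: "\<And>j. Q j ** y = y ** Q j" "\<And>j. Q j *v e1 = axis j 1" by metis
  let ?Q = "\<Sum>j\<in>UNIV. cscale (v $ j) (Q j)"
  have "?Q ** y = y ** ?Q" by (simp add: mm_distrib mm_sum Q)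
  moreover have "?Q *v e1 = v"
  proof -
    have "(?Q *v e1) $ a = (\<Sum>i\<in>UNIV. if i = a then v $ a else 0)" for a
      unfolding mv_sum mv_distrib Q sum_component by (intro sum.cong) (auto simp: axis_def)
    then show ?thesis by (simp add: vec_eq_iff)
  qed
  ultimately show ?thesis by (rule that)
qed

text \<open>By cyclicity some \<open>Q\<close> commuting with \<open>y\<close> has the first column
  of \<open>w\<close>. Subtracting it leaves the commutator alone and clears the first column. Entry
  (i, j - 1) of the commutator then expresses entry (i, j) of \<open>u\<close> through earlier
  columns, so the vanishing on and below the diagonal spreads from column to column.\<close>

lemma strictly_upper_representative:
  fixes y :: "'n::{finite,linorder} cmat"
  assumes y: "y \<in> b_e" and w: "upper (commutator y w)"
  obtains u where "strictly_upper u" "commutator y u = commutator y w"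
proof -
  obtain Q where Q: "Q ** y = y ** Q" "Q *v e1 = w *v e1"
    using b_e_cyclic[OF y] by blast
  define u where "u = w - Q"
  have com: "commutator y u = commutator y w"
    by (simp add: commutator_def u_def mm_distrib Q(1))
  have uc: "u $ i $ j = 0" if "rk j \<le> rk i" for i j
    using that
  proof (induction "rk j" arbitrary: i j rule: less_induct)
    case less
    show ?case
    proof (cases "rk j = Suc 0")
      case True
      then have "j = ix (Suc 0)" by (metis ix_rk)
      then have "u $ i $ j = (u *v e1) $ i" by (simp add: mv_axis)
      then show ?thesis using Q(2) by (simp add: u_def mv_distrib)
    next
      case False
      define k where "k = (ix (rk j - 1) :: 'n)"
      have b: "1 \<le> rk j - 1" "rk j - 1 \<le> CARD('n)"
        using False rk_ge1[of j] rk_le[of j] by linarith+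
      then have k: "rk j = Suc (rk k)" by (simp add: k_def)
      have ki: "rk k < rk i" using k less.prems by simp
      have "(u ** y) $ i $ k = (\<Sum>l\<in>UNIV. if l = j then u $ i $ j else 0)"
        unfolding mm_nth
      proof (intro sum.cong refl)
        fix l
        show "u $ i $ l * y $ l $ k = (if l = j then u $ i $ j else 0)"
        proof (cases "rk l \<le> rk k")
          case True
          then have "u $ i $ l = 0" using less.hyps[of l i] k ki by auto
          then show ?thesis using True k by auto
        next
          case False
          then have y0: "y $ l $ k = (if rk l = rk j then 1 else 0)"
            using b_e_nth[OF y, of k l] k by simp
          then show ?thesis by (cases "l = j") auto
        qed
      qed
      also have "\<dots> = u $ i $ j" by simp
      finally have uy: "(u ** y) $ i $ k = u $ i $ j" .
      have "(y ** u) $ i $ k = 0"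
        unfolding mm_nth
      proof (intro sum.neutral ballI)
        fix l
        show "y $ i $ l * u $ l $ k = 0"
        proof (cases "rk k \<le> rk l")
          case True
          then show ?thesis using less.hyps[of k l] k by auto
        next
          case False
          then show ?thesis using b_e_nth[OF y, of l i] ki by auto
        qed
      qed
      moreover have "commutator y u $ i $ k = 0" using w com ki by (simp add: upper_def)
      ultimately show ?thesis using uy by (simp add: commutator_def)
    qed
  qed
  then have "strictly_upper u" by (simp add: strictly_upper_def)
  then show ?thesis using com by (rule that)
qed

section \<open>Dependence of polynomials in a Hessenberg matrix on its last column\<close>

definition hat :: "'n cmat \<Rightarrow> 'n::{finite,linorder} cmat" where
  "hat x = (\<chi> i j. if rk j = CARD('n) then 0 else x $ i $ j)"

lemma hat_mv: "x *v w = hat x *v w + w $ ix CARD('n) *s (\<chi> i. x $ i $ (ix CARD('n) :: 'n::{finite,linorder}))"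
proof -
  have N: "rk (ix CARD('n) :: 'n) = CARD('n)" by simp
  have "(x *v w) $ i = (hat x *v w) $ i + (\<Sum>j\<in>UNIV. if j = ix CARD('n) then w $ j * x $ i $ j else 0)" for i
    unfolding mv_nth sum.distrib[symmetric]
    using N by (intro sum.cong) (auto simp: hat_def simp flip: rk_eq_iff)
  then show ?thesis by (simp add: vec_eq_iff)
qed

text \<open>Each factor pushes the lowest nonzero entry of the vector down by one position, with
  value 1. The last column of \<open>x\<close> acts only on a vector whose n-th entry is nonzero,
  and this entry is zero until n - 1 factors have been applied.\<close>

lemma mprod_e1:
  fixes x :: "'n::{finite,linorder} cmat"
  assumes x: "x \<in> b_e"
  shows "length ds < CARD('n) \<Longrightarrow> mprod ds x *v e1 = mprod ds (hat x) *v e1 \<and>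
    (\<forall>i. Suc (length ds) \<le> rk i \<longrightarrow> (mprod ds x *v e1) $ i = (if rk i = Suc (length ds) then 1 else 0))"
proof (induction ds)
  case Nil
  have "rk (ix (Suc 0) :: 'n) = Suc 0" by (rule rk_ix) (use rk_ge1[of "undefined::'n"] rk_le[of "undefined::'n"] in linarith)+
  then show ?case by (auto simp: mv_distrib axis_def simp flip: rk_eq_iff)
next
  case (Cons d ds)
  let ?u = "mprod ds x *v e1"
  have IH: "?u = mprod ds (hat x) *v e1"
    "\<And>i. Suc (length ds) \<le> rk i \<Longrightarrow> ?u $ i = (if rk i = Suc (length ds) then 1 else 0)"
    using Cons by auto
  have eq: "mprod (d # ds) x *v e1 = x *v ?u - d *s ?u"
    by (simp add: mv_distrib flip: matrix_vector_mul_assoc)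
  have "?u $ ix CARD('n) = 0" using IH(2)[of "ix CARD('n)"] Cons.prems by simp
  then have "x *v ?u = hat x *v ?u" by (subst hat_mv) (simp add: vec_eq_iff)
  then have 1: "mprod (d # ds) x *v e1 = mprod (d # ds) (hat x) *v e1"
    unfolding eq by (simp add: IH(1) mv_distrib flip: matrix_vector_mul_assoc)
  have "(mprod (d # ds) x *v e1) $ i = (if rk i = Suc (length (d # ds)) then 1 else 0)"
    if i: "Suc (length (d # ds)) \<le> rk i" for i
  proof -
    have "(x *v ?u) $ i = (\<Sum>l::'n\<in>UNIV. if l = ix (Suc (length ds)) then (if rk i = Suc (Suc (length ds)) then 1 else 0) else 0)"
      unfolding mv_nth[of x]
    proof (intro sum.cong refl)
      fix l :: 'n
      have N: "rk (ix (Suc (length ds)) :: 'n) = Suc (length ds)" using Cons.prems by simp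
      show "x $ i $ l * ?u $ l = (if l = ix (Suc (length ds)) then (if rk i = Suc (Suc (length ds)) then 1 else 0) else 0)"
      proof (cases "Suc (length ds) \<le> rk l")
        case True
        then show ?thesis using IH(2)[OF True] b_e_nth[OF x, of l i] i N by (auto simp flip: rk_eq_iff)
      next
        case False
        then show ?thesis using b_e_nth[OF x, of l i] i N by auto
      qed
    qed
    then show ?thesis unfolding eq using IH(2)[of i] i by simp
  qed
  with 1 show ?case by blast
qed

text \<open>The n-th factor is the only one to meet the last column, and it does so with coefficient
  1, the n-th entry of the vector reached after n - 1 factors.\<close>

lemma mprod_e1_full:
  fixes x :: "'n::{finite,linorder} cmat"
  assumes x: "x \<in> b_e" and l: "length ds = CARD('n)"
  shows "mprod ds x *v e1 = mprod ds (hat x) *v e1 + (\<chi> i. x $ i $ ix CARD('n))"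
proof -
  obtain d es where ds: "ds = d # es" using l by (cases ds) auto
  let ?u = "mprod es x *v e1"
  have L: "length es < CARD('n)" "Suc (length es) = CARD('n)" using l ds by auto
  have u: "?u = mprod es (hat x) *v e1" "?u $ ix CARD('n) = 1"
    using mprod_e1[OF x L(1)] L(2) by auto
  have "mprod ds x *v e1 = x *v ?u - d *s ?u"
    by (simp add: ds mv_distrib flip: matrix_vector_mul_assoc)
  also have "x *v ?u = hat x *v ?u + (\<chi> i. x $ i $ ix CARD('n))"
    by (subst hat_mv) (simp add: u(2) vec_eq_iff)
  finally show ?thesis
    by (simp add: ds u(1) mv_distrib flip: matrix_vector_mul_assoc)
qed

text \<open>A polynomial in \<open>x\<close> commutes with everything that commutes with
  \<open>x\<close>; if it kills the cyclic vector \<open>e1\<close>, it kills every vector.\<close>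

lemma mprod_eq_0_if_e1:
  fixes x :: "'n::{finite,linorder} cmat"
  assumes x: "x \<in> b_e" and 0: "mprod ds x *v e1 = 0"
  shows "mprod ds x = 0"
proof (rule cmat_eqI)
  fix i j
  obtain Q where Q: "Q ** x = x ** Q" "Q *v e1 = axis j 1"
    using b_e_cyclic[OF x] by blast
  have "Q ** mprod es x = mprod es x ** Q" for es
    by (induction es) (simp_all add: mm_distrib Q(1) matrix_mul_assoc, simp add: mm_assoc mm_distrib Q(1))
  then have "mprod ds x *v axis j 1 = Q *v (mprod ds x *v e1)"
    by (simp add: matrix_vector_mul_assoc flip: Q(2))
  also have "\<dots> = 0" by (simp add: 0)
  finally show "mprod ds x $ i $ j = 0 $ i $ j" by (metis mv_axis zero_index)
qed


section \<open>Regular semisimple orbits\<close>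

lemma matrix_inv_mult:
  assumes "invertible (g :: 'n::finite cmat)"
  shows "g ** matrix_inv g = mat 1" "matrix_inv g ** g = mat 1"
  using someI_ex[OF assms[unfolded invertible_def]] unfolding matrix_inv_def by blast+

lemma adjoint_orbit_iff:
  "x \<in> adjoint_orbit a \<longleftrightarrow> (\<exists>g g'. g ** g' = mat 1 \<and> g' ** g = mat 1 \<and> x = g ** a ** (g' :: 'n::finite cmat))"
proof
  assume "x \<in> adjoint_orbit a"
  then obtain g where g: "invertible g" "x = g ** a ** matrix_inv g" by (auto simp: adjoint_orbit_def)
  then show "\<exists>g g'. g ** g' = mat 1 \<and> g' ** g = mat 1 \<and> x = g ** a ** g'"
    using matrix_inv_mult[OF g(1)] by blast
next
  assume "\<exists>g g'. g ** g' = mat 1 \<and> g' ** g = mat 1 \<and> x = g ** a ** g'"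
  then obtain g g' where g: "g ** g' = mat 1" "g' ** g = mat 1" "x = g ** a ** g'" by blast
  then have i: "invertible g" by (auto simp: invertible_def)
  have "matrix_inv g = matrix_inv g ** (g ** g')" by (simp add: g)
  also have "\<dots> = g'" using matrix_inv_mult(2)[OF i] by (simp add: matrix_mul_assoc)
  finally show "x \<in> adjoint_orbit a" using i g by (auto simp: adjoint_orbit_def)
qed

lemma adjoint_orbit_trans:
  assumes "x \<in> adjoint_orbit a" "a \<in> adjoint_orbit (b :: 'n::finite cmat)"
  shows "x \<in> adjoint_orbit b"
proof -
  obtain g g' where g: "g ** g' = mat 1" "g' ** g = mat 1" "x = g ** a ** g'"
    using assms(1) unfolding adjoint_orbit_iff by blast
  obtain h h' where h: "h ** h' = mat 1" "h' ** h = mat 1" "a = h ** b ** h'"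
    using assms(2) unfolding adjoint_orbit_iff by blast
  have "(g ** h) ** (h' ** g') = g ** (h ** h') ** g'" "(h' ** g') ** (g ** h) = h' ** (g' ** g) ** h"
    by (simp_all add: mm_assoc)
  then have "(g ** h) ** (h' ** g') = mat 1" "(h' ** g') ** (g ** h) = mat 1" by (simp_all add: g h)
  moreover have "x = (g ** h) ** b ** (h' ** g')" by (simp add: g h mm_assoc)
  ultimately show ?thesis unfolding adjoint_orbit_iff by blast
qed

lemma adjoint_orbit_sym:
  assumes "x \<in> adjoint_orbit (a :: 'n::finite cmat)"
  shows "a \<in> adjoint_orbit x"
proof -
  obtain g g' where g: "g ** g' = mat 1" "g' ** g = mat 1" "x = g ** a ** g'"
    using assms unfolding adjoint_orbit_iff by blast
  have "g' ** x ** g = (g' ** g) ** a ** (g' ** g)" by (simp add: g(3) mm_assoc)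
  then have "a = g' ** x ** g" by (simp add: g)
  with g show ?thesis unfolding adjoint_orbit_iff by blast
qed

abbreviation diag :: "('n \<Rightarrow> complex) \<Rightarrow> 'n::finite cmat" where
  "diag c \<equiv> (\<chi> i j. if i = j then c i else 0)"

text \<open>One root per index, so that \<open>mprod (evs c)\<close> has exactly n factors, as
  \<open>mprod_e1_full\<close> demands.\<close>

definition evs :: "('n::{finite,linorder} \<Rightarrow> complex) \<Rightarrow> complex list" where
  "evs c = map (\<lambda>k. c (ix k)) [1..<Suc CARD('n)]"

lemma length_evs: "length (evs (c :: 'n::{finite,linorder} \<Rightarrow> complex)) = CARD('n)"
  by (simp add: evs_def del: upt_Suc)

lemma set_evs: "set (evs (c :: 'n::{finite,linorder} \<Rightarrow> complex)) = range c"
proof -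
  have "{1..<Suc CARD('n)} = {1..CARD('n)}" by auto
  then have "set (evs c) = c ` (ix ` {1..CARD('n)})"
    by (simp add: evs_def image_image del: upt_Suc)
  then show ?thesis using bij_ix[where 'n='n] by (simp add: bij_betw_def)
qed

lemma supp_full [simp]: "supp CARD('n) (A :: 'n::{finite,linorder} cmat)"
  by (simp add: supp_def)

lemma mprod_evs:
  fixes x :: "'n::{finite,linorder} cmat"
  assumes "x \<in> adjoint_orbit (diag c)"
  shows "mprod (evs c) x = 0"
proof -
  obtain g g' where g: "g ** g' = mat 1" "g' ** g = mat 1" "x = g ** diag c ** g'"
    using assms unfolding adjoint_orbit_iff by blast
  have d: "diag c = dgm (\<lambda>k. c (ix k)) CARD('n)"
    by (simp add: dgm_def vec_eq_iff)
  have "mprod (evs c) x ** Em CARD('n) = g ** dgm (\<lambda>k. \<Prod>c'\<leftarrow>evs c. c (ix k) - c') CARD('n) ** g'"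
    using g by (intro mprod_diag) (auto simp: cut_full d)
  also have "dgm (\<lambda>k. \<Prod>c'\<leftarrow>evs c. c (ix k) - c') CARD('n) = (0 :: 'n cmat)"
  proof -
    have "(\<Prod>c'\<leftarrow>evs c. c i - c') = 0" for i
      unfolding prod_list_zero_iff using set_evs[of c] by auto
    then show ?thesis by (simp add: dgm_def vec_eq_iff)
  qed
  finally show ?thesis by (simp add: cut_full mm_distrib)
qed

lemma spectral_full:
  fixes x :: "'n::{finite,linorder} cmat"
  assumes z: "(\<nu>, x) \<in> M_Omega_e"
  obtains g g' :: "'n cmat" where "g ** g' = mat 1" "g' ** g = mat 1"
    "x = g ** dgm (\<lambda>k. \<nu> k CARD('n)) CARD('n) ** g'"
    "\<And>k. k \<in> {1..CARD('n)} \<Longrightarrow> Prj \<nu> CARD('n) k x = g ** dgm (\<lambda>l. if l = k then 1 else 0) CARD('n) ** g'"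
proof -
  have "1 \<le> CARD('n)" by (simp add: Suc_le_eq)
  from spectral[OF z this order_refl] obtain g g' :: "'n cmat" where
    g: "supp CARD('n) g" "supp CARD('n) g'" "g ** g' = Em CARD('n)" "g' ** g = Em CARD('n)"
    "cut CARD('n) x = g ** dgm (\<lambda>k. \<nu> k CARD('n)) CARD('n) ** g'" .
  show ?thesis
  proof (rule that)
    show "Prj \<nu> CARD('n) k x = g ** dgm (\<lambda>l. if l = k then 1 else 0) CARD('n) ** g'" if "k \<in> {1..CARD('n)}" for k
      by (rule Prj_diag[OF g M_Omega_e_e[OF z] that order_refl])
  qed (use g in \<open>simp_all add: cut_full\<close>)
qed

lemma eigenvalue_in_evs:
  fixes x :: "'n::{finite,linorder} cmat"
  assumes z: "(\<nu>, x) \<in> M_Omega_e" and 0: "mprod ds x = 0" and k: "k \<in> {1..CARD('n)}"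
  shows "\<nu> k CARD('n) \<in> set ds"
proof -
  obtain g g' :: "'n cmat" where g: "g ** g' = mat 1" "g' ** g = mat 1"
    "x = g ** dgm (\<lambda>k. \<nu> k CARD('n)) CARD('n) ** g'"
    using spectral_full[OF z] by metis
  let ?D = "dgm (\<lambda>k. \<Prod>c\<leftarrow>ds. \<nu> k CARD('n) - c) CARD('n) :: 'n cmat"
  have "mprod ds x ** Em CARD('n) = g ** ?D ** g'"
    using g by (intro mprod_diag) (auto simp: cut_full)
  then have "0 = g' ** (g ** ?D ** g') ** g" by (simp add: 0 mm_distrib flip: \<open>mprod ds x ** Em CARD('n) = g ** ?D ** g'\<close>)
  also have "\<dots> = (g' ** g) ** ?D ** (g' ** g)" by (simp add: mm_assoc)
  also have "\<dots> = ?D" by (simp add: g)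
  finally have "?D $ ix k $ ix k = 0" by simp
  then have "(\<Prod>c\<leftarrow>ds. \<nu> k CARD('n) - c) = 0" using k by (simp add: dgm_def)
  then show ?thesis by (auto simp: prod_list_zero_iff)
qed

lemma diag_permute:
  fixes c :: "'n::finite \<Rightarrow> complex"
  assumes "bij \<sigma>"
  shows "diag (\<lambda>i. c (\<sigma> i)) \<in> adjoint_orbit (diag c)"
proof -
  let ?g = "(\<chi> i j. if j = \<sigma> i then 1 else 0) :: 'n cmat" and ?g' = "(\<chi> i j. if i = \<sigma> j then 1 else 0) :: 'n cmat"
  have inj: "\<sigma> i = \<sigma> j \<longleftrightarrow> i = j" for i j using assms by (meson bij_def injD)
  have gm: "(?g ** A) $ i $ j = A $ \<sigma> i $ j" for A :: "'n cmat" and i j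
  proof -
    have "(?g ** A) $ i $ j = (\<Sum>k\<in>UNIV. if k = \<sigma> i then A $ \<sigma> i $ j else 0)"
      unfolding mm_nth by (intro sum.cong) auto
    then show ?thesis by simp
  qed
  have mg: "(A ** ?g') $ i $ j = A $ i $ \<sigma> j" for A :: "'n cmat" and i j
  proof -
    have "(A ** ?g') $ i $ j = (\<Sum>k\<in>UNIV. if k = \<sigma> j then A $ i $ \<sigma> j else 0)"
      unfolding mm_nth by (intro sum.cong) auto
    then show ?thesis by simp
  qed
  have 1: "?g ** ?g' = mat 1"
    by (rule cmat_eqI, unfold gm) (simp add: inj mat1_nth)
  then have 2: "?g' ** ?g = mat 1" by (simp add: matrix_left_right_inverse)
  have "diag (\<lambda>i. c (\<sigma> i)) = ?g ** diag c ** ?g'"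
    by (rule cmat_eqI, unfold mg gm) (simp add: inj)
  with 1 2 show ?thesis unfolding adjoint_orbit_iff by blast
qed

text \<open>The n distinct eigenvalues of \<open>x\<close> are all roots, that is, values of
  \<open>c\<close>. Assigning to each eigenvalue an index of its value is injective, hence a
  permutation, and permuting diagonal entries stays in the orbit.\<close>

lemma orbit_if_mprod:
  fixes x :: "'n::{finite,linorder} cmat"
  assumes z: "(\<nu>, x) \<in> M_Omega_e" and 0: "mprod (evs c) x = 0"
  shows "x \<in> adjoint_orbit (diag c)"
proof -
  obtain g g' :: "'n cmat" where g: "g ** g' = mat 1" "g' ** g = mat 1"
    "x = g ** dgm (\<lambda>k. \<nu> k CARD('n)) CARD('n) ** g'"
    using spectral_full[OF z] by metis
  have "\<nu> (rk i) CARD('n) \<in> range c" for i :: 'n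
    using eigenvalue_in_evs[OF z 0, of "rk i"] rk_ge1[of i] by (simp add: set_evs)
  then have "\<forall>i :: 'n. \<exists>j. \<nu> (rk i) CARD('n) = c j" by blast
  then obtain \<sigma> where \<sigma>: "\<And>i :: 'n. \<nu> (rk i) CARD('n) = c (\<sigma> i)" by metis
  have "inj \<sigma>"
  proof (rule injI)
    fix i j assume "\<sigma> i = \<sigma> j"
    then have "\<nu> (rk i) CARD('n) = \<nu> (rk j) CARD('n)" by (simp add: \<sigma>)
    then have "rk i = rk j"
      using rk_ge1[of i] rk_ge1[of j] by (intro e_Omega_inj[OF M_Omega_e_e[OF z] order_refl]) auto
    then show "i = j" by simp
  qed
  then have "bij \<sigma>" by (simp add: bij_def finite_UNIV_inj_surj)
  from diag_permute[OF this, of c]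
  have "diag (\<lambda>i. c (\<sigma> i)) \<in> adjoint_orbit (diag c)" .
  moreover have "dgm (\<lambda>k. \<nu> k CARD('n)) CARD('n) = diag (\<lambda>i. c (\<sigma> i))"
    by (simp add: dgm_def \<sigma> vec_eq_iff)
  then have "x \<in> adjoint_orbit (diag (\<lambda>i. c (\<sigma> i)))"
    using g unfolding adjoint_orbit_iff by auto
  ultimately show ?thesis by (rule adjoint_orbit_trans[rotated])
qed

text \<open>On the Hessenberg part of \<open>M_Omega\<close> an orbit is cut out by n equations,
  each giving one entry of the last column in terms of the other columns.\<close>

lemma b_e_orbit_iff:
  fixes x :: "'n::{finite,linorder} cmat"
  assumes z: "(\<nu>, x) \<in> M_Omega_e" and x: "x \<in> b_e"
  shows "x \<in> adjoint_orbit (diag c) \<longleftrightarrow> (\<forall>i. (mprod (evs c) (hat x) *v e1) $ i + x $ i $ ix CARD('n) = 0)"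
proof -
  have "x \<in> adjoint_orbit (diag c) \<longleftrightarrow> mprod (evs c) x = 0"
    using mprod_evs orbit_if_mprod[OF z] by blast
  also have "\<dots> \<longleftrightarrow> mprod (evs c) x *v e1 = 0"
    using mprod_eq_0_if_e1[OF x] by auto
  also have "\<dots> \<longleftrightarrow> (\<forall>i. (mprod (evs c) (hat x) *v e1) $ i + x $ i $ ix CARD('n) = 0)"
    unfolding mprod_e1_full[OF x length_evs] by (simp add: vec_eq_iff)
  finally show ?thesis .
qed


section \<open>Charts\<close>

lemma card_rk_le: "m \<le> CARD('n) \<Longrightarrow> card {i :: 'n::{finite,linorder}. rk i \<le> m} = m"
proof -
  assume m: "m \<le> CARD('n)"
  have "{i :: 'n. rk i \<le> m} = ix ` {1..m}"
  proof (intro equalityI subsetI)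
    fix i :: 'n assume "i \<in> {i. rk i \<le> m}"
    then show "i \<in> ix ` {1..m}" using rk_ge1[of i] by (intro image_eqI[of _ _ "rk i"]) auto
  qed (use m in auto)
  moreover have "inj_on (ix :: nat \<Rightarrow> 'n) {1..m}"
    using bij_ix[where 'n='n] m by (auto simp: bij_betw_def intro: inj_on_subset)
  ultimately show ?thesis by (simp add: card_image)
qed

lemma card_upper: "card {(i :: 'n::{finite,linorder}, j :: 'n). rk i \<le> rk j} = d_fun CARD('n)"
proof -
  have "{(i :: 'n, j :: 'n). rk i \<le> rk j} = prod.swap ` (SIGMA j:UNIV. {i. rk i \<le> rk j})"
    by (auto simp: image_iff)
  then have "card {(i :: 'n, j :: 'n). rk i \<le> rk j} = card (SIGMA j:(UNIV::'n set). {i :: 'n. rk i \<le> rk j})"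
    by (simp add: card_image)
  also have "\<dots> = (\<Sum>j\<in>(UNIV :: 'n set). rk j)"
    by (simp add: card_rk_le)
  also have "\<dots> = (\<Sum>k\<in>{1..CARD('n)}. rk (ix k :: 'n))"
    by (rule sum.reindex_bij_betw[OF bij_ix, symmetric])
  also have "\<dots> = \<Sum>{1..CARD('n)}" by (intro sum.cong) auto
  also have "\<dots> = d_fun CARD('n)"
    by (simp add: d_fun_def Sum_Icc_nat)
  finally show ?thesis .
qed

text \<open>Translation by \<open>eH\<close> is a global chart taking \<open>b_e\<close> to the
  upper triangular matrices; \<open>W\<close> only has to contain a neighbourhood of each point of
  \<open>V\<close>.\<close>

lemma submanifold_b_e:
  fixes V W :: "('n::{finite,linorder} cmat) set"
  assumes V: "V \<subseteq> b_e" and ev: "\<And>p. p \<in> V \<Longrightarrow> \<forall>\<^sub>F x in nhds p. x \<in> W \<and> (x \<in> b_e \<longrightarrow> x \<in> V)"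
  shows "submanifold_of W (d_fun CARD('n)) V"
  unfolding submanifold_of_def
proof (intro conjI ballI)
  show "V \<subseteq> W" using eventually_nhds_x_imp_x[OF ev] by blast
  fix p assume p: "p \<in> V"
  obtain U where U: "open U" "p \<in> U" "\<And>x. x \<in> U \<Longrightarrow> x \<in> W \<and> (x \<in> b_e \<longrightarrow> x \<in> V)"
    using ev[OF p] unfolding eventually_nhds by blast
  let ?\<Phi> = "\<lambda>x. x - eH" and ?S = "{(i :: 'n, j :: 'n). rk i \<le> rk j}"
  have *: "x \<in> V \<longleftrightarrow> (\<forall>i j. (i, j) \<notin> ?S \<longrightarrow> ?\<Phi> x $ i $ j = 0)" if "x \<in> U" for x
  proof -
    have "x \<in> V \<longleftrightarrow> x \<in> b_e" using U(3)[OF that] V by blast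
    then show ?thesis unfolding b_e_upper upper_def by (simp add: not_le)
  qed
  show "\<exists>U \<Phi> \<Psi> S. open U \<and> p \<in> U \<and> U \<subseteq> W \<and> open (\<Phi> ` U) \<and> holo_map_on U \<Phi> \<and>
      holo_map_on (\<Phi> ` U) \<Psi> \<and> (\<forall>x\<in>U. \<Psi> (\<Phi> x) = x) \<and> card S = d_fun CARD('n) \<and>
      \<Phi> ` (U \<inter> V) = {y \<in> \<Phi> ` U. \<forall>i j. (i, j) \<notin> S \<longrightarrow> y $ i $ j = 0}"
  proof (rule exI[of _ U], rule exI[of _ ?\<Phi>], rule exI[of _ "\<lambda>x. x + eH"], rule exI[of _ ?S], intro conjI)
    show "?\<Phi> ` (U \<inter> V) = {y \<in> ?\<Phi> ` U. \<forall>i j. (i, j) \<notin> ?S \<longrightarrow> y $ i $ j = 0}"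
      using * by blast
    show "open (?\<Phi> ` U)" using U(1) by (rule open_translation_subtract)
  qed (use U card_upper in \<open>auto intro!: holo_map_on_diff holo_map_on_add holo_map_on_id holo_map_on_const\<close>)
qed

lemma mm_munit: "((A :: 'n::finite cmat) ** munit a b) $ i $ j = (if j = b then A $ i $ a else 0)"
proof -
  have "(A ** munit a b) $ i $ j = (\<Sum>k\<in>UNIV. if k = a then (if j = b then A $ i $ a else 0) else 0)"
    unfolding mm_nth by (intro sum.cong) (auto simp: munit_def)
  then show ?thesis by simp
qed

lemma holo_map_on_hat:
  fixes f :: "'n::{finite,linorder} cmat \<Rightarrow> 'n cmat"
  assumes "holo_map_on U f"
  shows "holo_map_on U (\<lambda>x. hat (f x))"
  unfolding holo_map_on_def
proof (intro allI)
  fix i j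
  show "holo_on U (\<lambda>x. hat (f x) $ i $ j)"
    using assms by (cases "rk j = CARD('n)") (simp_all add: hat_def holo_on_const holo_map_on_def)
qed

text \<open>
  On Hessenberg matrices \<open>x\<close>, the equation \<open>f(x) e\<^sub>1 = 0\<close> with \<open>f\<close> the characteristic polynomial
  of the orbit expresses the last column of \<open>x\<close> as a polynomial in the other columns.
\<close>

lemma submanifold_orbit:
  fixes V :: "('n::{finite,linorder} cmat) set"
  assumes V: "V \<subseteq> b_e" "\<And>x. x \<in> V \<Longrightarrow> \<exists>\<nu>. (\<nu>, x) \<in> M_Omega_e"
    and ev: "\<And>p. p \<in> V \<Longrightarrow> \<forall>\<^sub>F x in nhds p. x \<in> b_e \<longrightarrow> x \<in> V"
  shows "\<exists>k. submanifold_of UNIV k (adjoint_orbit (diag c) \<inter> V)"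
proof -
  let ?N = "CARD('n)" and ?O = "adjoint_orbit (diag c)"
  \<comment> \<open>The coordinates left free: upper triangular positions outside the last
    column.\<close>
  let ?S = "{(i :: 'n, j :: 'n). rk i \<le> rk j \<and> rk j \<noteq> ?N}"
  \<comment> \<open>\<open>G h\<close> carries the vector \<open>mprod (evs c) h *v e1\<close> in
    its last column and is zero elsewhere. As \<open>hat\<close> ignores the last column, adding
    \<open>G (hat x)\<close> is a shear, inverted by subtracting the same term.\<close>
  define G :: "'n cmat \<Rightarrow> 'n cmat" where "G h = mprod (evs c) h ** munit (ix (Suc 0)) (ix ?N)" for h
  define \<Phi> where "\<Phi> x = x - eH + G (hat x)" for x
  define \<Psi> where "\<Psi> y = y + eH - G (hat (y + eH))" for y
  have G: "G h $ i $ j = (if rk j = ?N then (mprod (evs c) h *v e1) $ i else 0)" for h i j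
    unfolding G_def mm_munit mv_axis by (auto simp flip: rk_eq_iff)
  have e0: "eH $ i $ j = 0" if "rk j = ?N" for i j :: 'n
    using that rk_le[of i] by (auto simp: eH_def simp del: rk_le)
  have hG: "hat (x + G h) = hat x" "hat (x - G h) = hat x" for x h
    by (simp_all add: hat_def vec_eq_iff G)
  have \<Psi>\<Phi>: "\<Psi> (\<Phi> x) = x" for x
  proof -
    have "\<Phi> x + eH = x + G (hat x)" by (simp add: \<Phi>_def)
    then show ?thesis by (simp add: \<Psi>_def hG)
  qed
  have \<Phi>\<Psi>: "\<Phi> (\<Psi> y) = y" for y
    by (simp add: \<Phi>_def \<Psi>_def hG)
  have hol: "holo_map_on U \<Phi>" "holo_map_on U \<Psi>" for U
    unfolding \<Phi>_def \<Psi>_def G_def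
    by (intro holo_map_on_add holo_map_on_diff holo_map_on_mm holo_map_on_mprod holo_map_on_hat
        holo_map_on_id holo_map_on_const)+
  have chart: "x \<in> ?O \<inter> V \<longleftrightarrow> (\<forall>i j. (i, j) \<notin> ?S \<longrightarrow> \<Phi> x $ i $ j = 0)"
    if x: "x \<in> b_e \<longrightarrow> x \<in> V" for x
  proof -
    have "x \<in> ?O \<inter> V \<longleftrightarrow> x \<in> b_e \<and> (\<forall>i. (mprod (evs c) (hat x) *v e1) $ i + x $ i $ ix ?N = 0)"
      using x V b_e_orbit_iff by blast
    also have "\<dots> \<longleftrightarrow> (\<forall>i j. (i, j) \<notin> ?S \<longrightarrow> \<Phi> x $ i $ j = 0)"
    proof
      assume *: "x \<in> b_e \<and> (\<forall>i. (mprod (evs c) (hat x) *v e1) $ i + x $ i $ ix ?N = 0)"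
      show "\<forall>i j. (i, j) \<notin> ?S \<longrightarrow> \<Phi> x $ i $ j = 0"
      proof (intro allI impI)
        fix i j assume ij: "(i, j) \<notin> ?S"
        show "\<Phi> x $ i $ j = 0"
        proof (cases "rk j = ?N")
          case True
          then have "j = ix ?N" by (metis ix_rk)
          then show ?thesis using * e0[OF True, of i] True by (simp add: \<Phi>_def G add.commute)
        next
          case False
          then show ?thesis using * ij unfolding b_e_upper upper_def by (simp add: \<Phi>_def G not_le)
        qed
      qed
    next
      assume *: "\<forall>i j. (i, j) \<notin> ?S \<longrightarrow> \<Phi> x $ i $ j = 0"
      have "(mprod (evs c) (hat x) *v e1) $ i + x $ i $ ix ?N = 0" for i
      proof -
        have r: "rk (ix ?N :: 'n) = ?N" by simp
        then have "\<Phi> x $ i $ ix ?N = 0" using * by auto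
        then show ?thesis using e0[OF r, of i] r by (simp add: \<Phi>_def G add.commute)
      qed
      moreover have "upper (x - eH)"
        unfolding upper_def
      proof (intro allI impI)
        fix i j :: 'n assume ij: "rk j < rk i"
        then have N: "rk j \<noteq> ?N" using rk_le[of i] by linarith
        then have "\<Phi> x $ i $ j = 0" using * ij by auto
        then show "(x - eH) $ i $ j = 0" using N by (simp add: \<Phi>_def G)
      qed
      ultimately show "x \<in> b_e \<and> (\<forall>i. (mprod (evs c) (hat x) *v e1) $ i + x $ i $ ix ?N = 0)"
        by (simp add: b_e_upper)
    qed
    finally show ?thesis .
  qed
  have "submanifold_of UNIV (card ?S) (?O \<inter> V)"
    unfolding submanifold_of_def
  proof (intro conjI ballI)
    fix p assume "p \<in> ?O \<inter> V"
    then obtain U where U: "open U" "p \<in> U" "\<And>x. x \<in> U \<Longrightarrow> x \<in> b_e \<longrightarrow> x \<in> V"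
      using ev[of p] unfolding eventually_nhds by blast
    have "\<Phi> ` U = \<Psi> -` U" using \<Psi>\<Phi> \<Phi>\<Psi> by (auto intro: rev_image_eqI)
    then have op: "open (\<Phi> ` U)"
      using open_vimage[OF U(1) holo_map_on_continuous[OF hol(2)]] by simp
    have im: "\<Phi> ` (U \<inter> (?O \<inter> V)) = {y \<in> \<Phi> ` U. \<forall>i j. (i, j) \<notin> ?S \<longrightarrow> y $ i $ j = 0}"
      using chart[OF U(3)] by blast
    show "\<exists>U \<Phi> \<Psi> S. open U \<and> p \<in> U \<and> U \<subseteq> UNIV \<and> open (\<Phi> ` U) \<and> holo_map_on U \<Phi> \<and>
      holo_map_on (\<Phi> ` U) \<Psi> \<and> (\<forall>x\<in>U. \<Psi> (\<Phi> x) = x) \<and> card S = card ?S \<and>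
      \<Phi> ` (U \<inter> (?O \<inter> V)) = {y \<in> \<Phi> ` U. \<forall>i j. (i, j) \<notin> S \<longrightarrow> y $ i $ j = 0}"
      by (rule exI[of _ U], rule exI[of _ \<Phi>], rule exI[of _ \<Psi>], rule exI[of _ ?S])
        (simp add: U(1,2) op im hol \<Psi>\<Phi>)
  qed simp
  then show ?thesis ..
qed


section \<open>Tangent spaces\<close>

lemma commutator_neg: "commutator (- u) y = commutator y (u :: 'n::finite cmat)"
  by (simp add: commutator_def mm_distrib)

text \<open>\<open>mprod (replicate k 0) u\<close> is the k-th power of \<open>u\<close>; every
  factor moves the nonzero entries one diagonal further up.\<close>

lemma mprod_zeros_strictly_upper:
  assumes "strictly_upper u"
  shows "rk j < rk i + k \<Longrightarrow> mprod (replicate k 0) u $ i $ j = 0"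
proof (induction k arbitrary: i)
  case 0
  then show ?case by (auto simp: mat1_nth)
next
  case (Suc k)
  have "(u ** mprod (replicate k 0) u) $ i $ j = 0"
    unfolding mm_nth
  proof (intro sum.neutral ballI)
    fix l
    show "u $ i $ l * mprod (replicate k 0) u $ l $ j = 0"
      using assms Suc.IH[of l] Suc.prems unfolding strictly_upper_def by (cases "rk l \<le> rk i") auto
  qed
  then show ?case by simp
qed

text \<open>The geometric series for the inverse terminates because \<open>u\<close> is nilpotent.
  Being polynomial in \<tau>, it is continuous, and it is visibly upper triangular.\<close>

lemma unipotent_inverse:
  fixes u :: "'n::{finite,linorder} cmat"
  assumes u: "strictly_upper u"
  defines "h \<equiv> \<lambda>\<tau>. \<Sum>k<CARD('n). cscale ((- \<tau>) ^ k) (mprod (replicate k 0) u)"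
  shows "(mat 1 + cscale \<tau> u) ** h \<tau> = mat 1" "upper (h \<tau>)" "h 0 = mat 1"
proof -
  let ?N = "CARD('n)" and ?p = "\<lambda>k. mprod (replicate k 0) u"
  have pN: "?p ?N = 0"
  proof (rule cmat_eqI)
    fix i j :: 'n
    have "rk j < rk i + ?N" using rk_le[of j] rk_ge1[of i] by linarith
    then show "?p ?N $ i $ j = 0 $ i $ j" using mprod_zeros_strictly_upper[OF u] by simp
  qed
  have "(mat 1 + cscale \<tau> u) ** h \<tau> = (\<Sum>k<?N. cscale ((- \<tau>) ^ k) (?p k) - cscale ((- \<tau>) ^ Suc k) (?p (Suc k)))"
    by (simp add: h_def mm_distrib mm_sum cscale_distrib mult.commute flip: sum.distrib)
  also have "\<dots> = cscale ((- \<tau>) ^ 0) (?p 0) - cscale ((- \<tau>) ^ ?N) (?p ?N)"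
    by (rule sum_lessThan_telescope')
  finally show "(mat 1 + cscale \<tau> u) ** h \<tau> = mat 1" by (simp add: pN)
  have "?p k $ i $ j = 0" if "rk j < rk i" for k and i j :: 'n
    using that by (intro mprod_zeros_strictly_upper[OF u]) simp
  then show "upper (h \<tau>)"
    unfolding upper_def h_def sum_component by simp
  have "h 0 = (\<Sum>k<?N. if k = 0 then mat 1 else 0)"
    unfolding h_def by (intro sum.cong) (auto simp: power_0_left)
  then show "h 0 = mat 1" by (simp add: sum.delta)
qed

text \<open>Conjugating \<open>y\<close> by 1 - t u gives a curve in the orbit. It equals
  \<open>y\<close> plus t times the commutator times the upper triangular inverse, so it differs
  from \<open>y\<close> by an upper triangular matrix and stays Hessenberg, not just to first
  order.\<close>

lemma tangent_space_supset:
  fixes V :: "('n::{finite,linorder} cmat) set"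
  assumes V: "V \<subseteq> b_e" and ev: "\<forall>\<^sub>F x in nhds y. x \<in> b_e \<longrightarrow> x \<in> V"
    and y: "y \<in> adjoint_orbit a \<inter> V" and u: "strictly_upper u"
  shows "commutator y u \<in> tangent_space (adjoint_orbit a \<inter> V) y"
proof -
  have ye: "y \<in> b_e" using y V by blast
  let ?w = "- u"
  have w: "strictly_upper ?w" using u by (simp add: strictly_upper_def)
  define h where "h \<tau> = (\<Sum>k<CARD('n). cscale ((- \<tau>) ^ k) (mprod (replicate k 0) ?w))" for \<tau>
  note hh = unipotent_inverse[OF w, folded h_def]
  define C where "C = commutator ?w y"
  have C: "C = commutator y u" by (simp add: C_def commutator_neg)
  define g where "g t = mat 1 + cscale (of_real t) ?w" for t :: real
  define \<gamma> where "\<gamma> t = g t ** y ** h (of_real t)" for t :: real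
  have gh: "g t ** h (of_real t) = mat 1" for t by (simp add: g_def hh(1))
  then have hg: "h (of_real t) ** g t = mat 1" for t by (simp add: matrix_left_right_inverse)
  have \<gamma>: "\<gamma> t = y + cscale (of_real t) (C ** h (of_real t))" for t
  proof -
    have "y = y ** (g t ** h (of_real t))" by (simp add: gh)
    then have "\<gamma> t - y = (g t ** y - y ** g t) ** h (of_real t)"
      unfolding \<gamma>_def by (simp add: mm_distrib mm_assoc)
    also have "g t ** y - y ** g t = cscale (of_real t) C"
      by (simp add: g_def C_def commutator_def mm_distrib cscale_distrib)
    finally show ?thesis by (simp add: mm_distrib algebra_simps)
  qed
  have orb: "\<gamma> t \<in> adjoint_orbit a" for t
  proof -
    have "\<gamma> t \<in> adjoint_orbit y" unfolding adjoint_orbit_iff \<gamma>_def using gh hg by blast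
    then show ?thesis using y adjoint_orbit_trans by blast
  qed
  have be: "\<gamma> t \<in> b_e" for t
  proof -
    have "upper ((y - eH) + cscale (of_real t) (C ** h (of_real t)))"
      using upper_commutator[OF u ye] ye hh(2)
      by (intro upper_add upper_cscale upper_mm) (simp_all add: C b_e_upper)
    then show ?thesis by (simp add: b_e_upper \<gamma> algebra_simps)
  qed
  have ht: "((\<lambda>t. h (of_real t)) \<longlongrightarrow> h (of_real 0)) (nhds 0)"
    unfolding h_def by (intro tendsto_intros filterlim_ident)
  have "(\<gamma> \<longlongrightarrow> y + cscale (of_real 0) (C ** h (of_real 0))) (nhds 0)"
    unfolding \<gamma> by (intro tendsto_intros ht filterlim_ident)
  then have "(\<gamma> \<longlongrightarrow> y) (nhds 0)" by simp
  from filterlim_iff[THEN iffD1, OF this, rule_format, OF ev]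
  have evV: "\<forall>\<^sub>F t in nhds 0. \<gamma> t \<in> adjoint_orbit a \<inter> V"
    by eventually_elim (use be orb in blast)
  have "(\<gamma> has_vector_derivative C) (at 0)"
    unfolding has_vector_derivative_def has_derivative_within
  proof (intro conjI bounded_linear_scaleR_left)
    have "((\<lambda>t. C ** h (of_real t) - C) \<longlongrightarrow> C ** h (of_real 0) - C) (at 0)"
      using ht by (intro tendsto_intros) (simp add: tendsto_nhds_iff)
    then have lim: "((\<lambda>t. norm (C ** h (of_real t) - C)) \<longlongrightarrow> 0) (at 0)"
      by (simp add: hh(3) tendsto_norm_zero)
    show "((\<lambda>t. (1 / norm (t - 0)) *\<^sub>R (\<gamma> t - (\<gamma> 0 + (t - 0) *\<^sub>R C))) \<longlongrightarrow> 0) (at 0)"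
    proof (rule Lim_null_comparison[OF always_eventually[OF allI] lim])
      fix t :: real
      have "cscale (of_real t) A = t *\<^sub>R A" for A :: "'n cmat"
        by (rule cmat_eqI) (simp only: cscale_nth vector_scaleR_component, simp only: scaleR_conv_of_real)
      then have "\<gamma> t - (\<gamma> 0 + (t - 0) *\<^sub>R C) = t *\<^sub>R (C ** h (of_real t) - C)"
        by (simp add: \<gamma> scaleR_diff_right)
      then show "norm ((1 / norm (t - 0)) *\<^sub>R (\<gamma> t - (\<gamma> 0 + (t - 0) *\<^sub>R C))) \<le> norm (C ** h (of_real t) - C)"
        by (cases "t = 0") auto
    qed
  qed
  moreover have "\<gamma> 0 = y" by (simp add: \<gamma>)
  ultimately show ?thesis
    unfolding tangent_space_def C[symmetric] using evV by blast
qed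

lemma constant_derivative:
  fixes f :: "real \<Rightarrow> 'a::real_normed_vector"
  assumes "\<forall>\<^sub>F t in nhds 0. f t = c" "(f has_vector_derivative v) (at 0)"
  shows "v = 0"
proof -
  have "((\<lambda>t. c) has_vector_derivative v) (at 0)"
  proof -
    have "\<forall>\<^sub>F t in at 0. f t = c" "f 0 = c"
      using assms(1) eventually_nhds_x_imp_x[OF assms(1)]
      by (auto simp: eventually_at_filter elim: eventually_mono)
    then show ?thesis
      using assms(2) unfolding has_vector_derivative_def
      by (auto intro: has_derivative_transform_eventually)
  qed
  then show ?thesis
    using vector_derivative_unique_at has_vector_derivative_const by blast
qed

text \<open>Below the diagonal the curve is constant, so \<open>v\<close> is upper triangular. The
  eigenvalues along the curve are continuous with values in the finite range of \<open>c\<close>,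
  hence locally constant, so \<open>v\<close> pairs to zero with each spectral projection; this
  makes \<open>v\<close> a commutator with \<open>y\<close>, and cyclicity improves the second
  factor.\<close>

lemma tangent_space_subset:
  fixes V :: "('n::{finite,linorder} cmat) set"
  assumes V: "V \<subseteq> b_e" "\<And>x. x \<in> V \<Longrightarrow> \<exists>\<nu>. (\<nu>, x) \<in> M_Omega_e"
    and y: "y \<in> adjoint_orbit (diag c) \<inter> V"
    and v: "v \<in> tangent_space (adjoint_orbit (diag c) \<inter> V) y"
  obtains u where "strictly_upper u" "v = commutator y u"
proof -
  let ?O = "adjoint_orbit (diag c)" and ?N = "CARD('n)"
  have ye: "y \<in> b_e" using y V(1) by blast
  obtain \<gamma> :: "real \<Rightarrow> 'n cmat" where \<gamma>: "\<gamma> 0 = y" "\<forall>\<^sub>F t in nhds 0. \<gamma> t \<in> ?O \<inter> V"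
    "(\<gamma> has_vector_derivative v) (at 0)"
    using v unfolding tangent_space_def by blast
  have ent: "((\<lambda>t. \<gamma> t $ i $ j) has_vector_derivative v $ i $ j) (at 0)" for i j
    using bounded_linear.has_vector_derivative[OF bounded_linear_compose[OF bounded_linear_vec_nth bounded_linear_vec_nth] \<gamma>(3)] .
  have up: "upper v"
    unfolding upper_def
  proof (intro allI impI)
    fix i j :: 'n assume ij: "rk j < rk i"
    have "\<forall>\<^sub>F t in nhds 0. \<gamma> t $ i $ j = (if rk i = Suc (rk j) then 1 else 0)"
      using \<gamma>(2) by eventually_elim (use V(1) b_e_nth[OF _ ij] in blast)
    from constant_derivative[OF this ent] show "v $ i $ j = 0" .
  qed
  obtain \<nu> where z: "(\<nu>, y) \<in> M_Omega_e" using V(2) y by blast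
  obtain U where s: "local_section U (section_at (\<nu>, y))" and yU: "y \<in> U"
    and sy: "section_at (\<nu>, y) y = (\<nu>, y)"
    using section_at[OF z] by auto
  have "isCont \<gamma> 0" using \<gamma>(3) by (rule has_vector_derivative_continuous)
  then have \<gamma>lim: "(\<gamma> \<longlongrightarrow> y) (nhds 0)" by (simp add: isCont_def tendsto_nhds_iff \<gamma>(1))
  have evU: "\<forall>\<^sub>F t in nhds 0. \<gamma> t \<in> U"
    using \<gamma>lim s yU by (intro topological_tendstoD) (auto simp: local_section_def)
  have trP: "trace (Prj \<nu> ?N k y ** v) = 0" if k: "k \<in> {1..?N}" for k
  proof -
    let ?f = "\<lambda>x. fst (section_at (\<nu>, y) x) k ?N"
    have f: "(?f has_derivative (\<lambda>v. trace (Prj \<nu> ?N k y ** v))) (at (\<gamma> 0))"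
      using has_derivative_eigenvalue[OF s yU k order_refl] by (simp add: sy \<gamma>(1))
    have "((\<lambda>t. ?f (\<gamma> t)) has_derivative (\<lambda>t. trace (Prj \<nu> ?N k y ** (t *\<^sub>R v)))) (at 0)"
      using has_derivative_compose[OF \<gamma>(3)[unfolded has_vector_derivative_def] f] .
    then have d: "((\<lambda>t. ?f (\<gamma> t)) has_vector_derivative trace (Prj \<nu> ?N k y ** v)) (at 0)"
      unfolding has_vector_derivative_def linear_simps(5)[OF bounded_linear_trace] .
    have "((\<lambda>t. ?f (\<gamma> t)) \<longlongrightarrow> \<nu> k ?N) (nhds 0)"
      using filterlim_compose[OF local_section_tendsto[OF s yU, of k ?N] \<gamma>lim] by (simp add: sy)
    moreover have "\<forall>\<^sub>F t in nhds 0. ?f (\<gamma> t) \<in> set (evs c)"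
      using \<gamma>(2) evU
    proof eventually_elim
      case (elim t)
      show ?case
        using eigenvalue_in_evs[OF local_section_eq[OF s elim(2)] mprod_evs k] elim(1) by blast
    qed
    \<comment> \<open>Removing the finitely many other roots leaves an open set, so continuity pins
      the eigenvalue to its initial value.\<close>
    moreover have "open (- (set (evs c) - {\<nu> k ?N}))"
      by (intro open_Compl finite_imp_closed) simp
    ultimately have "\<forall>\<^sub>F t in nhds 0. ?f (\<gamma> t) \<in> - (set (evs c) - {\<nu> k ?N})"
      by (intro topological_tendstoD) auto
    with \<open>\<forall>\<^sub>F t in nhds 0. ?f (\<gamma> t) \<in> set (evs c)\<close>
    have "\<forall>\<^sub>F t in nhds 0. ?f (\<gamma> t) = \<nu> k ?N" by eventually_elim blast
    from constant_derivative[OF this d] show ?thesis .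
  qed
  obtain g g' :: "'n cmat" where g: "g ** g' = mat 1" "g' ** g = mat 1"
    "y = g ** dgm (\<lambda>k. \<nu> k ?N) ?N ** g'"
    and P: "\<And>k. k \<in> {1..?N} \<Longrightarrow> Prj \<nu> ?N k y = g ** dgm (\<lambda>l. if l = k then 1 else 0) ?N ** g'"
    using spectral_full[OF z] by metis
  let ?D = "dgm (\<lambda>k. \<nu> k ?N) ?N :: 'n cmat"
  define v' where "v' = g' ** v ** g"
  \<comment> \<open>Pairing with the spectral projections reads off the diagonal of \<open>v\<close>
    in the eigenbasis.\<close>
  have v'0: "v' $ i $ i = 0" for i
  proof -
    let ?E = "dgm (\<lambda>l. if l = rk i then 1 else 0) ?N :: 'n cmat"
    have "rk i \<in> {1..?N}" using rk_ge1[of i] by simp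
    with trP P have "0 = trace (g ** ?E ** g' ** v)" by metis
    also have "\<dots> = trace (?E ** v')"
      using trace_mm_sym[of g "?E ** g' ** v"] by (simp add: v'_def mm_assoc)
    also have "\<dots> = (\<Sum>l\<in>UNIV. if l = i then v' $ i $ i else 0)"
      unfolding trace_def dgm_mm_nth by (intro sum.cong) auto
    finally show ?thesis by simp
  qed
  \<comment> \<open>The commutator with a diagonal matrix multiplies entry (i, j) by a difference of
    eigenvalues, which can be divided out off the diagonal; the diagonal of \<open>w'\<close> is
    free and set to 0.\<close>
  define w' where "w' = (\<chi> i j. if i = j then 0 else v' $ i $ j / (\<nu> (rk i) ?N - \<nu> (rk j) ?N))"
  have mD: "(A ** ?D) $ i $ j = A $ i $ j * \<nu> (rk j) ?N" for A :: "'n cmat" and i j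
  proof -
    have "(A ** ?D) $ i $ j = (\<Sum>l\<in>UNIV. if l = j then A $ i $ j * \<nu> (rk j) ?N else 0)"
      unfolding mm_nth by (intro sum.cong) (auto simp: dgm_def)
    then show ?thesis by simp
  qed
  have "commutator ?D w' = v'"
  proof (rule cmat_eqI)
    fix i j :: 'n
    have "\<nu> (rk i) ?N \<noteq> \<nu> (rk j) ?N" if "i \<noteq> j"
    proof
      assume "\<nu> (rk i) ?N = \<nu> (rk j) ?N"
      then have "rk i = rk j"
        using rk_ge1[of i] rk_ge1[of j] by (intro e_Omega_inj[OF M_Omega_e_e[OF z] order_refl]) auto
      with that show False by simp
    qed
    moreover have "commutator ?D w' $ i $ j = w' $ i $ j * (\<nu> (rk i) ?N - \<nu> (rk j) ?N)"
      by (simp add: commutator_def mD dgm_mm_nth algebra_simps)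
    ultimately show "commutator ?D w' $ i $ j = v' $ i $ j"
      by (cases "i = j") (simp_all add: w'_def v'0)
  qed
  have "commutator y (g ** w' ** g') = g ** (?D ** (g' ** g) ** w' - w' ** (g' ** g) ** ?D) ** g'"
    by (simp add: commutator_def g(3) mm_distrib mm_assoc)
  also have "\<dots> = g ** v' ** g'"
    using \<open>commutator ?D w' = v'\<close> by (simp add: g(1,2) commutator_def)
  also have "\<dots> = (g ** g') ** v ** (g ** g')" by (simp add: v'_def mm_assoc)
  also have "\<dots> = v" by (simp add: g(1))
  finally have v: "commutator y (g ** w' ** g') = v" .
  obtain u where "strictly_upper u" "commutator y u = v"
    using strictly_upper_representative[OF ye, of "g ** w' ** g'"] up v by metis
  then show ?thesis using that by metis
qed

lemma lagrangian_orbit: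
  fixes V :: "('n::{finite,linorder} cmat) set"
  assumes V: "V \<subseteq> b_e" "\<And>x. x \<in> V \<Longrightarrow> \<exists>\<nu>. (\<nu>, x) \<in> M_Omega_e"
    and ev: "\<And>p. p \<in> V \<Longrightarrow> \<forall>\<^sub>F x in nhds p. x \<in> b_e \<longrightarrow> x \<in> V"
  shows "lagrangian_in_orbit (adjoint_orbit (diag c)) (adjoint_orbit (diag c) \<inter> V)"
  unfolding lagrangian_in_orbit_def
proof (intro conjI ballI)
  let ?L = "adjoint_orbit (diag c) \<inter> V"
  show "\<exists>k. submanifold_of UNIV k ?L" using V ev by (rule submanifold_orbit)
  fix y assume y: "y \<in> ?L"
  then have ye: "y \<in> b_e" and yV: "y \<in> V" using V(1) by auto
  have T: "tangent_space ?L y = {commutator y u | u. strictly_upper u}"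
    using tangent_space_supset[OF V(1) ev[OF yV] y] tangent_space_subset[OF V y] by blast
  \<comment> \<open>Invariance of the trace pairs the first tangent vector directly with the
    generator of the second, so the form becomes the trace pairing of upper with strictly upper
    triangular matrices.\<close>
  have kks: "kks y (commutator y u) (commutator y w) = trace (commutator y u ** w)" for u w
  proof -
    have "kks y (commutator y u) (commutator y w) = trace (y ** commutator u w)"
      using kks_commutator[of y u w] by (simp add: commutator_neg)
    also have "\<dots> = trace (w ** commutator y u)" by (rule trace_commutator)
    also have "\<dots> = trace (commutator y u ** w)" by (rule trace_mm_sym)
    finally show ?thesis .
  qed
  show "tangent_space ?L y = {\<xi> \<in> orbit_tangent y. \<forall>\<eta>\<in>tangent_space ?L y. kks y \<xi> \<eta> = 0}"
  proof (intro equalityI subsetI)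
    fix \<xi> assume "\<xi> \<in> tangent_space ?L y"
    then obtain u where u: "strictly_upper u" "\<xi> = commutator y u" unfolding T by blast
    have "kks y \<xi> \<eta> = 0" if \<eta>: "\<eta> \<in> tangent_space ?L y" for \<eta>
    proof -
      obtain w where w: "strictly_upper w" "\<eta> = commutator y w" using \<eta> unfolding T by blast
      show ?thesis unfolding u(2) w(2) kks by (rule trace_upper_strictly_upper[OF upper_commutator[OF u(1) ye] w(1)])
    qed
    then show "\<xi> \<in> {\<xi> \<in> orbit_tangent y. \<forall>\<eta>\<in>tangent_space ?L y. kks y \<xi> \<eta> = 0}"
      unfolding orbit_tangent_def u(2) commutator_neg by blast
  next
    fix \<xi> assume *: "\<xi> \<in> {\<xi> \<in> orbit_tangent y. \<forall>\<eta>\<in>tangent_space ?L y. kks y \<xi> \<eta> = 0}"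
    then obtain w where w: "\<xi> = commutator y w" unfolding orbit_tangent_def commutator_neg by blast
    have "upper \<xi>"
    proof (rule upper_if_trace_strictly_upper)
      fix v :: "'n cmat" assume "strictly_upper v"
      then have "kks y \<xi> (commutator y v) = 0" using * unfolding T by blast
      then show "trace (\<xi> ** v) = 0" unfolding w kks .
    qed
    then obtain u where "strictly_upper u" "commutator y u = \<xi>"
      using strictly_upper_representative[OF ye, of w] unfolding w by blast
    then show "\<xi> \<in> tangent_space ?L y" unfolding T by blast
  qed
qed simp

section \<open>From a sheet over \<open>V_x\<close> to neighbourhoods inside
  \<open>W_x\<close>\<close>

theorem theorem5p20:
  fixes x_o :: "'n::{finite,linorder} cmat"
    and z_o :: "tuple \<times> 'n cmat"
    and V_x W_x :: "('n cmat) set"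
    and V_z W_z :: "(tuple \<times> 'n cmat) set"
  assumes "x_o \<in> b_e_Omega"
    and "z_o \<in> M_Omega_e" and "pi_n z_o = x_o"
    and "openin (top_of_set b_e_Omega) V_x" and "x_o \<in> V_x" and "connected V_x"
    and "evenly_covered {z \<in> M_Omega_e. pi_n z \<in> b_e_Omega} pi_n V_x"
    and "V_z = connected_component_set {z \<in> M_Omega_e. pi_n z \<in> V_x} z_o"
    and "W_z = {A_act q z | q z. z \<in> V_z}"
    and "W_x = pi_n ` W_z"
  shows "lagrangian_in W_x V_x"
proof -
  let ?C = "{z \<in> M_Omega_e. pi_n z \<in> (b_e_Omega :: 'n cmat set)}"
  from assms(7)[unfolded evenly_covered_def] obtain \<U> where \<U>0: "\<Union>\<U> = ?C \<inter> pi_n -` V_x \<and>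
     (\<forall>U\<in>\<U>. openin (top_of_set ?C) U) \<and> pairwise disjnt \<U> \<and> (\<forall>U\<in>\<U>. \<exists>q. homeomorphism U V_x pi_n q)" ..
  have \<U>: "\<Union>\<U> = ?C \<inter> pi_n -` V_x" "\<And>U. U \<in> \<U> \<Longrightarrow> openin (top_of_set ?C) U"
    "\<And>U. U \<in> \<U> \<Longrightarrow> \<exists>q. homeomorphism U V_x pi_n q"
    using \<U>0 by simp_all
  have "z_o \<in> ?C \<inter> pi_n -` V_x" using assms(1-3,5) by auto
  then obtain U where U: "U \<in> \<U>" "z_o \<in> U" using \<U>(1) by blast
  obtain q where q: "homeomorphism U V_x pi_n q" using \<U>(3)[OF U(1)] by blast
  \<comment> \<open>The sheet through \<open>z_o\<close> is homeomorphic to the connected set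
    \<open>V_x\<close>, so it lies in the connected component \<open>V_z\<close>.\<close>
  have "connected U"
    using connected_continuous_image[of V_x q] q assms(6) by (auto simp: homeomorphism_def)
  moreover have "U \<subseteq> {z \<in> M_Omega_e. pi_n z \<in> V_x}" using \<U>(1) U(1) by blast
  ultimately have UV: "U \<subseteq> V_z" unfolding assms(8) using U(2) by (intro connected_component_maximal)
  \<comment> \<open>\<open>T\<close> is the open set that \<open>A_act_near\<close> receives: a lift
    in \<open>T\<close> over a Hessenberg matrix lies on the sheet \<open>U\<close>.\<close>
  obtain T where T: "open T" "U = ?C \<inter> T" using \<U>(2)[OF U(1)] by (auto simp: openin_open)
  obtain R where R: "open R" "V_x = b_e_Omega \<inter> R" using assms(4) by (auto simp: openin_open)
  have Ve: "V_x \<subseteq> b_e" using R by (auto simp: b_e_Omega_def)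
  have lift: "\<exists>\<nu>. (\<nu>, p) \<in> U" if "p \<in> V_x" for p
  proof -
    have "p \<in> pi_n ` U" using q that by (simp add: homeomorphism_def)
    then show ?thesis by auto
  qed
  have V\<nu>: "\<exists>\<nu>. (\<nu>, p) \<in> M_Omega_e" if "p \<in> V_x" for p
    using lift[OF that] T(2) by blast
  \<comment> \<open>Openness of \<open>M_Omega\<close> is used in the form that lifts exist over all
    nearby matrices; any positive radius would do for them.\<close>
  have evV: "\<forall>\<^sub>F x in nhds p. x \<in> b_e \<longrightarrow> x \<in> V_x" if p: "p \<in> V_x" for p
  proof -
    obtain \<nu> where "(\<nu>, p) \<in> M_Omega_e" using V\<nu>[OF p] by blast
    then have "\<forall>\<^sub>F x in nhds p. \<exists>\<nu>'. (\<nu>', x) \<in> M_Omega_e \<and> (\<forall>k m. cmod (\<nu>' k m - \<nu> k m) < 1)"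
      by (rule M_Omega_e_near) simp
    moreover have "\<forall>\<^sub>F x in nhds p. x \<in> R" using R p by (intro eventually_nhds_in_open) auto
    ultimately show ?thesis
      by eventually_elim (auto simp: R(2) b_e_Omega_def M_Omega_e_def)
  qed
  \<comment> \<open>It suffices that a full neighbourhood of each point of \<open>V_x\<close>
    consists of torus translates of points of the sheet.\<close>
  have evW: "\<forall>\<^sub>F x in nhds p. x \<in> W_x" if p: "p \<in> V_x" for p
  proof -
    obtain \<nu> where z: "(\<nu>, p) \<in> U" using lift[OF p] by blast
    have "\<forall>\<^sub>F x in nhds p. \<exists>w q. w \<in> T \<and> w \<in> M_Omega_e \<and> snd w \<in> b_e \<and> snd (A_act q w) = x"
      using z T Ve p by (intro A_act_near) auto
    then show ?thesis
    proof eventually_elim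
      case (elim x)
      then obtain w q where w: "w \<in> T" "w \<in> M_Omega_e" "snd w \<in> b_e" "snd (A_act q w) = x" by blast
      have "w \<in> U" using w unfolding T(2) by (auto simp: b_e_Omega_def M_Omega_e_def)
      then have "A_act q w \<in> W_z" using UV unfolding assms(9) by blast
      then show ?case unfolding assms(10) using w(4) by blast
    qed
  qed
  have "submanifold_of W_x (d_fun CARD('n)) V_x"
    using Ve
  proof (rule submanifold_b_e)
    fix p assume "p \<in> V_x"
    from evW[OF this] evV[OF this]
    show "\<forall>\<^sub>F x in nhds p. x \<in> W_x \<and> (x \<in> b_e \<longrightarrow> x \<in> V_x)" by eventually_elim blast
  qed
  moreover have "lagrangian_in_orbit (adjoint_orbit a) (adjoint_orbit a \<inter> V_x)"
    if a: "regular_semisimple a" for a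
  proof -
    \<comment> \<open>A regular semisimple orbit contains a diagonal matrix, which reduces the claim
      to the orbits of \<open>diag c\<close>.\<close>
    obtain c where a: "a \<in> adjoint_orbit (diag c)"
      using a unfolding regular_semisimple_def by blast
    then have "adjoint_orbit a = adjoint_orbit (diag c)"
      using adjoint_orbit_trans adjoint_orbit_sym by blast
    then show ?thesis using lagrangian_orbit[OF Ve V\<nu> evV] by simp
  qed
  ultimately show ?thesis unfolding lagrangian_in_def by blast
qed

end
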